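(* For any Marcinkiewicz multiplier $m:\mathbb{R}\to\mathbb{C}$, $\Lambda_m:L^1(\mathbb{T})\to L^{1,\infty}(\mathbb{T})$ and $\Lambda_m:L^p(\mathbb{T})\to L^p(\mathbb{T})$ for $1<p<\infty$.
   Context: $\mathbb{T}=\mathbb{R}/\mathbb{Z}$ with Lebesgue (probability) measure; $\widehat f(n)=\int_{\mathbb{T}}f(x)e^{-2\pi inx}\,dx$ for $n\in\mathbb{Z}$; $\|f\|_p=(\int|f|^p)^{1/p}$; $\|f\|_{1,\infty}=\sup_{\lambda>0}\lambda\,|\{|f|>\lambda\}|$, and $L^{1,\infty}(\mathbb{T})$ is the space of functions for which this is finite. A function $m:\mathbb{R}\to\mathbb{C}$ that is smooth away from $0$ and uniformly bounded (everywhere, including at $0$) is a Marcinkiewicz multiplier if $|m^{(l)}(t)|\lesssim|t|^{-l}$ for $0\le l\le4$, where $A\lesssim B$ means $A\le CB$ for some constant $C$. For $f\in L^1(\mathbb{T})$, the operator is defined by $\Lambda_mf(x)=\sum_{t\in\mathbb{Z}}m(t)\widehat f(t)e^{2\pi itx}$. Writing $T:X\to Y$ means that $T$ maps boundedly: there is a constant $C$ with $\|Tf\|_Y\le C\|f\|_X$ for all $f$. *)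

theory Defs
  imports "HOL-Analysis.Analysis"
begin

text \<open>
  The circle R/Z is represented by its fundamental domain [0,1) with Lebesgue measure: a function
  on R/Z is a function on the reals of which only the values on [0,1) matter.
\<close>

definition torus :: "real measure"
  where "torus = lebesgue_on {0..<1}"

definition character :: "int \<Rightarrow> real \<Rightarrow> complex"
  where "character n x = exp (2 * of_real pi * \<i> * of_int n * of_real x)"

definition fourier_coeff :: "(real \<Rightarrow> complex) \<Rightarrow> int \<Rightarrow> complex"
  where "fourier_coeff f n = (LINT x|torus. f x * character (- n) x)"

definition Lp :: "real \<Rightarrow> (real \<Rightarrow> complex) set"
  where "Lp p = {f \<in> borel_measurable torus. integrable torus (\<lambda>x. norm (f x) powr p)}"

definition Lp_norm :: "real \<Rightarrow> (real \<Rightarrow> complex) \<Rightarrow> real"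
  where "Lp_norm p f = (LINT x|torus. norm (f x) powr p) powr (1 / p)"

definition distribution_fun :: "(real \<Rightarrow> complex) \<Rightarrow> real \<Rightarrow> real"
  where "distribution_fun f a = measure torus {x \<in> space torus. norm (f x) > a}"

definition weak_L1 :: "(real \<Rightarrow> complex) set"
  where "weak_L1 =
    {f \<in> borel_measurable torus. bdd_above ((\<lambda>a. a * distribution_fun f a) ` {0<..})}"

definition weak_L1_norm :: "(real \<Rightarrow> complex) \<Rightarrow> real"
  where "weak_L1_norm f = (SUP a\<in>{0<..}. a * distribution_fun f a)"

definition nth_derivative :: "nat \<Rightarrow> (real \<Rightarrow> complex) \<Rightarrow> real \<Rightarrow> complex"
  where "nth_derivative l m = ((\<lambda>g t. vector_derivative g (at t)) ^^ l) m"

definition smooth_away_from_0 :: "(real \<Rightarrow> complex) \<Rightarrow> bool"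
  where "smooth_away_from_0 m \<longleftrightarrow> (\<forall>l. \<forall>t. t \<noteq> 0 \<longrightarrow> nth_derivative l m differentiable (at t))"

definition marcinkiewicz_multiplier :: "(real \<Rightarrow> complex) \<Rightarrow> bool"
  where "marcinkiewicz_multiplier m \<longleftrightarrow>
    smooth_away_from_0 m \<and> bounded (range m) \<and>
    (\<exists>C. \<forall>l\<le>4. \<forall>t. t \<noteq> 0 \<longrightarrow> norm (nth_derivative l m t) \<le> C / \<bar>t\<bar> ^ l)"

definition multiplier_partial_sum ::
    "(real \<Rightarrow> complex) \<Rightarrow> (real \<Rightarrow> complex) \<Rightarrow> nat \<Rightarrow> real \<Rightarrow> complex"
  where "multiplier_partial_sum m f N x =
    (\<Sum>t\<in>{- int N..int N}. m (of_int t) * fourier_coeff f t * character t x)"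

definition converges_in_measure :: "(nat \<Rightarrow> real \<Rightarrow> complex) \<Rightarrow> (real \<Rightarrow> complex) \<Rightarrow> bool"
  where "converges_in_measure F g \<longleftrightarrow>
    g \<in> borel_measurable torus \<and>
    (\<forall>\<epsilon>>0. (\<lambda>N. distribution_fun (\<lambda>x. F N x - g x) \<epsilon>) \<longlonglongrightarrow> 0)"

text \<open>
  For an integrable function the series defining the multiplier operator need not converge at any
  point (already when the multiplier is constantly 1).  Its sum is therefore the limit in measure
  of the symmetric partial sums, which is unique up to null sets; Hilbert choice picks a
  representative.  The value is meaningful only where the limit exists.
\<close>

definition multiplier_op :: "(real \<Rightarrow> complex) \<Rightarrow> (real \<Rightarrow> complex) \<Rightarrow> real \<Rightarrow> complex"
  where "multiplier_op m f = (SOME g. converges_in_measure (multiplier_partial_sum m f) g)"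

definition maps_boundedly ::
    "('a \<Rightarrow> 'b) \<Rightarrow> 'a set \<Rightarrow> ('a \<Rightarrow> real) \<Rightarrow> 'b set \<Rightarrow> ('b \<Rightarrow> real) \<Rightarrow> bool"
  where "maps_boundedly T X norm_X Y norm_Y \<longleftrightarrow>
    (\<exists>C. \<forall>f\<in>X. T f \<in> Y \<and> norm_Y (T f) \<le> C * norm_X f)"

end

theory Submission
  imports Defs
begin

text \<open>
  The partial sums are bounded uniformly in their length, from the integrable functions to weak
  \<open>L\<^sup>1\<close> and on every \<open>L\<^sup>p\<close>, and the limit inherits the bounds.

  For a sequence on the nonnegative integers with \<open>\<bar>\<Delta>\<^sup>l a t\<bar> \<le> A / t\<^sup>l\<close>, \<open>l \<le> 3\<close>, summation by parts
  shows that the kernel \<open>K\<close> satisfies \<open>\<bar>K' x\<bar> \<le> C / \<bar>1 - e x\<bar>\<^sup>2\<close> with \<open>e x = exp (2 \<pi> i x)\<close>, so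
  Calderon-Zygmund theory applies. The dyadic stopping time is stopped at a fine scale; since the kernel is a trigonometric
  polynomial, the unselected intervals contribute a uniformly small amount and no differentiation
  theorem is needed. A multiplier cut off sharply at \<open>N\<close> is the sum of a smoothly cut off one and of
  the modulation by \<open>N\<close> of a reflected one, which makes the estimate uniform in \<open>N\<close>; negative
  frequencies are treated by conjugation. Bessel's inequality, interpolation and duality give
  the \<open>L\<^sup>p\<close> bounds. The partial sums of a square integrable function are Cauchy in \<open>L\<^sup>2\<close>, so the weak
  bound and truncation give convergence in measure for every integrable function.
\<close>

section \<open>Fourier sums on the circle\<close>

text \<open>A sharp cutoff at \<open>N\<close> destroys the difference bounds near \<open>N\<close>.
  With \<open>cutoff N t + cutoff N (N - t) = 1\<close> on \<open>0..N\<close>, the jump sits in the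
  second piece, and the reflection \<open>s = N - t\<close> carries it to index 0, where a one-sided
  sum starts anyway. The price is paid at the other end: near \<open>s = N\<close> the reflected
  multiplier is singular, its \<open>i\<close>-th difference being of size
  \<open>1 / (N - s)^i\<close>. A cutoff with a zero of order three absorbs up to three such
  factors, which dictates the quintic. Three differences enter because the derivative of the kernel
  has coefficients \<open>t * a t\<close>: their second difference is only of size
  \<open>1 / t\<close>, the third one is of size \<open>1 / t^2\<close> and hence summable. All
  constants are explicit numbers times powers of \<open>A\<close>, so that independence of the
  length of the sum can be read off the statements. Differences of two points of [0,1) fill (-1,1).
  The distance on the circle is therefore replaced everywhere by the three translates by -1, 0 and
  1.\<close>

lemma space_torus [simp]: "space torus = {0..<1}"
  by (simp add: torus_def)

interpretation torus: finite_measure torus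
  unfolding torus_def by (rule finite_measure_lebesgue_on) (auto intro: bounded_set_imp_lmeasurable)

lemma measure_torus: "A \<subseteq> {0..<1} \<Longrightarrow> measure torus A = measure lebesgue A"
  unfolding torus_def by (rule measure_restrict_space) auto

lemma measure_torus_space [simp]: "measure torus {0..<1} = 1"
  by (simp add: measure_torus)

lemma borel_measurable_torusI: "f \<in> measurable borel M \<Longrightarrow> f \<in> measurable torus M"
  unfolding torus_def
  by (rule measurable_restrict_space1, rule measurable_completion) simp

lemma continuous_measurable_torus:
  fixes f :: "real \<Rightarrow> 'b::topological_space"
  shows "continuous_on UNIV f \<Longrightarrow> f \<in> borel_measurable torus"
  by (intro borel_measurable_torusI borel_measurable_continuous_onI)

lemma sets_torusI: "A \<in> sets borel \<Longrightarrow> A \<subseteq> {0..<1} \<Longrightarrow> A \<in> sets torus"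
  by (auto simp: torus_def sets_restrict_space_iff)

lemma measure_torus_interval_le:
  assumes "0 \<le> h"
  shows "measure torus ({a - h..a + h} \<inter> {0..<1}) \<le> 2 * h"
proof -
  have "measure torus ({a - h..a + h} \<inter> {0..<1}) = measure lebesgue ({a - h..a + h} \<inter> {0..<1})"
    by (rule measure_torus) auto
  also have "\<dots> \<le> measure lebesgue {a - h..a + h}"
    by (rule measure_mono_fmeasurable) auto
  finally show ?thesis using assms by simp
qed

lemma integrable_torus_bounded:
  fixes f :: "real \<Rightarrow> 'b::{banach, second_countable_topology}"
  assumes "f \<in> borel_measurable torus" "\<And>x. x \<in> {0..<1} \<Longrightarrow> norm (f x) \<le> B"
  shows "integrable torus f"
  using assms by (intro torus.integrable_const_bound[where B = B]) (auto intro!: AE_I2)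

lemma integrable_bounded_mult:
  fixes f g :: "'a \<Rightarrow> complex"
  assumes "integrable M f" "g \<in> borel_measurable M" "\<And>x. x \<in> space M \<Longrightarrow> norm (g x) \<le> B"
  shows "integrable M (\<lambda>x. g x * f x)"
proof (rule Bochner_Integration.integrable_bound)
  show "integrable M (\<lambda>x. B * norm (f x))" using assms by simp
  show "(\<lambda>x. g x * f x) \<in> borel_measurable M"
    using assms by (intro borel_measurable_times) auto
  show "AE x in M. norm (g x * f x) \<le> norm (B * norm (f x))"
  proof (rule AE_I2)
    fix x assume "x \<in> space M"
    then have "norm (g x) \<le> \<bar>B\<bar>" using assms(3)[of x] by linarith
    then show "norm (g x * f x) \<le> norm (B * norm (f x))"
      by (simp add: norm_mult abs_mult mult_right_mono)
  qed
qed

lemma integrable_torus_continuous: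
  fixes f :: "real \<Rightarrow> 'b::{banach, second_countable_topology}"
  assumes "continuous_on UNIV f"
  shows "integrable torus f"
proof -
  have "compact (f ` {0..1})"
    by (intro compact_continuous_image continuous_on_subset[OF assms]) auto
  then obtain B where "\<forall>y\<in>f ` {0..1}. norm y \<le> B"
    using compact_imp_bounded bounded_iff by metis
  then show ?thesis
    by (intro integrable_torus_bounded[where B = B] continuous_measurable_torus assms) auto
qed

lemma integral_torus_FTC:
  fixes f :: "real \<Rightarrow> 'b::euclidean_space"
  assumes "\<And>x. (F has_vector_derivative f x) (at x)" "continuous_on UNIV f"
  shows "(LINT x|torus. f x) = F 1 - F 0"
proof -
  have "(f has_integral (F 1 - F 0)) {0..1}"
    by (rule fundamental_theorem_of_calculus) (auto intro: has_vector_derivative_at_within assms)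
  moreover have "(f has_integral (F 1 - F 0)) {0..1} \<longleftrightarrow> (f has_integral (F 1 - F 0)) {0..<1}"
    by (rule has_integral_spike_set_eq; rule negligible_subset[of "{1}"]) auto
  ultimately have "(f has_integral (F 1 - F 0)) {0..<1}" by blast
  moreover have "(LINT x|torus. f x) = integral {0..<1} f"
    using integrable_torus_continuous[OF assms(2)] unfolding torus_def
    by (intro lebesgue_integral_eq_integral) auto
  ultimately show ?thesis by (simp add: integral_unique)
qed

section \<open>Characters, Fourier coefficients and finite Fourier sums\<close>

lemma character_0 [simp]: "character 0 x = 1"
  by (simp add: character_def)

lemma character_at_0 [simp]: "character n 0 = 1"
  by (simp add: character_def)

lemma character_add: "character (a + b) x = character a x * character b x"
  by (simp add: character_def algebra_simps exp_add)

lemma character_add_arg: "character n (x + y) = character n x * character n y"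
  by (simp add: character_def algebra_simps exp_add)

lemma character_eq_cis: "character n x = cis (2 * pi * of_int n * x)"
  by (simp add: character_def cis_conv_exp mult_ac)

lemma norm_character [simp]: "norm (character n x) = 1"
  by (simp add: character_eq_cis)

lemma cnj_character: "cnj (character n x) = character (- n) x"
  by (simp add: character_eq_cis cis_cnj)

lemma character_neg_arg: "character n (- x) = character (- n) x"
  by (simp add: character_eq_cis)

lemma character_power: "character (int n) x = character 1 x ^ n"
  by (induction n) (simp_all add: character_add add.commute)

lemma character_mult_neg [simp]: "character n x * character (- n) x = 1"
  using character_add[of n "- n" x] by simp

lemma character_at_1 [simp]: "character n 1 = 1"
  by (simp add: character_eq_cis)

lemma has_vector_derivative_character:
  "(character n has_vector_derivative (2 * of_real pi * \<i> * of_int n) * character n x) (at x within S)"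
proof -
  have "((\<lambda>z. exp (2 * of_real pi * \<i> * of_int n * z)) has_field_derivative
          (2 * of_real pi * \<i> * of_int n) * exp (2 * of_real pi * \<i> * of_int n * of_real x)) (at (of_real x))"
    by (auto intro!: derivative_eq_intros)
  from has_vector_derivative_real_field[OF this]
  show ?thesis
    unfolding character_def .
qed

lemma continuous_on_character [continuous_intros]: "continuous_on S (character n)"
  unfolding character_def by (intro continuous_intros)

lemma measurable_character [measurable]: "character n \<in> borel_measurable torus"
  by (intro continuous_measurable_torus continuous_intros)

lemma integral_character: "(LINT x|torus. character n x) = (if n = 0 then 1 else 0)"
proof (cases "n = 0")
  case True
  then show ?thesis by simp
next
  case False
  define c where "c = 2 * of_real pi * \<i> * of_int n"
  have c: "c \<noteq> 0" using False by (simp add: c_def)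
  have "(LINT x|torus. character n x) = character n 1 / c - character n 0 / c"
  proof (rule integral_torus_FTC[where F = "\<lambda>x. character n x / c"])
    fix x
    have "((\<lambda>x. character n x / c) has_vector_derivative c * character n x / c) (at x)"
      unfolding c_def by (intro has_vector_derivative_divide has_vector_derivative_character)
    moreover have "c * character n x / c = character n x"
      using c by (rule nonzero_mult_div_cancel_left)
    ultimately show "((\<lambda>x. character n x / c) has_vector_derivative character n x) (at x)"
      by (simp only:)
  qed (rule continuous_on_character)
  then show ?thesis using False by simp
qed

lemma integrable_mult_character:
  assumes "integrable torus f"
  shows "integrable torus (\<lambda>x. f x * character n x)"
  by (rule Bochner_Integration.integrable_bound[OF assms])
     (use assms in \<open>auto simp: norm_mult intro!: borel_measurable_times\<close>)

lemma fourier_coeff_add: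
  assumes "integrable torus f" "integrable torus g"
  shows "fourier_coeff (\<lambda>x. f x + g x) n = fourier_coeff f n + fourier_coeff g n"
  unfolding fourier_coeff_def using assms
  by (simp add: ring_distribs integrable_mult_character)

lemma fourier_coeff_character_mult:
  "fourier_coeff (\<lambda>x. character k x * f x) n = fourier_coeff f (n - k)"
  unfolding fourier_coeff_def
  by (rule Bochner_Integration.integral_cong) (auto simp: character_add[symmetric] algebra_simps)

lemma fourier_coeff_cnj: "fourier_coeff (\<lambda>x. cnj (f x)) n = cnj (fourier_coeff f (- n))"
  unfolding fourier_coeff_def
  by (subst Bochner_Integration.integral_cnj[symmetric]) (simp add: cnj_character)

definition fourier_sum :: "int set \<Rightarrow> (int \<Rightarrow> complex) \<Rightarrow> (real \<Rightarrow> complex) \<Rightarrow> real \<Rightarrow> complex"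
  where "fourier_sum S c f x = (\<Sum>t\<in>S. c t * fourier_coeff f t * character t x)"

lemma continuous_on_fourier_sum [continuous_intros]: "continuous_on T (fourier_sum S c f)"
  unfolding fourier_sum_def by (intro continuous_intros)

lemma measurable_fourier_sum [measurable]: "fourier_sum S c f \<in> borel_measurable torus"
  by (intro continuous_measurable_torus continuous_intros)

lemma fourier_sum_add:
  assumes "integrable torus f" "integrable torus g"
  shows "fourier_sum S c (\<lambda>x. f x + g x) x = fourier_sum S c f x + fourier_sum S c g x"
  unfolding fourier_sum_def fourier_coeff_add[OF assms]
  by (simp add: sum.distrib algebra_simps)

lemma fourier_sum_eq_integral:
  assumes "integrable torus f"
  shows "fourier_sum S c f x = (LINT y|torus. (\<Sum>t\<in>S. c t * character t (x - y)) * f y)"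
proof -
  have "(LINT y|torus. (\<Sum>t\<in>S. c t * character t (x - y)) * f y)
      = (LINT y|torus. (\<Sum>t\<in>S. (c t * character t x) * (f y * character (- t) y)))"
    by (intro Bochner_Integration.integral_cong refl)
       (simp add: sum_distrib_right sum_distrib_left character_add_arg character_neg_arg
          diff_conv_add_uminus mult_ac del: add_uminus_conv_diff)
  also have "\<dots> = fourier_sum S c f x"
    using assms integrable_mult_character[OF assms]
    by (subst Bochner_Integration.integral_sum)
       (auto simp: fourier_sum_def fourier_coeff_def intro!: sum.cong)
  finally show ?thesis ..
qed

text \<open>The pairing is bilinear, without conjugation, whence the coefficient at
  \<open>- t\<close>. Parseval, Bessel's inequality and the adjoint identity of the duality argument
  are all read off from it.\<close>

lemma integral_trig_poly_mult:
  assumes "finite S" "integrable torus g"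
  shows "(LINT x|torus. (\<Sum>t\<in>S. a t * character t x) * g x) = (\<Sum>t\<in>S. a t * fourier_coeff g (- t))"
proof -
  have "(LINT x|torus. (\<Sum>t\<in>S. a t * character t x) * g x)
      = (LINT x|torus. (\<Sum>t\<in>S. a t * (g x * character t x)))"
    by (intro Bochner_Integration.integral_cong refl) (simp add: sum_distrib_right sum_distrib_left mult_ac)
  then show ?thesis
    using integrable_mult_character[OF assms(2)] by (simp add: fourier_coeff_def)
qed

lemma fourier_coeff_trig_poly:
  assumes "finite S"
  shows "fourier_coeff (\<lambda>x. \<Sum>t\<in>S. a t * character t x) n = (if n \<in> S then a n else 0)"
proof -
  have "fourier_coeff (\<lambda>x. \<Sum>t\<in>S. a t * character t x) n
      = (LINT x|torus. (\<Sum>t\<in>S. a t * character t x) * character (- n) x)"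
    by (simp add: fourier_coeff_def)
  also have "\<dots> = (\<Sum>t\<in>S. a t * fourier_coeff (character (- n)) (- t))"
    by (intro integral_trig_poly_mult assms integrable_torus_continuous continuous_intros)
  also have "\<dots> = (\<Sum>t\<in>S. if t = n then a t else 0)"
    by (intro sum.cong refl)
       (auto simp: fourier_coeff_def integral_character character_add[symmetric] simp del: character_mult_neg)
  finally show ?thesis using assms by (simp add: sum.delta)
qed

section \<open>Parseval and Bessel\<close>

lemma integral_norm_square_trig_poly:
  assumes "finite S"
  shows "(LINT x|torus. (norm (\<Sum>t\<in>S. a t * character t x))\<^sup>2) = (\<Sum>t\<in>S. (norm (a t))\<^sup>2)"
proof -
  let ?P = "\<lambda>x. \<Sum>t\<in>S. a t * character t x"
  have int: "integrable torus (\<lambda>x. cnj (?P x))"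
    by (intro integrable_torus_continuous continuous_intros)
  have "complex_of_real (LINT x|torus. (norm (?P x))\<^sup>2) = (LINT x|torus. complex_of_real ((norm (?P x))\<^sup>2))"
    by (rule integral_complex_of_real[symmetric])
  also have "\<dots> = (LINT x|torus. ?P x * cnj (?P x))"
    by (intro Bochner_Integration.integral_cong refl) (simp only: complex_norm_square)
  also have "\<dots> = (\<Sum>t\<in>S. a t * fourier_coeff (\<lambda>x. cnj (?P x)) (- t))"
    by (rule integral_trig_poly_mult[OF assms int])
  also have "\<dots> = (\<Sum>t\<in>S. a t * cnj (a t))"
    by (intro sum.cong refl) (simp add: fourier_coeff_cnj fourier_coeff_trig_poly[OF assms] del: cnj_sum)
  also have "\<dots> = complex_of_real (\<Sum>t\<in>S. (norm (a t))\<^sup>2)"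
    by (simp only: complex_norm_square of_real_sum)
  finally show ?thesis using of_real_eq_iff by blast
qed

lemma square_integrable_imp_integrable:
  fixes f :: "real \<Rightarrow> complex"
  assumes "f \<in> borel_measurable torus" "integrable torus (\<lambda>x. (norm (f x))\<^sup>2)"
  shows "integrable torus f"
proof (rule Bochner_Integration.integrable_bound)
  show "integrable torus (\<lambda>x. 1 + (norm (f x))\<^sup>2)" using assms by simp
  have "norm z \<le> 1 + (norm z)\<^sup>2" for z :: complex
    using zero_le_power2[of "norm z - 1/2"] by (simp add: power2_eq_square algebra_simps)
  then show "AE x in torus. norm (f x) \<le> norm (1 + (norm (f x))\<^sup>2)"
    by (intro AE_I2) (simp add: abs_of_nonneg add_nonneg_nonneg)
qed (use assms in simp)

text \<open>Expand the nonnegative integral of \<open>(norm (f - P))^2\<close> for the partial sum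
  \<open>P\<close>: the cross term and the square of \<open>P\<close> produce the same sum of
  squared coefficients, once with factor -2 and once with factor 1.\<close>

lemma Bessel_inequality:
  assumes "finite S" and f: "f \<in> borel_measurable torus" "integrable torus (\<lambda>x. (norm (f x))\<^sup>2)"
  shows "(\<Sum>t\<in>S. (norm (fourier_coeff f t))\<^sup>2) \<le> (LINT x|torus. (norm (f x))\<^sup>2)"
proof -
  define P where "P = (\<lambda>x. \<Sum>t\<in>S. fourier_coeff f t * character t x)"
  have intf: "integrable torus f" by (rule square_integrable_imp_integrable[OF f])
  have intc: "integrable torus (\<lambda>x. cnj (f x))" using intf by simp
  have intP2: "integrable torus (\<lambda>x. (norm (P x))\<^sup>2)"
    unfolding P_def by (intro integrable_torus_continuous continuous_intros)
  have intPf: "integrable torus (\<lambda>x. P x * cnj (f x))"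
  proof (rule integrable_bounded_mult[OF intc])
    show "P \<in> borel_measurable torus" unfolding P_def by (intro continuous_measurable_torus continuous_intros)
    show "norm (P x) \<le> (\<Sum>t\<in>S. norm (fourier_coeff f t))" for x
      unfolding P_def by (rule order_trans[OF norm_sum]) (simp add: norm_mult)
  qed
  have cross: "(LINT x|torus. P x * cnj (f x)) = of_real (\<Sum>t\<in>S. (norm (fourier_coeff f t))\<^sup>2)"
    unfolding P_def by (subst integral_trig_poly_mult[OF assms(1) intc])
       (simp add: fourier_coeff_cnj complex_norm_square del: of_real_power)
  have "0 \<le> (LINT x|torus. (norm (f x - P x))\<^sup>2)" by simp
  also have "\<dots> = (LINT x|torus. (norm (f x))\<^sup>2 + (norm (P x))\<^sup>2 - 2 * Re (P x * cnj (f x)))"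
    by (intro Bochner_Integration.integral_cong refl)
       (unfold cmod_power2, simp add: power2_eq_square algebra_simps)
  also have "\<dots> = (LINT x|torus. (norm (f x))\<^sup>2) + (LINT x|torus. (norm (P x))\<^sup>2)
      - 2 * Re (LINT x|torus. P x * cnj (f x))"
    using f(2) intP2 intPf
    by (simp only: Bochner_Integration.integral_diff Bochner_Integration.integral_add
        Bochner_Integration.integrable_add integrable_Re integrable_mult_right integral_mult_right_zero integral_Re)
  finally show ?thesis
    unfolding cross unfolding P_def integral_norm_square_trig_poly[OF assms(1)] by simp
qed

text \<open>Only the supremum of the coefficients matters in \<open>L^2\<close>. This bounds the
  good part of the Calderon-Zygmund decomposition and is the upper endpoint of the
  interpolation.\<close>

lemma fourier_sum_L2_bound:
  assumes "finite S" and f: "f \<in> borel_measurable torus" "integrable torus (\<lambda>x. (norm (f x))\<^sup>2)"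
    and "\<And>t. t \<in> S \<Longrightarrow> norm (c t) \<le> A"
  shows "(LINT x|torus. (norm (fourier_sum S c f x))\<^sup>2) \<le> A\<^sup>2 * (LINT x|torus. (norm (f x))\<^sup>2)"
proof -
  have "(LINT x|torus. (norm (fourier_sum S c f x))\<^sup>2) = (\<Sum>t\<in>S. (norm (c t * fourier_coeff f t))\<^sup>2)"
    unfolding fourier_sum_def by (rule integral_norm_square_trig_poly[OF assms(1)])
  also have "\<dots> \<le> (\<Sum>t\<in>S. A\<^sup>2 * (norm (fourier_coeff f t))\<^sup>2)"
    unfolding norm_mult power_mult_distrib
    by (intro sum_mono mult_right_mono power_mono assms(4) norm_ge_zero zero_le_power2)
  also have "\<dots> = A\<^sup>2 * (\<Sum>t\<in>S. (norm (fourier_coeff f t))\<^sup>2)"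
    by (simp add: sum_distrib_left)
  also have "\<dots> \<le> A\<^sup>2 * (LINT x|torus. (norm (f x))\<^sup>2)"
    by (intro mult_left_mono Bessel_inequality assms zero_le_power2)
  finally show ?thesis .
qed

section \<open>Kernels of one-sided multipliers\<close>

definition fdiff :: "(nat \<Rightarrow> complex) \<Rightarrow> nat \<Rightarrow> complex"
  where "fdiff a t = a (Suc t) - a t"

text \<open>The discrete form of the derivative bounds. For \<open>t \<ge> 1\<close> the differences
  do not involve \<open>a 0\<close>, so the value at index 0 may be replaced by any other of norm at
  most \<open>A\<close>; the treatment of frequency 0 relies on this.\<close>

definition marcinkiewicz_seq :: "real \<Rightarrow> (nat \<Rightarrow> complex) \<Rightarrow> bool"
  where "marcinkiewicz_seq A a \<longleftrightarrow> (\<forall>t. norm (a t) \<le> A) \<and>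
    (\<forall>l\<le>3. \<forall>t\<ge>1. norm ((fdiff ^^ l) a t) \<le> A / real t ^ l)"

lemma marcinkiewicz_seqD:
  assumes "marcinkiewicz_seq A a"
  shows "norm (a t) \<le> A" "l \<le> 3 \<Longrightarrow> t \<ge> 1 \<Longrightarrow> norm ((fdiff ^^ l) a t) \<le> A / real t ^ l"
  using assms by (auto simp: marcinkiewicz_seq_def)

lemma marcinkiewicz_seq_nonneg: "marcinkiewicz_seq A a \<Longrightarrow> 0 \<le> A"
  using norm_ge_zero[of "a 0"] marcinkiewicz_seqD(1)[of A a 0] by linarith

lemma fdiff_eventually_zero: "(\<And>t. t \<ge> M \<Longrightarrow> a t = 0) \<Longrightarrow> t \<ge> M \<Longrightarrow> fdiff a t = 0"
  by (simp add: fdiff_def)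

text \<open>Abel summation; the upper boundary term \<open>a M * z ^ M\<close> vanishes.\<close>

lemma summation_by_parts:
  assumes "\<And>t. t \<ge> M \<Longrightarrow> a t = 0" "R \<le> M"
  shows "(1 - z) * (\<Sum>t=R..<M. a t * z ^ t) = a R * z ^ R + z * (\<Sum>t=R..<M. fdiff a t * z ^ t)"
proof -
  have "(\<Sum>t=R..<M. a (Suc t) * z ^ Suc t - a t * z ^ t) = a M * z ^ M - a R * z ^ R"
    by (rule sum_Suc_diff'[OF assms(2)])
  then have "(\<Sum>t=R..<M. a (Suc t) * z ^ Suc t) - (\<Sum>t=R..<M. a t * z ^ t) = - (a R * z ^ R)"
    using assms(1)[of M] by (simp add: sum_subtractf)
  moreover have "z * (\<Sum>t=R..<M. fdiff a t * z ^ t) =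
      (\<Sum>t=R..<M. a (Suc t) * z ^ Suc t) - z * (\<Sum>t=R..<M. a t * z ^ t)"
    by (simp add: fdiff_def sum_distrib_left sum_subtractf algebra_simps)
  ultimately show ?thesis by (simp add: algebra_simps)
qed

text \<open>Each use trades one difference of the coefficients for a factor
  \<open>1 / norm (1 - z)\<close>.\<close>

lemma norm_sum_le_fdiff:
  fixes z :: complex
  assumes "\<And>t. t \<ge> M \<Longrightarrow> a t = 0" "R \<le> M" "norm z = 1" "z \<noteq> 1"
  shows "norm (\<Sum>t=R..<M. a t * z ^ t) \<le>
    (norm (a R) + norm (\<Sum>t=R..<M. fdiff a t * z ^ t)) / norm (1 - z)"
proof -
  have "norm (1 - z) * norm (\<Sum>t=R..<M. a t * z ^ t)
      = norm (a R * z ^ R + z * (\<Sum>t=R..<M. fdiff a t * z ^ t))"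
    using summation_by_parts[OF assms(1,2), where z = z] by (simp add: norm_mult[symmetric])
  also have "\<dots> \<le> norm (a R) + norm (\<Sum>t=R..<M. fdiff a t * z ^ t)"
    by (rule order_trans[OF norm_triangle_ineq]) (simp add: norm_mult norm_power assms(3))
  finally show ?thesis using assms(4) by (simp add: field_simps)
qed

text \<open>The induction proves the telescoping form \<open>2 / R - 2 / M\<close>, which works
  because \<open>n + 1 \<le> 2 * n\<close>.\<close>

lemma sum_inverse_squares_le:
  assumes "1 \<le> R" "R \<le> M"
  shows "(\<Sum>t=R..<M. 1 / real t ^ 2) \<le> 2 / real R"
proof -
  have "(\<Sum>t=R..<M. 1 / real t ^ 2) \<le> 2 / real R - 2 / real M"
    using assms(2)
  proof (induction M rule: dec_induct)
    case (step n)
    then have "real n \<ge> 1" using assms(1) by simp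
    then have "2 / (2 * real n ^ 2) \<le> 2 / (real n * (real n + 1))"
      by (intro divide_left_mono mult_pos_pos) (auto simp: power2_eq_square algebra_simps)
    also have "\<dots> = 2 / real n - 2 / real (Suc n)"
      using \<open>real n \<ge> 1\<close> by (simp add: field_simps)
    finally have "1 / real n ^ 2 \<le> 2 / real n - 2 / real (Suc n)" by simp
    then show ?case using step assms(1) by simp
  qed simp
  then show ?thesis by (smt (verit) divide_nonneg_nonneg of_nat_0_le_iff)
qed

text \<open>The Leibniz rule with the factor \<open>t\<close>, whose second and third differences
  vanish; hence only two terms.\<close>

lemma fdiff_pow_mult_index:
  "(fdiff ^^ 1) (\<lambda>t. of_nat t * a t) t = of_nat t * (fdiff ^^ 1) a t + a (Suc t)"
  "(fdiff ^^ 2) (\<lambda>t. of_nat t * a t) t = of_nat t * (fdiff ^^ 2) a t + 2 * (fdiff ^^ 1) a (Suc t)"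
  "(fdiff ^^ 3) (\<lambda>t. of_nat t * a t) t = of_nat t * (fdiff ^^ 3) a t + 3 * (fdiff ^^ 2) a (Suc t)"
  by (simp_all add: numeral_2_eq_2 numeral_3_eq_3 fdiff_def algebra_simps)

lemma nat_le_3_cases: "(l::nat) \<le> 3 \<Longrightarrow> l = 0 \<or> l = 1 \<or> l = 2 \<or> l = 3"
  by auto

text \<open>The 4 is 1 + 3, where 3 is the largest coefficient in the Leibniz rule. The quotient
  \<open>real t / real t ^ l\<close> stands for the power \<open>1 - l\<close>, which is negative
  from \<open>l = 2\<close> on.\<close>

lemma fdiff_pow_mult_index_le:
  assumes a: "marcinkiewicz_seq A a" and "l \<le> 3" "t \<ge> 1"
  shows "norm ((fdiff ^^ l) (\<lambda>t. of_nat t * a t) t) \<le> 4 * A * real t / real t ^ l"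
proof -
  have A: "0 \<le> A" by (rule marcinkiewicz_seq_nonneg[OF a])
  have t: "real t \<ge> 1" using assms by simp
  have step: "norm (of_nat t * u + of_nat k * v) \<le> 4 * A * real t / real t ^ Suc j"
    if "norm u \<le> A / real t ^ Suc j" "norm v \<le> A / real (Suc t) ^ j" "k \<le> 3" for u v :: complex and j k
  proof -
    have "norm v \<le> A / real t ^ j"
      using that(2) A t by (elim order_trans) (intro divide_left_mono power_mono mult_pos_pos zero_less_power, auto)
    then have "real k * norm v \<le> 3 * (A / real t ^ j)"
      using that(3) by (intro mult_mono) auto
    moreover have "real t * norm u \<le> real t * (A / real t ^ Suc j)"
      using that(1) t by (intro mult_left_mono) auto
    moreover have "norm (of_nat t * u + of_nat k * v) \<le> real t * norm u + real k * norm v"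
      by (rule order_trans[OF norm_triangle_ineq]) (simp add: norm_mult)
    moreover have "real t * (A / real t ^ Suc j) = A / real t ^ j"
      and "4 * A * real t / real t ^ Suc j = 4 * (A / real t ^ j)" using t by (auto simp: field_simps)
    ultimately show ?thesis by linarith
  qed
  note D = marcinkiewicz_seqD[OF a]
  consider "l = 0" | "l = 1" | "l = 2" | "l = 3" using nat_le_3_cases[OF assms(2)] by blast
  then show ?thesis
  proof cases
    case 1
    have "real t * norm (a t) \<le> real t * (4 * A)" using D(1)[of t] A by (intro mult_left_mono) auto
    then show ?thesis using 1 by (simp add: norm_mult mult_ac)
  next
    case 2
    show ?thesis
      using step[of "(fdiff ^^ 1) a t" 0 "a (Suc t)" 1] D(2)[of 1 t] D(1)[of "Suc t"] assms(3)
      unfolding 2 fdiff_pow_mult_index by simp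
  next
    case 3
    show ?thesis
      using step[of "(fdiff ^^ 2) a t" 1 "(fdiff ^^ 1) a (Suc t)" 2] D(2)[of 2 t] D(2)[of 1 "Suc t"] assms(3)
      unfolding 3 fdiff_pow_mult_index by (simp add: numeral_2_eq_2)
  next
    case 4
    show ?thesis
      using step[of "(fdiff ^^ 3) a t" 2 "(fdiff ^^ 2) a (Suc t)" 3] D(2)[of 3 t] D(2)[of 2 "Suc t"] assms(3)
      unfolding 4 fdiff_pow_mult_index by (simp add: numeral_3_eq_3 numeral_2_eq_2)
  qed
qed

text \<open>Low frequencies are estimated trivially; beyond the threshold \<open>R \<approx> 1 / \<bar>1 - z\<bar>\<close> three
  summations by parts are used.\<close>

lemma norm_sum_index_le:
  fixes z :: complex
  assumes a: "marcinkiewicz_seq A a" and M: "\<And>t. t \<ge> M \<Longrightarrow> a t = 0" and z: "norm z = 1" "z \<noteq> 1"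
  shows "norm (\<Sum>t<M. of_nat t * a t * z ^ t) \<le> 64 * A / (norm (1 - z))\<^sup>2"
proof -
  define d where "d = norm (1 - z)"
  define n where "n = (\<lambda>t. of_nat t * a t)"
  \<comment> \<open>Rounding \<open>1 / d\<close> up changes \<open>R * d\<close> by at most
    \<open>d \<le> 2\<close>, so it lies between 1 and 3.\<close>
  define R where "R = nat \<lceil>1 / d\<rceil>"
  have A: "0 \<le> A" by (rule marcinkiewicz_seq_nonneg[OF a])
  have d: "0 < d" "d \<le> 2"
    using z norm_triangle_ineq4[of 1 z] by (auto simp: d_def)
  have R: "1 \<le> real R * d" "real R * d \<le> 3" "1 \<le> R"
  proof -
    have "0 < 1 / d" using d by simp
    then have "1 / d \<le> real R" "real R \<le> 1 / d + 1" unfolding R_def by linarith+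
    then show "1 \<le> real R * d" "real R * d \<le> 3" using d by (auto simp: field_simps)
    then show "1 \<le> R" by (cases R) auto
  qed
  have n: "norm ((fdiff ^^ l) n t) \<le> 4 * A * real t / real t ^ l" if "l \<le> 3" "t \<ge> 1" for l t
    unfolding n_def by (rule fdiff_pow_mult_index_le[OF a that])
  \<comment> \<open>At most \<open>R\<close> terms of size \<open>4 * A * R\<close>, and
    \<open>R * d \<le> 3\<close>. A general \<open>k \<le> R\<close> also covers the case that the
    whole sum ends before \<open>R\<close>.\<close>
  have low: "norm (\<Sum>t<k. n t * z ^ t) \<le> 36 * A / d\<^sup>2" if "k \<le> R" for k
  proof -
    have "norm (\<Sum>t<k. n t * z ^ t) \<le> (\<Sum>t<k. norm (n t * z ^ t))" by (rule norm_sum)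
    also have "\<dots> \<le> (\<Sum>t<k. 4 * A * real R)"
    proof (rule sum_mono)
      fix t assume "t \<in> {..<k}"
      then have "real t \<le> real R" using that by simp
      moreover have "norm (a t) \<le> 4 * A" using marcinkiewicz_seqD(1)[OF a, of t] A by linarith
      ultimately have "real t * norm (a t) \<le> real R * (4 * A)" by (intro mult_mono) auto
      then show "norm (n t * z ^ t) \<le> 4 * A * real R"
        by (simp add: n_def norm_mult norm_power z mult_ac)
    qed
    also have "\<dots> \<le> 4 * A * (real R * real R)"
      using that A by (simp add: mult_ac mult_mono mult_left_mono)
    also have "\<dots> \<le> 4 * A * (9 / d\<^sup>2)"
    proof (rule mult_left_mono)
      have "(real R * d) * (real R * d) \<le> 3 * 3" using R d by (intro mult_mono) auto
      then show "real R * real R \<le> 9 / d\<^sup>2" using d by (simp add: field_simps power2_eq_square)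
    qed (use A in simp)
    finally show ?thesis by simp
  qed
  show ?thesis
  proof (cases "R \<le> M")
    case False
    then show ?thesis
      using low[of M] A d by (simp add: n_def d_def[symmetric] divide_right_mono order_trans[OF _ divide_right_mono[of "36 * A" "64 * A"]])
  next
    case True
    define B where "B = (\<lambda>l. norm (\<Sum>t=R..<M. (fdiff ^^ l) n t * z ^ t))"
    have n0: "n t = 0" if "t \<ge> M" for t using M[OF that] by (simp add: n_def)
    have zero: "(fdiff ^^ l) n t = 0" if "t \<ge> M" for l t
      using that
    proof (induction l arbitrary: t)
      case 0
      then show ?case by (simp add: n0)
    next
      case (Suc l)
      then show ?case by (simp add: fdiff_eventually_zero[where M = M])
    qed
    have step: "B l \<le> (norm ((fdiff ^^ l) n R) + B (Suc l)) / d" for l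
      using norm_sum_le_fdiff[of M "(fdiff ^^ l) n" R z] zero True z by (simp add: B_def d_def)
    have B3: "B 3 \<le> 8 * A / real R"
    proof -
      have "B 3 \<le> (\<Sum>t=R..<M. norm ((fdiff ^^ 3) n t * z ^ t))" unfolding B_def by (rule norm_sum)
      also have "\<dots> \<le> (\<Sum>t=R..<M. 4 * A * (1 / real t ^ 2))"
      proof (rule sum_mono)
        fix t assume "t \<in> {R..<M}"
        then have t: "t \<ge> 1" using R by simp
        then show "norm ((fdiff ^^ 3) n t * z ^ t) \<le> 4 * A * (1 / real t ^ 2)"
          using n[of 3 t] by (simp add: norm_mult norm_power z power2_eq_square power3_eq_cube field_simps)
      qed
      also have "\<dots> \<le> 4 * A * (2 / real R)"
        unfolding sum_distrib_left[symmetric]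
        by (intro mult_left_mono sum_inverse_squares_le R True) (use A in simp)
      finally show ?thesis by simp
    qed
    \<comment> \<open>Going back through the three summations by parts, with
      \<open>1 / r \<le> d\<close> and \<open>r \<le> 3 / d\<close>: the bounds are
      \<open>8 * A / r\<close>, \<open>12 * A\<close>, \<open>16 * A / d\<close> and
      \<open>28 * A / d^2\<close>. With the low part, 36 + 28 = 64.\<close>
    define r where "r = real R"
    have r: "r \<ge> 1" "1 / d \<le> r" "1 / r \<le> d" "r \<le> 3 / d" using R d by (auto simp: r_def field_simps)
    have "B 2 \<le> (4 * A / r + 8 * A / r) / d"
    proof (rule order_trans[OF step])
      have "norm ((fdiff ^^ 2) n R) \<le> 4 * A / r"
        using n[of 2 R] R by (simp add: r_def power2_eq_square)
      then show "(norm ((fdiff ^^ 2) n R) + B (Suc 2)) / d \<le> (4 * A / r + 8 * A / r) / d"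
        using B3 d by (intro divide_right_mono add_mono) (auto simp: r_def numeral_3_eq_3 numeral_2_eq_2)
    qed
    also have "\<dots> = 12 * A * (1 / r) / d" by simp
    also have "\<dots> \<le> 12 * A * d / d" using A r d by (intro divide_right_mono mult_left_mono) auto
    finally have B2: "B 2 \<le> 12 * A" using d by simp
    have "norm ((fdiff ^^ 1) n R) \<le> 4 * A" using n[of 1 R] R by simp
    then have "B 1 \<le> (4 * A + 12 * A) / d"
      using step[of 1] B2 d by (intro order_trans[OF step divide_right_mono]) (auto simp: numeral_2_eq_2)
    then have B1: "B 1 \<le> 16 * A / d" by simp
    have "norm ((fdiff ^^ 0) n R) \<le> 4 * A * r" using n[of 0 R] R by (simp add: r_def)
    also have "\<dots> \<le> 4 * A * (3 / d)" using r A by (intro mult_left_mono) auto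
    finally have "norm ((fdiff ^^ 0) n R) \<le> 12 * A / d" by simp
    then have "B 0 \<le> (12 * A / d + 16 * A / d) / d"
      using B1 d by (intro order_trans[OF step divide_right_mono]) auto
    then have B0: "B 0 \<le> 28 * A / d\<^sup>2" using d by (simp add: power2_eq_square add_divide_distrib[symmetric])
    have "(\<Sum>t<M. n t * z ^ t) = (\<Sum>t<R. n t * z ^ t) + (\<Sum>t=R..<M. n t * z ^ t)"
      using True by (simp add: lessThan_atLeast0 sum.atLeastLessThan_concat)
    then have "norm (\<Sum>t<M. n t * z ^ t) \<le> 36 * A / d\<^sup>2 + 28 * A / d\<^sup>2"
      using norm_triangle_mono[OF low[OF order_refl]] B0 by (simp only: B_def funpow_0)
    then show ?thesis by (simp add: n_def d_def add_divide_distrib[symmetric])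
  qed
qed

section \<open>Chord length on the unit circle and regularity of the kernel\<close>

lemma sin_ge_fraction:
  assumes "0 \<le> x" "x \<le> pi / 2"
  shows "x / pi \<le> sin x"
\<comment> \<open>This is Jordan's inequality with a factor 2 given away. Up to
  \<open>pi / 3\<close> the mean value theorem gives a slope of at least 1/2, which exceeds
  \<open>1 / pi\<close>; beyond it \<open>sin x\<close> is at least 1/2, and \<open>x / pi\<close>
  at most 1/2.\<close>
proof (cases "x \<le> pi / 3")
  case True
  show ?thesis
  proof (cases "x = 0")
    case False
    then have "0 < x" using assms by simp
    from MVT2[OF this, of sin cos] obtain u where u: "0 < u" "u < x" "sin x - sin 0 = (x - 0) * cos u"
      by (auto intro: DERIV_sin)
    have "cos (pi / 3) \<le> cos u" using u True by (intro cos_monotone_0_pi_le) auto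
    then have "1 / 2 \<le> cos u" by (simp add: cos_60)
    moreover have "1 / pi \<le> 1 / 2" using pi_gt3 by (intro divide_left_mono) auto
    ultimately have "1 / pi \<le> cos u" by linarith
    then have "x * (1 / pi) \<le> x * cos u" using \<open>0 < x\<close> by (intro mult_left_mono) auto
    then show ?thesis using u by simp
  qed simp
next
  case False
  have "sin (pi / 6) \<le> sin x" using False assms by (intro sin_monotone_2pi_le) (use pi_gt_zero in linarith)+
  moreover have "x / pi \<le> 1 / 2" using assms by (simp add: field_simps)
  ultimately show ?thesis unfolding sin_30 by linarith
qed

lemma norm_one_minus_character: "norm (1 - character 1 x) = 2 * \<bar>sin (pi * x)\<bar>"
proof -
  have alg: "(1 - (1 - 2 * s\<^sup>2))\<^sup>2 + (2 * s * c)\<^sup>2 = 4 * s\<^sup>2 * (s\<^sup>2 + c\<^sup>2)" for s c :: real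
    by (simp add: power2_eq_square algebra_simps)
  have "(norm (1 - character 1 x))\<^sup>2 = (1 - cos (2 * (pi * x)))\<^sup>2 + (sin (2 * (pi * x)))\<^sup>2"
    by (simp add: character_eq_cis cmod_power2 mult_ac)
  also have "\<dots> = 4 * (sin (pi * x))\<^sup>2 * ((sin (pi * x))\<^sup>2 + (cos (pi * x))\<^sup>2)"
    unfolding cos_double_sin sin_double by (rule alg)
  also have "\<dots> = (2 * \<bar>sin (pi * x)\<bar>)\<^sup>2" by (simp add: power_mult_distrib)
  finally show ?thesis by (rule power2_eq_imp_eq) auto
qed

text \<open>The chord from 1 is at least twice the distance from \<open>x\<close> to the nearest
  integer, which for \<open>x\<close> in (-1,1) is -1, 0 or 1.\<close>

lemma norm_one_minus_character_ge:
  assumes "-1 < x" "x < 1"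
  obtains k where "k \<in> {-1, 0, 1::real}" "2 * \<bar>x - k\<bar> \<le> norm (1 - character 1 x)"
proof -
  have half: "2 * u \<le> 2 * \<bar>sin (pi * u)\<bar>" if "0 \<le> u" "u \<le> 1 / 2" for u
    using sin_ge_fraction[of "pi * u"] that by simp
  consider "-1 < x" "x \<le> -1/2" | "-1/2 \<le> x" "x \<le> 0" | "0 \<le> x" "x \<le> 1/2" | "1/2 \<le> x" "x < 1"
    using assms by linarith
  then show thesis
  proof cases
    case 1
    have "sin (pi * (x + 1)) = - sin (pi * x)" by (simp add: algebra_simps)
    then show ?thesis
      using half[of "x + 1"] 1 that[of "-1"] by (simp add: norm_one_minus_character)
  next
    case 2
    then show ?thesis
      using half[of "- x"] that[of 0] by (simp add: norm_one_minus_character)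
  next
    case 3
    then show ?thesis
      using half[of x] that[of 0] by (simp add: norm_one_minus_character)
  next
    case 4
    have "sin (pi * (1 - x)) = sin (pi * x)" by (simp add: algebra_simps)
    then show ?thesis
      using half[of "1 - x"] 4 that[of 1] by (simp add: norm_one_minus_character)
  qed
qed

definition one_sided_kernel :: "(nat \<Rightarrow> complex) \<Rightarrow> nat \<Rightarrow> real \<Rightarrow> complex"
  where "one_sided_kernel a M x = (\<Sum>t<M. a t * character (int t) x)"

lemma one_sided_kernel_has_derivative:
  "(one_sided_kernel a M has_vector_derivative
     2 * of_real pi * \<i> * (\<Sum>t<M. of_nat t * a t * character 1 x ^ t)) (at x within S)"
proof -
  have "((\<lambda>x. \<Sum>t<M. a t * character (int t) x) has_vector_derivative
     (\<Sum>t<M. a t * ((2 * of_real pi * \<i> * of_int (int t)) * character (int t) x))) (at x within S)"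
    by (intro has_vector_derivative_sum has_vector_derivative_mult_right has_vector_derivative_character)
  then show ?thesis
    unfolding one_sided_kernel_def[abs_def]
    by (simp add: sum_distrib_left character_power mult_ac)
qed

text \<open>A crude bound that grows with \<open>M\<close>. It is used only on intervals whose
  length is chosen after \<open>M\<close>, so it leaves no trace in the final constant.\<close>

lemma one_sided_kernel_lipschitz:
  "norm (one_sided_kernel a M x - one_sided_kernel a M y) \<le> (2 * pi * (\<Sum>t<M. real t * norm (a t))) * \<bar>x - y\<bar>"
proof -
  have "norm (one_sided_kernel a M x - one_sided_kernel a M y) \<le>
     (2 * pi * (\<Sum>t<M. real t * norm (a t))) * norm (x - y)"
  proof (rule differentiable_bound[where S = UNIV])
    fix u
    show "(one_sided_kernel a M has_derivative
       (\<lambda>h. h *\<^sub>R (2 * of_real pi * \<i> * (\<Sum>t<M. of_nat t * a t * character 1 u ^ t)))) (at u within UNIV)"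
      using one_sided_kernel_has_derivative[of a M u UNIV] by (simp add: has_vector_derivative_def)
    have "norm (\<Sum>t<M. of_nat t * a t * character 1 u ^ t) \<le> (\<Sum>t<M. real t * norm (a t))"
      by (rule order_trans[OF norm_sum]) (simp add: norm_mult norm_power)
    then show "onorm (\<lambda>h. h *\<^sub>R (2 * of_real pi * \<i> * (\<Sum>t<M. of_nat t * a t * character 1 u ^ t)))
       \<le> 2 * pi * (\<Sum>t<M. real t * norm (a t))"
      by (intro onorm_le) (simp add: norm_mult mult_left_mono mult_ac mult_left_mono)
  qed auto
  then show ?thesis by simp
qed

text \<open>Hoermander's regularity condition in pointwise form: the mean value inequality with the
  bound \<open>64 * A / w^2\<close> for the sum in the derivative. Replacing \<open>w^2\<close> by
  \<open>w^2 + h^2\<close> costs a factor 2 and yields a majorant that is integrable over the whole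
  circle. The constant is \<open>2 * pi * 64 * 2\<close>; summing over \<open>k\<close> avoids
  naming the nearest integer.\<close>

lemma one_sided_kernel_diff_le:
  assumes a: "marcinkiewicz_seq A a" and M: "\<And>t. t \<ge> M \<Longrightarrow> a t = 0"
    and x: "0 \<le> x" "x < 1" and y: "0 \<le> u" "u \<le> y" "y \<le> u + h" "y < 1"
    and off: "\<And>k. k \<in> {-1, 0, 1} \<Longrightarrow> 2 * h < \<bar>x - u - k\<bar>"
  shows "norm (one_sided_kernel a M (x - y) - one_sided_kernel a M (x - u)) \<le>
    256 * pi * A * h * (\<Sum>k\<in>{-1, 0, 1}. 1 / ((x - u - k)\<^sup>2 + h\<^sup>2))" (is "_ \<le> ?C * h * ?P")
proof -
  have A: "0 \<le> A" by (rule marcinkiewicz_seq_nonneg[OF a])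
  have h: "0 \<le> h" using y by linarith
  define S where "S = {x - y..x - u}"
  have bound: "norm (2 * of_real pi * \<i> * (\<Sum>t<M. of_nat t * a t * character 1 v ^ t)) \<le> ?C * ?P"
    if "v \<in> S" for v
  proof -
    have v: "-1 < v" "v < 1" "x - u - h \<le> v" "v \<le> x - u" using that x y by (auto simp: S_def)
    obtain k where k: "k \<in> {-1, 0, 1}" "2 * \<bar>v - k\<bar> \<le> norm (1 - character 1 v)"
      using norm_one_minus_character_ge[OF v(1,2)] by metis
    define w where "w = \<bar>x - u - k\<bar>"
    have w: "2 * h < w" using off[OF k(1)] by (simp add: w_def)
    \<comment> \<open>The intermediate point \<open>v\<close> is within \<open>h < w / 2\<close> of
      \<open>x - u\<close>. Passing from \<open>v\<close> to \<open>x - u\<close> at most doubles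
      the distance to \<open>k\<close>, and the factor 2 in the chord bound pays for this.\<close>
    have "w \<le> \<bar>v - k\<bar> + h" using v unfolding w_def by linarith
    moreover have "p \<le> 2 * q" if "p \<le> q + h" "2 * h < p" for p q :: real using that by linarith
    ultimately have "w \<le> 2 * \<bar>v - k\<bar>" using w by blast
    then have wn: "w \<le> norm (1 - character 1 v)" using k by linarith
    have wpos: "0 < w" using w h by linarith
    have ne: "character 1 v \<noteq> 1" using wn wpos by auto
    have "norm (\<Sum>t<M. of_nat t * a t * character 1 v ^ t) \<le> 64 * A / (norm (1 - character 1 v))\<^sup>2"
      by (rule norm_sum_index_le[OF a M]) (use ne in auto)
    also have "\<dots> \<le> 64 * A / w\<^sup>2"
      using A wn wpos by (intro divide_left_mono power_mono mult_pos_pos zero_less_power) auto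
    also have "\<dots> \<le> 64 * A * (2 * (1 / (w\<^sup>2 + h\<^sup>2)))"
    proof -
      have "h\<^sup>2 \<le> w\<^sup>2" using w h by (intro power_mono) auto
      moreover have "0 < w\<^sup>2" using wpos by simp
      moreover have "0 < w\<^sup>2 + h\<^sup>2" using wpos by (simp add: add_pos_nonneg)
      ultimately have "1 / w\<^sup>2 \<le> 2 * (1 / (w\<^sup>2 + h\<^sup>2))" by (simp add: field_simps)
      then have "64 * A * (1 / w\<^sup>2) \<le> 64 * A * (2 * (1 / (w\<^sup>2 + h\<^sup>2)))" using A by (intro mult_left_mono) auto
      then show ?thesis by simp
    qed
    also have "\<dots> = 128 * A * (1 / ((x - u - k)\<^sup>2 + h\<^sup>2))" by (simp add: w_def)
    also have "\<dots> \<le> 128 * A * ?P"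
      using A k(1) by (intro mult_left_mono member_le_sum) auto
    finally have "2 * pi * norm (\<Sum>t<M. of_nat t * a t * character 1 v ^ t) \<le> 2 * pi * (128 * A * ?P)"
      by (intro mult_left_mono) auto
    then show ?thesis by (simp add: norm_mult mult_ac)
  qed
  have "norm (one_sided_kernel a M (x - y) - one_sided_kernel a M (x - u)) \<le> (?C * ?P) * norm ((x - y) - (x - u))"
  proof (rule differentiable_bound[where S = S])
    fix v assume "v \<in> S"
    show "(one_sided_kernel a M has_derivative
       (\<lambda>h. h *\<^sub>R (2 * of_real pi * \<i> * (\<Sum>t<M. of_nat t * a t * character 1 v ^ t)))) (at v within S)"
      using one_sided_kernel_has_derivative[of a M v S] by (simp add: has_vector_derivative_def)
    show "onorm (\<lambda>h. h *\<^sub>R (2 * of_real pi * \<i> * (\<Sum>t<M. of_nat t * a t * character 1 v ^ t))) \<le> ?C * ?P"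
      using bound[OF \<open>v \<in> S\<close>]
      by (intro onorm_le) (simp only: norm_scaleR real_norm_def mult.commute[of "?C * ?P"], rule mult_left_mono, auto)
  qed (use y in \<open>auto simp: S_def\<close>)
  also have "\<dots> \<le> (?C * ?P) * h"
    using y A by (intro mult_left_mono mult_nonneg_nonneg sum_nonneg) (auto simp: abs_le_iff)
  finally show ?thesis by (simp add: mult_ac)
qed

text \<open>Up to a constant factor this is the Poisson kernel of the half plane at height
  \<open>h\<close>. Its primitive \<open>arctan ((x - b) / h)\<close> bounds the integral
  independently of \<open>h\<close> and \<open>b\<close>, hence of the size of the interval in the
  decomposition.\<close>

lemma integral_poisson_like_le:
  assumes "0 < h"
  shows "(LINT x|torus. h / ((x - b)\<^sup>2 + h\<^sup>2)) \<le> pi"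
    and "integrable torus (\<lambda>x. h / ((x - b)\<^sup>2 + h\<^sup>2))"
proof -
  have pos: "0 < (x - b)\<^sup>2 + h\<^sup>2" for x using assms by (simp add: add_nonneg_pos)
  have cont: "continuous_on UNIV (\<lambda>x. h / ((x - b)\<^sup>2 + h\<^sup>2))"
    by (intro continuous_intros ballI) (use pos in \<open>auto simp: less_imp_neq[symmetric]\<close>, metis less_irrefl pos)
  then show "integrable torus (\<lambda>x. h / ((x - b)\<^sup>2 + h\<^sup>2))" by (rule integrable_torus_continuous)
  have "(LINT x|torus. h / ((x - b)\<^sup>2 + h\<^sup>2)) = arctan ((1 - b) / h) - arctan ((0 - b) / h)"
  proof (rule integral_torus_FTC[where F = "\<lambda>x. arctan ((x - b) / h)", OF _ cont])
    fix x
    have "((\<lambda>x. arctan ((x - b) / h)) has_real_derivative (1 / h) * inverse (1 + ((x - b) / h)\<^sup>2)) (at x)"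
      using assms by (auto intro!: derivative_eq_intros)
    moreover have "(1 / h) * inverse (1 + ((x - b) / h)\<^sup>2) = h / ((x - b)\<^sup>2 + h\<^sup>2)"
    proof -
      have "1 + ((x - b) / h)\<^sup>2 = ((x - b)\<^sup>2 + h\<^sup>2) / h\<^sup>2"
        using assms by (simp add: power_divide add_divide_distrib)
      then show ?thesis using assms by (simp add: power2_eq_square)
    qed
    ultimately show "((\<lambda>x. arctan ((x - b) / h)) has_vector_derivative h / ((x - b)\<^sup>2 + h\<^sup>2)) (at x)"
      by (simp add: has_real_derivative_iff_has_vector_derivative)
  qed
  then show "(LINT x|torus. h / ((x - b)\<^sup>2 + h\<^sup>2)) \<le> pi"
    using arctan_bounded[of "(1 - b) / h"] arctan_bounded[of "(0 - b) / h"] by linarith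
qed

section \<open>The Calderon-Zygmund argument\<close>

text \<open>An interval is encoded as the pair of its left endpoint and its length, half-open so
  that its two halves partition it exactly.\<close>

definition mass :: "(real \<Rightarrow> real) \<Rightarrow> real \<times> real \<Rightarrow> real"
  where "mass F J = (LINT x|torus. indicator {fst J..<fst J + snd J} x * F x)"

lemma interval_sets_torus: "{b..<b + k} \<subseteq> {0..<1} \<Longrightarrow> {b..<b + k} \<in> sets torus" for b k :: real
  by (rule sets_torusI) auto

lemma integrable_indicator_mult:
  fixes F :: "real \<Rightarrow> real"
  assumes "integrable torus F" "{b..<b + k} \<subseteq> {0..<1}"
  shows "integrable torus (\<lambda>x. indicator {b..<b + k} x * F x)"
  using integrable_real_mult_indicator[OF interval_sets_torus[OF assms(2)] assms(1)]
  by (simp add: mult.commute)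

lemma mass_mono:
  assumes "integrable torus F" "\<And>x. 0 \<le> F x" "{b..<b + k} \<subseteq> {c..<c + l}" "{c..<c + l} \<subseteq> {0..<1}"
  shows "mass F (b, k) \<le> mass F (c, l)"
  unfolding mass_def fst_conv snd_conv
  using assms by (intro integral_mono integrable_indicator_mult mult_right_mono) (auto split: split_indicator)

text \<open>Induction on the remaining depth \<open>M\<close>. An interval of mean at most
  \<open>\<alpha>\<close> is halved. A half of larger mean is kept; its mean is at most
  \<open>2 * \<alpha>\<close>, as its mass is at most that of the parent. The other halves are
  subdivided further, and at depth 0 they are kept as they are, which is the second alternative. The
  partition is stated with indicators so that it holds at every point and can be integrated
  termwise.\<close>

lemma calderon_zygmund_intervals:
  assumes F: "integrable torus F" "\<And>x. 0 \<le> F x" and "0 < \<alpha>"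
    and "0 < h" "{a..<a + h} \<subseteq> {0..<1}" "mass F (a, h) \<le> \<alpha> * h"
  shows "\<exists>P. finite P \<and>
    (\<forall>J\<in>P. 0 < snd J \<and> {fst J..<fst J + snd J} \<subseteq> {a..<a + h} \<and> mass F J \<le> 2 * \<alpha> * snd J \<and>
      (\<alpha> * snd J < mass F J \<or> snd J \<le> h / 2 ^ M)) \<and>
    (\<forall>x. indicator {a..<a + h} x = (\<Sum>J\<in>P. indicator {fst J..<fst J + snd J} x :: real))"
  using assms(4-)
proof (induction M arbitrary: a h)
  case 0
  have "\<alpha> * h \<le> 2 * \<alpha> * h" using 0 assms(3) by simp
  then show ?case
    using 0 by (intro exI[of _ "{(a, h)}"]) auto
next
  case (Suc M)
  define k where "k = h / 2"
  have k: "0 < k" "h = k + k" using Suc.prems by (auto simp: k_def)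
  let ?Q = "\<lambda>c P. finite P \<and>
    (\<forall>J\<in>P. 0 < snd J \<and> {fst J..<fst J + snd J} \<subseteq> {c..<c + k} \<and> mass F J \<le> 2 * \<alpha> * snd J \<and>
      (\<alpha> * snd J < mass F J \<or> snd J \<le> k / 2 ^ M)) \<and>
    (\<forall>x. indicator {c..<c + k} x = (\<Sum>J\<in>P. indicator {fst J..<fst J + snd J} x :: real))"
  have ex: "\<exists>P. ?Q c P" if c: "c = a \<or> c = a + k" for c
  proof (cases "mass F (c, k) \<le> \<alpha> * k")
    case True
    have "{c..<c + k} \<subseteq> {a..<a + h}" using c k by auto
    then have "{c..<c + k} \<subseteq> {0..<1}" using Suc.prems(2) by (rule order_trans)
    then show ?thesis by (rule Suc.IH[OF k(1) _ True])
  next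
    case False
    have sub: "{c..<c + k} \<subseteq> {a..<a + h}" using c k by auto
    have "mass F (c, k) \<le> mass F (a, h)"
      by (rule mass_mono[OF F sub Suc.prems(2)])
    also have "\<dots> \<le> 2 * \<alpha> * k" using Suc.prems(3) k by (simp add: algebra_simps)
    finally show ?thesis
      using False k(1) by (intro exI[of _ "{(c, k)}"]) (simp add: not_le)
  qed
  obtain P1 where P1: "?Q a P1" using ex[of a] by auto
  obtain P2 where P2: "?Q (a + k) P2" using ex[of "a + k"] by auto
  \<comment> \<open>Positive length makes each interval nonempty, so none lies in both halves; a
    common element would be counted only once in the sum over the union.\<close>
  have disj: "P1 \<inter> P2 = {}"
  proof (rule ccontr)
    assume "P1 \<inter> P2 \<noteq> {}"
    then obtain J where J: "J \<in> P1" "J \<in> P2" by blast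
    then have "fst J \<in> {fst J..<fst J + snd J}" using P1 by auto
    then have "fst J \<in> {a..<a + k}" "fst J \<in> {a + k..<a + k + k}"
      using P1 P2 J by blast+
    then show False by simp
  qed
  have ind: "indicator {a..<a + h} x = indicator {a..<a + k} x + (indicator {a + k..<a + k + k} x :: real)" for x
    using k by (auto split: split_indicator)
  show ?case
  proof (intro exI[of _ "P1 \<union> P2"] conjI ballI allI)
    show "finite (P1 \<union> P2)" using P1 P2 by simp
  next
    fix J assume "J \<in> P1 \<union> P2"
    then have J: "0 < snd J \<and> ({fst J..<fst J + snd J} \<subseteq> {a..<a + k} \<or> {fst J..<fst J + snd J} \<subseteq> {a + k..<a + k + k})
       \<and> mass F J \<le> 2 * \<alpha> * snd J \<and> (\<alpha> * snd J < mass F J \<or> snd J \<le> k / 2 ^ M)"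
      using P1 P2 by blast
    have "{a..<a + k} \<subseteq> {a..<a + h}" "{a + k..<a + k + k} \<subseteq> {a..<a + h}" using k by auto
    then show "{fst J..<fst J + snd J} \<subseteq> {a..<a + h}" using J by blast
    show "0 < snd J" "mass F J \<le> 2 * \<alpha> * snd J" using J by auto
    show "\<alpha> * snd J < mass F J \<or> snd J \<le> h / 2 ^ Suc M" using J by (simp add: k_def)
  next
    fix x
    show "indicator {a..<a + h} x = (\<Sum>J\<in>P1 \<union> P2. indicator {fst J..<fst J + snd J} x :: real)"
      using P1 P2 disj by (subst sum.union_disjoint) (auto simp: ind)
  qed
qed

definition conv :: "(real \<Rightarrow> complex) \<Rightarrow> (real \<Rightarrow> complex) \<Rightarrow> real \<Rightarrow> complex"
  where "conv K f x = (LINT y|torus. K (x - y) * f y)"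

lemma continuous_on_one_sided_kernel [continuous_intros]:
  "continuous_on S g \<Longrightarrow> continuous_on S (\<lambda>x. one_sided_kernel a M (g x))"
  unfolding one_sided_kernel_def
  by (intro continuous_intros continuous_on_compose2[OF continuous_on_character[of UNIV]]) auto

lemma norm_one_sided_kernel_le: "norm (one_sided_kernel a M x) \<le> (\<Sum>t<M. norm (a t))"
  unfolding one_sided_kernel_def by (rule order_trans[OF norm_sum]) (simp add: norm_mult)

lemma integrable_kernel_mult:
  assumes "integrable torus f"
  shows "integrable torus (\<lambda>y. one_sided_kernel a M (x - y) * f y)"
  by (rule integrable_bounded_mult[OF assms _ norm_one_sided_kernel_le])
     (intro continuous_measurable_torus continuous_intros)

lemma conv_one_sided_kernel_eq:
  assumes "integrable torus f"
  shows "conv (one_sided_kernel a M) f = fourier_sum (int ` {..<M}) (\<lambda>t. a (nat t)) f"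
  unfolding fourier_sum_eq_integral[OF assms] conv_def one_sided_kernel_def fun_eq_iff
  by (simp add: sum.reindex)

lemma borel_measurable_norm_gt:
  "f \<in> borel_measurable torus \<Longrightarrow> {x \<in> {0..<1}. a < norm (f x)} \<in> sets torus"
  for f :: "real \<Rightarrow> complex"
  using borel_measurable_less[of "\<lambda>_. a" torus "\<lambda>x. norm (f x)"] by simp

text \<open>The constants arise at level \<open>\<alpha> / 3\<close>: 18 is 2 * 9, from Chebyshev
  and the \<open>L^2\<close> bound of the good part; 12, rounded up to 13, is the measure of three
  windows of width \<open>4 * snd J\<close>; 4608 is 3 * 1536, from Markov's inequality for the
  majorant of the selected pieces. None depends on \<open>M\<close>.\<close>

theorem one_sided_weak_type:
  assumes a: "marcinkiewicz_seq A a" and M: "\<And>t. t \<ge> M \<Longrightarrow> a t = 0"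
    and f: "integrable torus f" and lam: "0 < \<alpha>"
  defines "T \<equiv> conv (one_sided_kernel a M)"
  shows "\<alpha> * distribution_fun (T f) \<alpha> \<le>
    (18 * A\<^sup>2 + 13 + 4608 * pi\<^sup>2 * A) * (LINT x|torus. norm (f x))"
proof -
  define K where "K = one_sided_kernel a M"
  define N where "N = (LINT x|torus. norm (f x))"
  have A: "0 \<le> A" by (rule marcinkiewicz_seq_nonneg[OF a])
  have N: "0 \<le> N" by (simp add: N_def)
  let ?C = "18 * A\<^sup>2 + 13 + 4608 * pi\<^sup>2 * A"
  have C: "1 \<le> ?C" using A by (simp add: add_increasing)
  have intK: "integrable torus (\<lambda>y. K (x - y) * u y)" if "integrable torus u" for u x
    unfolding K_def by (rule integrable_kernel_mult[OF that])
  show ?thesis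
  \<comment> \<open>If \<open>\<alpha>\<close> is below the mean of \<open>norm f\<close>, the total
    measure 1 already gives the claim. Otherwise the unit interval itself has mean at most
    \<open>\<alpha>\<close> and can start the stopping time.\<close>
  proof (cases "N \<le> \<alpha>")
    case False
    have "distribution_fun (T f) \<alpha> \<le> measure torus (space torus)"
      unfolding distribution_fun_def by (rule torus.bounded_measure)
    then have "distribution_fun (T f) \<alpha> \<le> 1" by simp
    then have "\<alpha> * distribution_fun (T f) \<alpha> \<le> \<alpha> * 1" using lam by (intro mult_left_mono) auto
    also have "\<dots> \<le> 1 * N" using False by simp
    also have "\<dots> \<le> ?C * N" using C N by (rule mult_right_mono)
    finally show ?thesis by (simp add: N_def)
  next
    case True
    define F where "F = (\<lambda>x. norm (f x))"
    have F: "integrable torus F" "\<And>x. 0 \<le> F x" using f by (auto simp: F_def)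
    define L where "L = 2 * pi * (\<Sum>t<M. real t * norm (a t))"
    have L: "0 \<le> L" by (auto simp: L_def intro!: mult_nonneg_nonneg sum_nonneg)
    have Lip: "norm (K x - K y) \<le> L * \<bar>x - y\<bar>" for x y
      unfolding K_def L_def by (rule one_sided_kernel_lipschitz)
    \<comment> \<open>The depth may depend on \<open>M\<close>, \<open>f\<close> and
      \<open>\<alpha>\<close>, because \<open>n\<close> does not enter the constant. The 6 is 3 * 2:
      a third of \<open>\<alpha>\<close> is available, and each \<open>\<beta> J\<close> has at most
      twice the mass of \<open>f\<close> on \<open>J\<close>.\<close>
    obtain n where "6 * L * N / \<alpha> < 2 ^ n"
      using real_arch_pow[of 2 "6 * L * N / \<alpha>"] by auto
    then have n: "L * (1 / 2 ^ n) * (2 * N) \<le> \<alpha> / 3"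
      using lam by (simp add: field_simps)
    have mass01: "mass F (0, 1) = N"
      unfolding mass_def N_def F_def by (intro Bochner_Integration.integral_cong) auto
    have "mass F (0, 1) \<le> \<alpha> * 1" using True by (simp add: mass01)
    from calderon_zygmund_intervals[OF F lam _ _ this, of n] obtain P where
      fin: "finite P" and
      P: "\<And>J. J \<in> P \<Longrightarrow> 0 < snd J \<and> {fst J..<fst J + snd J} \<subseteq> {0..<1} \<and> mass F J \<le> 2 * \<alpha> * snd J \<and>
        (\<alpha> * snd J < mass F J \<or> snd J \<le> 1 / 2 ^ n)" and
      part: "\<And>x. indicator {0..<1} x = (\<Sum>J\<in>P. indicator {fst J..<fst J + snd J} x :: real)"
      by auto
    define \<phi> where "\<phi> J x = (indicator {fst J..<fst J + snd J} x :: real)" for J :: "real \<times> real" and x :: real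
    have part': "(\<Sum>J\<in>P. \<phi> J x) = 1" if "x \<in> {0..<1}" for x
      using part[of x] that by (simp add: \<phi>_def)
    have \<phi>01: "0 \<le> \<phi> J x" "\<phi> J x \<le> 1" for J x by (auto simp: \<phi>_def split: split_indicator)
    have setsJ: "{fst J..<fst J + snd J} \<in> sets torus" if "J \<in> P" for J
      using P[OF that] by (intro interval_sets_torus) auto
    have int\<phi>: "integrable torus (\<phi> J)" if "J \<in> P" for J
      unfolding \<phi>_def using setsJ[OF that] by (intro integrable_real_indicator) (auto simp: less_top[symmetric])
    have I\<phi>: "(LINT x|torus. \<phi> J x) = snd J" if "J \<in> P" for J
    proof -
      have "{fst J..<fst J + snd J} \<inter> {0..<1} = {fst J..<fst J + snd J}" using P[OF that] by auto
      then have "(LINT x|torus. \<phi> J x) = measure torus {fst J..<fst J + snd J}"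
        unfolding \<phi>_def by simp
      also have "\<dots> = snd J" using P[OF that] by (subst measure_torus) auto
      finally show ?thesis .
    qed
    have int\<phi>f: "integrable torus (\<lambda>x. \<phi> J x *\<^sub>R f x)" if "J \<in> P" for J
      unfolding \<phi>_def by (rule integrable_mult_indicator[OF setsJ[OF that] f])
    have int\<phi>F: "integrable torus (\<lambda>x. \<phi> J x * F x)" if "J \<in> P" for J
      unfolding \<phi>_def using P[OF that] by (intro integrable_indicator_mult F) auto
    have massJ: "mass F J = (LINT x|torus. \<phi> J x * F x)" for J
      by (simp add: mass_def \<phi>_def)
    have mass0: "0 \<le> mass F J" for J
      unfolding massJ using F \<phi>01 by (intro integral_nonneg_AE AE_I2 mult_nonneg_nonneg)
    have sum_mass: "(\<Sum>J\<in>P. mass F J) = N"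
    proof -
      have "(\<Sum>J\<in>P. mass F J) = (LINT x|torus. (\<Sum>J\<in>P. \<phi> J x * F x))"
        unfolding massJ using int\<phi>F by (simp add: Bochner_Integration.integral_sum)
      also have "\<dots> = N"
        unfolding N_def F_def
        by (intro Bochner_Integration.integral_cong refl)
           (simp add: sum_distrib_right[symmetric] part')
      finally show ?thesis .
    qed
    define avg where "avg J = (LINT x|torus. \<phi> J x *\<^sub>R f x) /\<^sub>R snd J" for J
    have avg: "norm (avg J) * snd J \<le> mass F J" "norm (avg J) \<le> 2 * \<alpha>" if "J \<in> P" for J
    proof -
      have k: "0 < snd J" using P[OF that] by simp
      have "norm (LINT x|torus. \<phi> J x *\<^sub>R f x) \<le> (LINT x|torus. norm (\<phi> J x *\<^sub>R f x))"
        by (rule integral_norm_bound)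
      also have "\<dots> = mass F J" unfolding massJ by (simp add: F_def \<phi>01)
      finally have "norm (LINT x|torus. \<phi> J x *\<^sub>R f x) \<le> mass F J" .
      then show *: "norm (avg J) * snd J \<le> mass F J" using k by (simp add: avg_def field_simps)
      then have "norm (avg J) * snd J \<le> 2 * \<alpha> * snd J" using P[OF that] by linarith
      then show "norm (avg J) \<le> 2 * \<alpha>" using k by simp
    qed
    \<comment> \<open>The good function takes averages on the unselected small intervals too,
      instead of keeping \<open>f\<close> there. This makes \<open>norm g \<le> 2 * \<alpha>\<close>
      immediate and turns the rest of \<open>f\<close> into mean-zero pieces on all of
      \<open>P\<close>.\<close>
    define g where "g x = (\<Sum>J\<in>P. \<phi> J x *\<^sub>R avg J)" for x
    define \<beta> where "\<beta> J x = \<phi> J x *\<^sub>R (f x - avg J)" for J x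
    have intc: "integrable torus (\<lambda>x. \<phi> J x *\<^sub>R avg J)" if "J \<in> P" for J
      using int\<phi>[OF that] by simp
    have int\<beta>: "integrable torus (\<beta> J)" if "J \<in> P" for J
      unfolding \<beta>_def[abs_def] scaleR_diff_right
      using int\<phi>f[OF that] intc[OF that] by simp
    have intg: "integrable torus g"
      unfolding g_def[abs_def] using intc by simp
    have f_eq: "f x = g x + (\<Sum>J\<in>P. \<beta> J x)" if "x \<in> {0..<1}" for x
      unfolding g_def \<beta>_def scaleR_diff_right sum_subtractf
      by (simp add: scaleR_left.sum[symmetric] part'[OF that])
    have norm_g: "norm (g x) \<le> (\<Sum>J\<in>P. \<phi> J x * norm (avg J))" for x
      unfolding g_def by (rule order_trans[OF norm_sum]) (simp add: \<phi>01)
    have g_bdd: "norm (g x) \<le> 2 * \<alpha>" if "x \<in> {0..<1}" for x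
    proof -
      have "norm (g x) \<le> (\<Sum>J\<in>P. \<phi> J x * (2 * \<alpha>))"
        by (rule order_trans[OF norm_g]) (intro sum_mono mult_left_mono avg \<phi>01)
      then show ?thesis by (simp add: sum_distrib_right[symmetric] part'[OF that])
    qed
    have int_normg: "(LINT x|torus. norm (g x)) \<le> N"
    proof -
      have "(LINT x|torus. norm (g x)) \<le> (LINT x|torus. (\<Sum>J\<in>P. \<phi> J x * norm (avg J)))"
        using intg int\<phi> by (intro integral_mono norm_g) auto
      also have "\<dots> = (\<Sum>J\<in>P. norm (avg J) * snd J)"
        using int\<phi> I\<phi> by (subst Bochner_Integration.integral_sum) (auto intro!: sum.cong)
      also have "\<dots> \<le> (\<Sum>J\<in>P. mass F J)" by (intro sum_mono avg)
      finally show ?thesis by (simp add: sum_mass)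
    qed
    have g_meas: "g \<in> borel_measurable torus" using intg by simp
    have intg2: "integrable torus (\<lambda>x. (norm (g x))\<^sup>2)"
    proof (rule integrable_torus_bounded[where B = "(2 * \<alpha>)\<^sup>2"])
      show "(\<lambda>x. (norm (g x))\<^sup>2) \<in> borel_measurable torus" using g_meas by simp
      show "norm ((norm (g x))\<^sup>2) \<le> (2 * \<alpha>)\<^sup>2" if "x \<in> {0..<1}" for x
        using power_mono[OF g_bdd[OF that], of 2] by simp
    qed
    have g2: "(LINT x|torus. (norm (g x))\<^sup>2) \<le> 2 * \<alpha> * N"
    proof -
      have "(LINT x|torus. (norm (g x))\<^sup>2) \<le> (LINT x|torus. 2 * \<alpha> * norm (g x))"
        using intg intg2 by (intro integral_mono) (auto simp: power2_eq_square intro!: mult_right_mono g_bdd)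
      also have "\<dots> \<le> 2 * \<alpha> * N" using int_normg lam by simp
      finally show ?thesis .
    qed
    have Tg_eq: "T g = fourier_sum (int ` {..<M}) (\<lambda>t. a (nat t)) g"
      unfolding T_def by (rule conv_one_sided_kernel_eq[OF intg])
    have Tg_cont: "continuous_on UNIV (T g)" unfolding Tg_eq by (intro continuous_intros)
    have Tg2: "(LINT x|torus. (norm (T g x))\<^sup>2) \<le> A\<^sup>2 * (2 * \<alpha> * N)"
    proof -
      have "(LINT x|torus. (norm (T g x))\<^sup>2) \<le> A\<^sup>2 * (LINT x|torus. (norm (g x))\<^sup>2)"
        unfolding Tg_eq
        by (rule fourier_sum_L2_bound) (use g_meas intg2 marcinkiewicz_seqD(1)[OF a] in auto)
      also have "\<dots> \<le> A\<^sup>2 * (2 * \<alpha> * N)" using g2 by (intro mult_left_mono) auto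
      finally show ?thesis .
    qed
    have T_split: "T f x = T g x + (\<Sum>J\<in>P. T (\<beta> J) x)" for x
    proof -
      have "T f x = (LINT y|torus. K (x - y) * g y + (\<Sum>J\<in>P. K (x - y) * \<beta> J y))"
        unfolding T_def conv_def K_def[symmetric]
        by (intro Bochner_Integration.integral_cong refl)
           (simp add: f_eq algebra_simps sum_distrib_left)
      also have "\<dots> = T g x + (\<Sum>J\<in>P. T (\<beta> J) x)"
        unfolding T_def conv_def K_def[symmetric]
        using intK[OF intg] intK[OF int\<beta>] by simp
      finally show ?thesis .
    qed
    have \<beta>0: "(LINT y|torus. \<beta> J y) = 0" if "J \<in> P" for J
      unfolding \<beta>_def scaleR_diff_right
      using int\<phi>f[OF that] intc[OF that] int\<phi>[OF that] I\<phi>[OF that] P[OF that]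
      by (simp add: avg_def)
    have \<beta>1: "(LINT y|torus. norm (\<beta> J y)) \<le> 2 * mass F J" if "J \<in> P" for J
    proof -
      have "(LINT y|torus. norm (\<beta> J y)) \<le> (LINT y|torus. \<phi> J y * F y + norm (avg J) * \<phi> J y)"
      proof (rule integral_mono)
        show "norm (\<beta> J y) \<le> \<phi> J y * F y + norm (avg J) * \<phi> J y" for y
          using mult_left_mono[OF norm_triangle_ineq4[of "f y" "avg J"] \<phi>01(1)[of J y]]
          by (simp add: \<beta>_def F_def \<phi>01 distrib_left mult.commute)
      qed (use int\<beta>[OF that] int\<phi>F[OF that] int\<phi>[OF that] in auto)
      also have "\<dots> = mass F J + norm (avg J) * snd J"
        using int\<phi>F[OF that] int\<phi>[OF that] I\<phi>[OF that] by (simp add: massJ)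
      also have "\<dots> \<le> 2 * mass F J" using avg(1)[OF that] by simp
      finally show ?thesis .
    qed
    \<comment> \<open>As \<open>\<beta> J\<close> has mean zero, the constant
      \<open>K (x - fst J)\<close> may be subtracted from the kernel. The variation bound
      \<open>D\<close> is left open: it is the Lipschitz bound on unselected intervals and the decay
      estimate on selected ones.\<close>
    have T\<beta>: "norm (T (\<beta> J) x) \<le> D * (2 * mass F J)"
      if J: "J \<in> P" and D: "0 \<le> D" "\<And>y. y \<in> {fst J..<fst J + snd J} \<Longrightarrow> norm (K (x - y) - K (x - fst J)) \<le> D"
      for J x D
    proof -
      have "T (\<beta> J) x = (LINT y|torus. K (x - y) * \<beta> J y) - K (x - fst J) * (LINT y|torus. \<beta> J y)"
        by (simp add: T_def conv_def K_def \<beta>0[OF J])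
      also have "\<dots> = (LINT y|torus. (K (x - y) - K (x - fst J)) * \<beta> J y)"
        using intK[OF int\<beta>[OF J]] int\<beta>[OF J] by (simp add: algebra_simps)
      finally have "norm (T (\<beta> J) x) \<le> (LINT y|torus. norm ((K (x - y) - K (x - fst J)) * \<beta> J y))"
        by (simp only: integral_norm_bound)
      also have "\<dots> \<le> (LINT y|torus. D * norm (\<beta> J y))"
      proof (rule integral_mono)
        show "integrable torus (\<lambda>y. norm ((K (x - y) - K (x - fst J)) * \<beta> J y))"
          using intK[OF int\<beta>[OF J]] int\<beta>[OF J] by (simp add: left_diff_distrib)
        show "integrable torus (\<lambda>y. D * norm (\<beta> J y))" using int\<beta>[OF J] by simp
        fix y
        show "norm ((K (x - y) - K (x - fst J)) * \<beta> J y) \<le> D * norm (\<beta> J y)"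
        proof (cases "y \<in> {fst J..<fst J + snd J}")
          case True
          then show ?thesis using D(2)[of y] by (simp add: norm_mult mult_right_mono)
        qed (simp add: \<beta>_def \<phi>_def)
      qed
      also have "\<dots> \<le> D * (2 * mass F J)" using \<beta>1[OF J] D(1) by (simp add: mult_left_mono)
      finally show ?thesis .
    qed
    define Bd where "Bd = {J \<in> P. \<alpha> * snd J < mass F J}"
    have Bd: "Bd \<subseteq> P" "finite Bd" using fin by (auto simp: Bd_def)
    have small: "norm (\<Sum>J\<in>P - Bd. T (\<beta> J) x) \<le> \<alpha> / 3" for x
    proof -
      have "norm (\<Sum>J\<in>P - Bd. T (\<beta> J) x) \<le> (\<Sum>J\<in>P - Bd. norm (T (\<beta> J) x))" by (rule norm_sum)
      also have "\<dots> \<le> (\<Sum>J\<in>P - Bd. L * (1 / 2 ^ n) * (2 * mass F J))"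
      proof (rule sum_mono)
        fix J assume J: "J \<in> P - Bd"
        then have k: "snd J \<le> 1 / 2 ^ n" using P[of J] by (auto simp: Bd_def)
        show "norm (T (\<beta> J) x) \<le> L * (1 / 2 ^ n) * (2 * mass F J)"
        proof (rule T\<beta>)
          fix y assume y: "y \<in> {fst J..<fst J + snd J}"
          have "norm (K (x - y) - K (x - fst J)) \<le> L * \<bar>(x - y) - (x - fst J)\<bar>" by (rule Lip)
          also have "\<dots> \<le> L * (1 / 2 ^ n)" using y k L by (intro mult_left_mono) auto
          finally show "norm (K (x - y) - K (x - fst J)) \<le> L * (1 / 2 ^ n)" .
        qed (use J L in auto)
      qed
      also have "\<dots> \<le> (\<Sum>J\<in>P. L * (1 / 2 ^ n) * (2 * mass F J))"
        using fin L mass0 by (intro sum_mono2) auto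
      also have "\<dots> = L * (1 / 2 ^ n) * (2 * N)"
        by (simp add: sum_mass[symmetric] sum_distrib_left)
      also note n
      finally show ?thesis .
    qed
    \<comment> \<open>The windows are centred at the left endpoint, the point whose kernel value is
      subtracted. The translates by -1 and 1 catch points that are close to \<open>J\<close> across
      the seam at 0.\<close>
    define E where "E J = (\<Union>k\<in>{-1, 0, 1}. {fst J + k - 2 * snd J..fst J + k + 2 * snd J} \<inter> {0..<1})" for J :: "real \<times> real"
    have E_sets: "E J \<in> sets torus" for J
      unfolding E_def by (intro sets.finite_UN sets_torusI) auto
    have E_meas: "measure torus (E J) \<le> 12 * snd J" if "J \<in> P" for J
    proof -
      have "measure torus (E J) \<le> (\<Sum>k\<in>{-1, 0, 1}. measure torus ({fst J + k - 2 * snd J..fst J + k + 2 * snd J} \<inter> {0..<1}))"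
        unfolding E_def by (intro measure_UNION_le sets_torusI) auto
      also have "\<dots> \<le> (\<Sum>k\<in>{-1, 0, 1::real}. 2 * (2 * snd J))"
        using P[OF that] by (intro sum_mono measure_torus_interval_le) auto
      finally show ?thesis by simp
    qed
    define G where "G J x = (\<Sum>k\<in>{-1, 0, 1}. snd J / ((x - (fst J + k))\<^sup>2 + (snd J)\<^sup>2))" for J :: "real \<times> real" and x :: real
    have G0: "0 \<le> G J x" if "J \<in> P" for J x
      unfolding G_def using P[OF that] by (intro sum_nonneg divide_nonneg_nonneg) auto
    have intG: "integrable torus (G J)" if "J \<in> P" for J
      unfolding G_def[abs_def] using P[OF that]
      by (intro Bochner_Integration.integrable_sum integral_poisson_like_le) auto
    have IG: "(LINT x|torus. G J x) \<le> 3 * pi" if "J \<in> P" for J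
    proof -
      have "(LINT x|torus. G J x) = (\<Sum>k\<in>{-1, 0, 1}. (LINT x|torus. snd J / ((x - (fst J + k))\<^sup>2 + (snd J)\<^sup>2)))"
        unfolding G_def using P[OF that]
        by (intro Bochner_Integration.integral_sum integral_poisson_like_le) auto
      also have "\<dots> \<le> (\<Sum>k\<in>{-1, 0, 1::real}. pi)"
        using P[OF that] by (intro sum_mono integral_poisson_like_le) auto
      finally show ?thesis by simp
    qed
    \<comment> \<open>\<open>H\<close> dominates the selected pieces only off the exceptional set,
      but it is integrable over the whole circle, so its integral needs no restriction. The 1536 is
      256 * 3 * 2, from the kernel, the three translates and the mass of
      \<open>\<beta> J\<close>.\<close>
    define H where "H x = (\<Sum>J\<in>Bd. 256 * pi * A * G J x * (2 * mass F J))" for x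
    have H0: "0 \<le> H x" for x
      unfolding H_def using A G0 Bd mass0 by (intro sum_nonneg mult_nonneg_nonneg) auto
    have intH: "integrable torus H"
      unfolding H_def[abs_def] using intG Bd
      by (intro Bochner_Integration.integrable_sum integrable_mult_left integrable_mult_right) blast
    have IH: "(LINT x|torus. H x) \<le> 1536 * pi\<^sup>2 * A * N"
    proof -
      have "(LINT x|torus. H x) = (\<Sum>J\<in>Bd. 256 * pi * A * (LINT x|torus. G J x) * (2 * mass F J))"
        unfolding H_def using intG Bd by (subst Bochner_Integration.integral_sum) auto
      also have "\<dots> \<le> (\<Sum>J\<in>Bd. 256 * pi * A * (3 * pi) * (2 * mass F J))"
        using A mass0 IG Bd by (intro sum_mono mult_right_mono mult_left_mono) auto
      also have "\<dots> \<le> (\<Sum>J\<in>P. 256 * pi * A * (3 * pi) * (2 * mass F J))"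
        using A mass0 fin Bd by (intro sum_mono2) auto
      also have "\<dots> = 1536 * pi\<^sup>2 * A * N"
        unfolding sum_distrib_left[symmetric] sum_mass by (simp add: power2_eq_square)
      finally show ?thesis .
    qed
    have bad: "norm (\<Sum>J\<in>Bd. T (\<beta> J) x) \<le> H x" if x: "x \<in> {0..<1}" "x \<notin> (\<Union>J\<in>Bd. E J)" for x
    proof -
      have "norm (\<Sum>J\<in>Bd. T (\<beta> J) x) \<le> (\<Sum>J\<in>Bd. norm (T (\<beta> J) x))" by (rule norm_sum)
      also have "\<dots> \<le> H x"
        unfolding H_def
      proof (rule sum_mono)
        fix J assume "J \<in> Bd"
        then have J: "J \<in> P" and xE: "x \<notin> E J" using Bd x by auto
        show "norm (T (\<beta> J) x) \<le> 256 * pi * A * G J x * (2 * mass F J)"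
        proof (rule T\<beta>[OF J])
          show "0 \<le> 256 * pi * A * G J x" using A G0[OF J] by (intro mult_nonneg_nonneg) auto
          fix y assume y: "y \<in> {fst J..<fst J + snd J}"
          have "y \<in> {0..<1}" "fst J \<in> {0..<1}" using P[OF J] y by auto
          moreover have "2 * snd J < \<bar>x - fst J - k\<bar>" if "k \<in> {-1, 0, 1}" for k
          proof (rule ccontr)
            assume "\<not> ?thesis"
            then have "x \<in> {fst J + k - 2 * snd J..fst J + k + 2 * snd J}" by (auto simp: abs_le_iff not_less)
            then show False using xE x(1) that unfolding E_def by blast
          qed
          ultimately have "norm (K (x - y) - K (x - fst J)) \<le>
              256 * pi * A * snd J * (\<Sum>k\<in>{-1, 0, 1}. 1 / ((x - fst J - k)\<^sup>2 + (snd J)\<^sup>2))"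
            unfolding K_def using x(1) y by (intro one_sided_kernel_diff_le[OF a M]) auto
          also have "\<dots> = 256 * pi * A * G J x"
            by (simp add: G_def algebra_simps)
          finally show "norm (K (x - y) - K (x - fst J)) \<le> 256 * pi * A * G J x" .
        qed
      qed
      finally show ?thesis .
    qed
    \<comment> \<open>The unselected pieces need no set of their own, being at most
      \<open>\<alpha> / 3\<close> everywhere.\<close>
    let ?S1 = "{x \<in> {0..<1}. \<alpha> / 3 < norm (T g x)}" and ?S2 = "\<Union>J\<in>Bd. E J"
      and ?S3 = "{x \<in> {0..<1}. \<alpha> / 3 \<le> H x}"
    have S1: "?S1 \<in> sets torus"
      by (rule borel_measurable_norm_gt) (rule continuous_measurable_torus[OF Tg_cont])
    have S2: "?S2 \<in> sets torus" using Bd E_sets by (intro sets.finite_UN) auto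
    have S3: "?S3 \<in> sets torus"
      using borel_measurable_le[of "\<lambda>_. \<alpha> / 3" torus H] intH by simp
    have "distribution_fun (T f) \<alpha> \<le> measure torus (?S1 \<union> ?S2 \<union> ?S3)"
      unfolding distribution_fun_def
    proof (rule torus.finite_measure_mono)
      show "{x \<in> space torus. \<alpha> < norm (T f x)} \<subseteq> ?S1 \<union> ?S2 \<union> ?S3"
      proof (rule subsetI, rule ccontr)
        fix x assume "x \<in> {x \<in> space torus. \<alpha> < norm (T f x)}" and nx: "x \<notin> ?S1 \<union> ?S2 \<union> ?S3"
        then have x: "x \<in> {0..<1}" "\<alpha> < norm (T f x)" by auto
        have eq: "(\<Sum>J\<in>P. T (\<beta> J) x) = (\<Sum>J\<in>P - Bd. T (\<beta> J) x) + (\<Sum>J\<in>Bd. T (\<beta> J) x)"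
          by (rule sum.subset_diff[OF Bd(1) fin])
        have "norm (T f x) \<le> norm (T g x) + (norm (\<Sum>J\<in>P - Bd. T (\<beta> J) x) + norm (\<Sum>J\<in>Bd. T (\<beta> J) x))"
          unfolding T_split[of x] eq
          by (intro order_trans[OF norm_triangle_ineq] add_left_mono norm_triangle_ineq)
        moreover have "norm (\<Sum>J\<in>Bd. T (\<beta> J) x) \<le> H x" using x(1) nx by (intro bad) blast+
        ultimately have "\<alpha> < norm (T g x) + (\<alpha> / 3 + H x)" using small[of x] x(2) by linarith
        moreover have "H x < \<alpha> / 3" "norm (T g x) \<le> \<alpha> / 3" using x(1) nx by auto
        ultimately show False by linarith
      qed
    qed (use S1 S2 S3 in auto)
    also have "\<dots> \<le> measure torus ?S1 + measure torus ?S2 + measure torus ?S3"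
      using S1 S2 S3 measure_Un_le[of "?S1 \<union> ?S2" torus ?S3] measure_Un_le[of ?S1 torus ?S2]
      by (auto intro: order_trans)
    finally have dist: "distribution_fun (T f) \<alpha> \<le> measure torus ?S1 + measure torus ?S2 + measure torus ?S3" .
    have m1: "\<alpha> * measure torus ?S1 \<le> 18 * A\<^sup>2 * N"
    proof -
      have "measure torus ?S1 \<le> measure torus {x \<in> space torus. (\<alpha> / 3)\<^sup>2 \<le> (norm (T g x))\<^sup>2}"
      proof (rule torus.finite_measure_mono)
        show "?S1 \<subseteq> {x \<in> space torus. (\<alpha> / 3)\<^sup>2 \<le> (norm (T g x))\<^sup>2}"
          using lam by (auto intro!: power_mono)
        show "{x \<in> space torus. (\<alpha> / 3)\<^sup>2 \<le> (norm (T g x))\<^sup>2} \<in> sets torus"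
          by (intro borel_measurable_le continuous_measurable_torus continuous_intros Tg_cont)
      qed
      also have "\<dots> \<le> (LINT x|torus. (norm (T g x))\<^sup>2) / (\<alpha> / 3)\<^sup>2"
        by (rule integral_Markov_inequality_measure[where A = "{}"])
           (use lam in \<open>auto intro!: integrable_torus_continuous continuous_intros Tg_cont\<close>)
      also have "\<dots> \<le> A\<^sup>2 * (2 * \<alpha> * N) / (\<alpha> / 3)\<^sup>2"
        using Tg2 by (rule divide_right_mono) simp
      finally have "\<alpha> * measure torus ?S1 \<le> \<alpha> * (A\<^sup>2 * (2 * \<alpha> * N) / (\<alpha> / 3)\<^sup>2)"
        using lam by (intro mult_left_mono) auto
      then show ?thesis using lam by (simp add: power2_eq_square)
    qed
    have m2: "\<alpha> * measure torus ?S2 \<le> 12 * N"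
    proof -
      have "measure torus ?S2 \<le> (\<Sum>J\<in>Bd. measure torus (E J))"
        using Bd E_sets by (intro measure_UNION_le) auto
      then have "\<alpha> * measure torus ?S2 \<le> \<alpha> * (\<Sum>J\<in>Bd. measure torus (E J))"
        using lam by (intro mult_left_mono) auto
      also have "\<dots> = (\<Sum>J\<in>Bd. \<alpha> * measure torus (E J))" by (rule sum_distrib_left)
      also have "\<dots> \<le> (\<Sum>J\<in>Bd. 12 * mass F J)"
      proof (rule sum_mono)
        fix J assume J: "J \<in> Bd"
        then have "\<alpha> * measure torus (E J) \<le> \<alpha> * (12 * snd J)"
          using lam E_meas[of J] Bd by (intro mult_left_mono) auto
        then show "\<alpha> * measure torus (E J) \<le> 12 * mass F J" using J by (auto simp: Bd_def)
      qed
      also have "\<dots> \<le> (\<Sum>J\<in>P. 12 * mass F J)" using fin Bd mass0 by (intro sum_mono2) auto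
      also have "\<dots> = 12 * N" by (simp add: sum_mass[symmetric] sum_distrib_left)
      finally show ?thesis .
    qed
    have m3: "\<alpha> * measure torus ?S3 \<le> 4608 * pi\<^sup>2 * A * N"
    proof -
      have "measure torus ?S3 \<le> (LINT x|torus. H x) / (\<alpha> / 3)"
        using integral_Markov_inequality_measure[OF intH, of "{}" "\<alpha> / 3"] lam H0 by simp
      also have "\<dots> \<le> (1536 * pi\<^sup>2 * A * N) / (\<alpha> / 3)"
        using IH lam by (intro divide_right_mono) auto
      finally have "\<alpha> * measure torus ?S3 \<le> \<alpha> * ((1536 * pi\<^sup>2 * A * N) / (\<alpha> / 3))"
        using lam by (intro mult_left_mono) auto
      then show ?thesis using lam by simp
    qed
    have "\<alpha> * distribution_fun (T f) \<alpha> \<le> \<alpha> * (measure torus ?S1 + measure torus ?S2 + measure torus ?S3)"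
      using dist lam by (intro mult_left_mono) auto
    also have "\<dots> \<le> 18 * A\<^sup>2 * N + 12 * N + 4608 * pi\<^sup>2 * A * N"
      using m1 m2 m3 by (simp add: algebra_simps)
    also have "\<dots> \<le> ?C * N" using N by (simp add: algebra_simps)
    finally show ?thesis by (simp add: N_def)
  qed
qed

section \<open>Truncated multipliers\<close>

lemma fdiff_pow_bound:
  assumes "\<And>t. t \<ge> s \<Longrightarrow> norm (a t) \<le> B" "t \<ge> s"
  shows "norm ((fdiff ^^ l) a t) \<le> 2 ^ l * B"
  using assms(2)
proof (induction l arbitrary: t)
  case 0
  then show ?case using assms(1) by simp
next
  case (Suc l)
  have "norm ((fdiff ^^ Suc l) a t) \<le> norm ((fdiff ^^ l) a (Suc t)) + norm ((fdiff ^^ l) a t)"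
    unfolding funpow.simps o_apply fdiff_def[of "(fdiff ^^ l) a"] by (rule norm_triangle_ineq4)
  also have "\<dots> \<le> 2 ^ l * B + 2 ^ l * B"
    using Suc by (intro add_mono) auto
  finally show ?case by (simp add: mult_ac)
qed

lemma fdiff_pow_cong:
  assumes "\<And>t. t \<ge> s \<Longrightarrow> a t = b t" "t \<ge> s"
  shows "(fdiff ^^ l) a t = (fdiff ^^ l) b t"
  using assms(2) by (induction l arbitrary: t) (simp_all add: assms(1) fdiff_def)

lemma fdiff_pow_cnj: "(fdiff ^^ l) (\<lambda>t. cnj (a t)) t = cnj ((fdiff ^^ l) a t)"
  by (induction l arbitrary: t) (simp_all add: fdiff_def)

text \<open>Reversal turns forward into backward differences up to a sign; the base index becomes
  the lower end of the window. The condition \<open>t + l \<le> N\<close> keeps subtraction on the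
  naturals exact.\<close>

lemma fdiff_pow_reverse:
  "t + l \<le> N \<Longrightarrow> norm ((fdiff ^^ l) (\<lambda>s. a (N - s)) t) = norm ((fdiff ^^ l) a (N - t - l))"
proof -
  have "(fdiff ^^ l) (\<lambda>s. a (N - s)) t = (-1) ^ l * (fdiff ^^ l) a (N - t - l)" if "t + l \<le> N" for t
    using that
  proof (induction l arbitrary: t)
    case (Suc l)
    have "N - Suc t - l = N - t - Suc l" "N - t - l = Suc (N - t - Suc l)" using Suc.prems by auto
    then show ?case
      using Suc.IH[of t] Suc.IH[of "Suc t"] Suc.prems by (simp add: fdiff_def algebra_simps)
  qed simp
  then show "t + l \<le> N \<Longrightarrow> ?thesis" by (simp add: norm_mult norm_power)
qed

lemma fdiff_pow_mult:
  "(fdiff ^^ 1) (\<lambda>t. a t * b t) t = a t * (fdiff ^^ 1) b t + (fdiff ^^ 1) a t * b (Suc t)"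
  "(fdiff ^^ 2) (\<lambda>t. a t * b t) t = a t * (fdiff ^^ 2) b t + 2 * ((fdiff ^^ 1) a t * (fdiff ^^ 1) b (Suc t))
    + (fdiff ^^ 2) a t * b (t + 2)"
  "(fdiff ^^ 3) (\<lambda>t. a t * b t) t = a t * (fdiff ^^ 3) b t + 3 * ((fdiff ^^ 1) a t * (fdiff ^^ 2) b (Suc t))
    + 3 * ((fdiff ^^ 2) a t * (fdiff ^^ 1) b (t + 2)) + (fdiff ^^ 3) a t * b (t + 3)"
  by (simp_all add: numeral_2_eq_2 numeral_3_eq_3 fdiff_def algebra_simps)

text \<open>The 8 is the sum 1 + 3 + 3 + 1 of the binomial coefficients for \<open>l = 3\<close>.
  The shift \<open>t + i\<close> in the second factor is kept, since the reflected case needs it for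
  an exact cancellation.\<close>

lemma fdiff_pow_mult_le:
  assumes "l \<le> 3" "\<And>i. i \<le> l \<Longrightarrow> norm ((fdiff ^^ i) a t) * norm ((fdiff ^^ (l - i)) b (t + i)) \<le> B"
  shows "norm ((fdiff ^^ l) (\<lambda>t. a t * b t) t) \<le> 8 * B"
proof -
  have B: "0 \<le> B" using assms(2)[of 0] by (meson le0 mult_nonneg_nonneg norm_ge_zero order_trans)
  consider "l = 0" | "l = 1" | "l = 2" | "l = 3" using nat_le_3_cases[OF assms(1)] by blast
  then show ?thesis
  proof cases
    case 1
    then show ?thesis using assms(2)[of 0] B by (simp add: norm_mult)
  next
    case 2
    have "norm ((fdiff ^^ 1) (\<lambda>t. a t * b t) t) \<le> norm (a t * (fdiff ^^ 1) b t) + norm ((fdiff ^^ 1) a t * b (Suc t))"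
      unfolding fdiff_pow_mult by (rule norm_triangle_ineq)
    also have "\<dots> \<le> B + B"
      using assms(2)[of 0] assms(2)[of 1] 2 by (intro add_mono) (simp_all add: norm_mult)
    finally show ?thesis using 2 B by simp
  next
    case 3
    have "norm ((fdiff ^^ 2) (\<lambda>t. a t * b t) t) \<le> norm (a t * (fdiff ^^ 2) b t)
      + norm (2 * ((fdiff ^^ 1) a t * (fdiff ^^ 1) b (Suc t))) + norm ((fdiff ^^ 2) a t * b (t + 2))"
      unfolding fdiff_pow_mult by (intro norm_triangle_le add_right_mono norm_triangle_ineq)
    also have "\<dots> \<le> B + 2 * B + B"
      using assms(2)[of 0] assms(2)[of 1] assms(2)[of 2] 3
      by (intro add_mono) (simp_all add: norm_mult)
    finally show ?thesis using 3 B by simp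
  next
    case 4
    have "norm ((fdiff ^^ 3) (\<lambda>t. a t * b t) t) \<le> norm (a t * (fdiff ^^ 3) b t)
      + norm (3 * ((fdiff ^^ 1) a t * (fdiff ^^ 2) b (Suc t)))
      + norm (3 * ((fdiff ^^ 2) a t * (fdiff ^^ 1) b (t + 2))) + norm ((fdiff ^^ 3) a t * b (t + 3))"
      unfolding fdiff_pow_mult by (intro norm_triangle_le add_right_mono norm_triangle_ineq)
    also have "\<dots> \<le> B + 3 * B + 3 * B + B"
      using assms(2)[of 0] assms(2)[of 1] assms(2)[of 2] assms(2)[of 3] 4
      by (intro add_mono) (simp_all add: norm_mult)
    finally show ?thesis using 4 B by simp
  qed
qed

lemma marcinkiewicz_seq_mult:
  assumes a: "marcinkiewicz_seq A a" and b: "marcinkiewicz_seq B b"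
  shows "marcinkiewicz_seq (8 * (A * B)) (\<lambda>t. a t * b t)"
  unfolding marcinkiewicz_seq_def
proof (intro conjI allI impI)
  note A = marcinkiewicz_seq_nonneg[OF a] and B = marcinkiewicz_seq_nonneg[OF b]
  fix t
  have "norm (a t * b t) \<le> A * B"
    using marcinkiewicz_seqD(1)[OF a, of t] marcinkiewicz_seqD(1)[OF b, of t] A
    by (simp add: norm_mult mult_mono)
  moreover have "0 \<le> A * B" using A B by simp
  ultimately show "norm (a t * b t) \<le> 8 * (A * B)" by linarith
next
  note A = marcinkiewicz_seq_nonneg[OF a] and B = marcinkiewicz_seq_nonneg[OF b]
  fix l t :: nat assume l: "l \<le> 3" and t: "1 \<le> t"
  have "norm ((fdiff ^^ l) (\<lambda>t. a t * b t) t) \<le> 8 * (A * B / real t ^ l)"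
  proof (rule fdiff_pow_mult_le[OF l])
    fix i assume i: "i \<le> l"
    have "norm ((fdiff ^^ (l - i)) b (t + i)) \<le> B / real (t + i) ^ (l - i)"
      using i l t by (intro marcinkiewicz_seqD(2)[OF b]) auto
    also have "\<dots> \<le> B / real t ^ (l - i)"
      using B t by (intro divide_left_mono power_mono mult_pos_pos zero_less_power) auto
    finally have "norm ((fdiff ^^ i) a t) * norm ((fdiff ^^ (l - i)) b (t + i)) \<le>
        (A / real t ^ i) * (B / real t ^ (l - i))"
      using i l t A by (intro mult_mono marcinkiewicz_seqD(2)[OF a]) auto
    also have "\<dots> = A * B / real t ^ l"
      using i by (simp add: power_add[symmetric])
    finally show "norm ((fdiff ^^ i) a t) * norm ((fdiff ^^ (l - i)) b (t + i)) \<le> A * B / real t ^ l" .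
  qed
  then show "norm ((fdiff ^^ l) (\<lambda>t. a t * b t) t) \<le> 8 * (A * B) / real t ^ l" by simp
qed

lemma marcinkiewicz_seq_cnj: "marcinkiewicz_seq A a \<Longrightarrow> marcinkiewicz_seq A (\<lambda>t. cnj (a t))"
  by (simp add: marcinkiewicz_seq_def fdiff_pow_cnj)

section \<open>The smooth cutoff\<close>

lemma power_backward_differences:
  fixes r k :: nat
  assumes "k \<in> {3, 4, 5}"
  defines "p \<equiv> \<lambda>i. real (r - i) ^ k"
  shows "\<bar>p 0\<bar> \<le> 60 * real r ^ k"
    "\<bar>p 1 - p 0\<bar> \<le> 60 * real r ^ (k - 1)"
    "\<bar>p 2 - 2 * p 1 + p 0\<bar> \<le> 60 * real r ^ (k - 2)"
    "\<bar>p 3 - 3 * p 2 + 3 * p 1 - p 0\<bar> \<le> 60 * real r ^ (k - 3)"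
proof -
  \<comment> \<open>Truncated subtraction takes effect only for \<open>r < 3\<close>, where the
    claims are numerical. For \<open>r = q + 3\<close> they are polynomial inequalities in
    \<open>q \<ge> 0\<close>. The 60 is 5 * 4 * 3, the coefficient in the third derivative of the
    fifth power.\<close>
  have "r = 0 \<or> r = 1 \<or> r = 2 \<or> (\<exists>q. r = q + 3)" by presburger
  then consider "r = 0" | "r = 1" | "r = 2" | q where "r = q + 3" by blast
  then have *: "\<bar>p 0\<bar> \<le> 60 * real r ^ k \<and> \<bar>p 1 - p 0\<bar> \<le> 60 * real r ^ (k - 1) \<and>
    \<bar>p 2 - 2 * p 1 + p 0\<bar> \<le> 60 * real r ^ (k - 2) \<and>
    \<bar>p 3 - 3 * p 2 + 3 * p 1 - p 0\<bar> \<le> 60 * real r ^ (k - 3)"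
  proof cases
    case 4
    define x where "x = real q"
    have x: "0 \<le> x" "0 \<le> x * x" "0 \<le> x * (x * x)" "0 \<le> x * (x * (x * x))" "0 \<le> x * (x * (x * (x * x)))"
      by (simp_all add: x_def)
    have p: "p 0 = (x + 3) ^ k" "p 1 = (x + 2) ^ k" "p 2 = (x + 1) ^ k" "p 3 = x ^ k" "real r = x + 3"
      using 4 by (simp_all add: p_def x_def add.commute)
    show ?thesis
      using assms(1) unfolding p abs_le_iff
      by (elim insertE emptyE; hypsubst; use x in \<open>simp add: eval_nat_numeral algebra_simps\<close>)
  qed (use assms in \<open>auto simp: p_def\<close>)
  then show "\<bar>p 0\<bar> \<le> 60 * real r ^ k"
    "\<bar>p 1 - p 0\<bar> \<le> 60 * real r ^ (k - 1)"
    "\<bar>p 2 - 2 * p 1 + p 0\<bar> \<le> 60 * real r ^ (k - 2)"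
    "\<bar>p 3 - 3 * p 2 + 3 * p 1 - p 0\<bar> \<le> 60 * real r ^ (k - 3)" by auto
qed

text \<open>The quintic satisfies \<open>smoothstep v + smoothstep (1 - v) = 1\<close> and vanishes to third order at \<open>0\<close>.\<close>

definition smoothstep :: "real \<Rightarrow> real"
  where "smoothstep v = 10 * v ^ 3 - 15 * v ^ 4 + 6 * v ^ 5"

text \<open>The transition from 1 to 0 is spread over all of \<open>0..N\<close>, so that
  differences at scale \<open>N\<close> are small; truncated subtraction makes the value 0 from
  \<open>N\<close> on.\<close>

definition cutoff :: "nat \<Rightarrow> nat \<Rightarrow> complex"
  where "cutoff N t = of_real (smoothstep (real (N - t) / real N))"

lemma cutoff_eq_0: "t \<ge> N \<Longrightarrow> cutoff N t = 0"
  by (simp add: cutoff_def smoothstep_def)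

lemma cutoff_partition: "t \<le> N \<Longrightarrow> 1 \<le> N \<Longrightarrow> cutoff N t + cutoff N (N - t) = 1"
proof -
  assume *: "t \<le> N" "1 \<le> N"
  have alg: "smoothstep (1 - v) + smoothstep v = 1" for v
    unfolding smoothstep_def by (simp add: eval_nat_numeral algebra_simps)
  have "real (N - t) / real N = 1 - real (N - (N - t)) / real N"
    using * by (simp add: field_simps of_nat_diff)
  then show ?thesis
    unfolding cutoff_def of_real_add[symmetric] by (simp add: alg)
qed

lemma fdiff_pow_explicit:
  "(fdiff ^^ 1) a t = a (t + 1) - a t"
  "(fdiff ^^ 2) a t = a (t + 2) - 2 * a (t + 1) + a t"
  "(fdiff ^^ 3) a t = a (t + 3) - 3 * a (t + 2) + 3 * a (t + 1) - a t"
  by (simp_all add: numeral_2_eq_2 numeral_3_eq_3 fdiff_def)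

text \<open>The 1860 is 60 * (10 + 15 + 6). The factor \<open>(N - s) ^ (3 - j)\<close> records how
  much of the zero at \<open>N\<close> is left after \<open>j\<close> differences; surplus powers
  from the exponents 4 and 5 are bounded by powers of \<open>N\<close>.\<close>

lemma cutoff_fdiff_le:
  assumes "j \<le> 3" "1 \<le> N"
  shows "norm ((fdiff ^^ j) (cutoff N) s) \<le> 1860 * real (N - s) ^ (3 - j) / real N ^ 3"
proof -
  define r where "r = N - s"
  define d where "d k = (if j = 0 then real (r - 0) ^ k else if j = 1 then real (r - 1) ^ k - real (r - 0) ^ k
     else if j = 2 then real (r - 2) ^ k - 2 * real (r - 1) ^ k + real (r - 0) ^ k
     else real (r - 3) ^ k - 3 * real (r - 2) ^ k + 3 * real (r - 1) ^ k - real (r - 0) ^ k)" for k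
  have eq: "(fdiff ^^ j) (cutoff N) s
      = of_real (10 * (d 3 / real N ^ 3) - 15 * (d 4 / real N ^ 4) + 6 * (d 5 / real N ^ 5))"
  proof -
    consider "j = 0" | "j = 1" | "j = 2" | "j = 3" using nat_le_3_cases[OF assms(1)] by blast
    then show ?thesis
      unfolding fdiff_pow_explicit d_def
      by cases (simp_all add: fdiff_pow_explicit fdiff_def cutoff_def smoothstep_def r_def power_divide
          add_divide_distrib diff_divide_distrib right_diff_distrib distrib_left del: of_nat_diff)
  qed
  have d: "\<bar>d k / real N ^ k\<bar> \<le> 60 * (real r ^ (3 - j) / real N ^ 3)" if k: "k \<in> {3, 4, 5}" for k
  proof -
    have "\<bar>d k\<bar> \<le> 60 * real r ^ (k - j)"
    proof -
      consider "j = 0" | "j = 1" | "j = 2" | "j = 3" using nat_le_3_cases[OF assms(1)] by blast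
      then show ?thesis
      proof cases
        case 1
        then show ?thesis unfolding d_def using power_backward_differences(1)[OF k, of r] by (simp only: simp_thms if_True diff_zero)
      next
        case 2
        then show ?thesis unfolding d_def using power_backward_differences(2)[OF k, of r] by simp
      next
        case 3
        then show ?thesis unfolding d_def using power_backward_differences(3)[OF k, of r] by simp
      next
        case 4
        then show ?thesis unfolding d_def using power_backward_differences(4)[OF k, of r] by simp
      qed
    qed
    also have "real r ^ (k - j) = real r ^ (3 - j) * real r ^ (k - 3)"
      using k assms(1) by (auto simp: power_add[symmetric])
    also have "60 * \<dots> \<le> 60 * (real r ^ (3 - j) * real N ^ (k - 3))"
      by (intro mult_left_mono power_mono) (auto simp: r_def)
    finally have "\<bar>d k\<bar> / real N ^ k \<le> 60 * (real r ^ (3 - j) * real N ^ (k - 3)) / real N ^ k"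
      by (rule divide_right_mono) simp
    also have "\<dots> = 60 * (real r ^ (3 - j) / real N ^ 3)"
    proof -
      have "real N ^ k = real N ^ (k - 3) * real N ^ 3" using k by (auto simp: power_add[symmetric])
      then show ?thesis using assms(2) by simp
    qed
    finally show ?thesis by simp
  qed
  have "norm ((fdiff ^^ j) (cutoff N) s)
      \<le> 10 * \<bar>d 3 / real N ^ 3\<bar> + 15 * \<bar>d 4 / real N ^ 4\<bar> + 6 * \<bar>d 5 / real N ^ 5\<bar>"
    unfolding eq norm_of_real by linarith
  also have "\<dots> \<le> 1860 * (real r ^ (3 - j) / real N ^ 3)"
    using d[of 3] d[of 4] d[of 5] by simp
  finally show ?thesis by (simp add: r_def)
qed

lemma inverse_power_index_mono:
  fixes s N l :: nat
  assumes "1 \<le> s" "s \<le> N"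
  shows "1 / real N ^ l \<le> 1 / real s ^ l"
  using assms by (intro divide_left_mono power_mono mult_pos_pos zero_less_power) auto

lemma marcinkiewicz_seq_cutoff:
  assumes "1 \<le> N"
  shows "marcinkiewicz_seq 1860 (cutoff N)"
  unfolding marcinkiewicz_seq_def
proof (intro conjI allI impI)
  fix t
  have "real (N - t) ^ 3 \<le> real N ^ 3" by (intro power_mono) auto
  then have "1860 * real (N - t) ^ 3 / real N ^ 3 \<le> 1860" using assms by (simp add: field_simps)
  then show "norm (cutoff N t) \<le> 1860" using cutoff_fdiff_le[of 0 N t] assms by simp
next
  fix l t :: nat assume l: "l \<le> 3" and t: "1 \<le> t"
  show "norm ((fdiff ^^ l) (cutoff N) t) \<le> 1860 / real t ^ l"
  proof (cases "t \<le> N")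
    case True
    have "norm ((fdiff ^^ l) (cutoff N) t) \<le> 1860 * real (N - t) ^ (3 - l) / real N ^ 3"
      by (rule cutoff_fdiff_le[OF l assms])
    also have "\<dots> \<le> 1860 * real N ^ (3 - l) / real N ^ 3"
      by (intro divide_right_mono mult_left_mono power_mono) auto
    also have "real N ^ 3 = real N ^ (3 - l) * real N ^ l" using l by (simp add: power_add[symmetric])
    also have "1860 * real N ^ (3 - l) / \<dots> = 1860 * (1 / real N ^ l)" using assms by simp
    also have "\<dots> \<le> 1860 * (1 / real t ^ l)"
      by (intro mult_left_mono inverse_power_index_mono t True) simp
    finally show ?thesis by simp
  next
    case False
    have "norm ((fdiff ^^ l) (cutoff N) t) \<le> 2 ^ l * 0"
      by (rule fdiff_pow_bound[where s = N]) (use False in \<open>auto simp: cutoff_eq_0\<close>)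
    then show ?thesis by simp
  qed
qed

text \<open>With \<open>r = N - s - i\<close>, the \<open>i\<close>-th difference of the reflected
  sequence may be as large as \<open>A / r^i\<close>, but the \<open>(l - i)\<close>-th difference
  of the cutoff at \<open>s + i\<close> carries \<open>r^(3 - l + i)\<close>. The powers
  \<open>r^i\<close> cancel and a bound of order \<open>1 / N^l\<close> remains, which is at most
  \<open>1 / s^l\<close>.\<close>

lemma marcinkiewicz_seq_reversed_cutoff:
  assumes a: "marcinkiewicz_seq A a" and N: "1 \<le> N"
  shows "marcinkiewicz_seq (216 * (1860 * A)) (\<lambda>s. a (N - s) * cutoff N s)"
  unfolding marcinkiewicz_seq_def
proof (intro conjI allI impI)
  note A = marcinkiewicz_seq_nonneg[OF a]
  fix t
  have "norm (a (N - t) * cutoff N t) \<le> A * 1860"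
    using marcinkiewicz_seqD(1)[OF a, of "N - t"] A marcinkiewicz_seqD(1)[OF marcinkiewicz_seq_cutoff[OF N], of t]
    unfolding norm_mult by (intro mult_mono) auto
  then show "norm (a (N - t) * cutoff N t) \<le> 216 * (1860 * A)" using A by simp
next
  note A = marcinkiewicz_seq_nonneg[OF a]
  fix l s :: nat assume l: "l \<le> 3" and s: "1 \<le> s"
  let ?n = "\<lambda>s. a (N - s) * cutoff N s"
  have N3: "real N ^ 3 = real N ^ (3 - l) * real N ^ l" using l by (simp add: power_add[symmetric])
  show "norm ((fdiff ^^ l) ?n s) \<le> 216 * (1860 * A) / real s ^ l"
  \<comment> \<open>In this case the difference window of \<open>a\<close> stays at indices of at
    least 1, where its bounds apply.\<close>
  proof (cases "s + 3 < N")
    case True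
    have "norm ((fdiff ^^ l) ?n s) \<le> 8 * (1860 * A / real N ^ l)"
    proof (rule fdiff_pow_mult_le[OF l])
      fix i assume i: "i \<le> l"
      define r where "r = N - s - i"
      have r: "1 \<le> r" "r \<le> N" using True i l by (auto simp: r_def)
      have "norm ((fdiff ^^ i) (\<lambda>s. a (N - s)) s) = norm ((fdiff ^^ i) a r)"
        unfolding r_def using True i l by (intro fdiff_pow_reverse) auto
      also have "\<dots> \<le> A / real r ^ i" using i l r by (intro marcinkiewicz_seqD(2)[OF a]) auto
      finally have 1: "norm ((fdiff ^^ i) (\<lambda>s. a (N - s)) s) \<le> A / real r ^ i" .
      have 2: "norm ((fdiff ^^ (l - i)) (cutoff N) (s + i)) \<le> 1860 * real r ^ (3 - (l - i)) / real N ^ 3"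
        using cutoff_fdiff_le[of "l - i" N "s + i"] l N by (simp add: r_def)
      have "norm ((fdiff ^^ i) (\<lambda>s. a (N - s)) s) * norm ((fdiff ^^ (l - i)) (cutoff N) (s + i))
         \<le> (A / real r ^ i) * (1860 * real r ^ (3 - (l - i)) / real N ^ 3)"
        using A by (intro mult_mono 1 2) auto
      also have "real r ^ (3 - (l - i)) = real r ^ i * real r ^ (3 - l)"
        using i l by (simp add: power_add[symmetric] add.commute)
      also have "(A / real r ^ i) * (1860 * (real r ^ i * real r ^ (3 - l)) / real N ^ 3)
          = 1860 * A * real r ^ (3 - l) / real N ^ 3" using r by simp
      also have "\<dots> \<le> 1860 * A * real N ^ (3 - l) / real N ^ 3"
        using A r by (intro divide_right_mono mult_left_mono power_mono) auto
      also have "\<dots> = 1860 * A / real N ^ l" unfolding N3 using N by simp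
      finally show "norm ((fdiff ^^ i) (\<lambda>s. a (N - s)) s) * norm ((fdiff ^^ (l - i)) (cutoff N) (s + i))
         \<le> 1860 * A / real N ^ l" .
    qed
    also have "\<dots> = 8 * (1860 * A) * (1 / real N ^ l)" by simp
    also have "\<dots> \<le> 8 * (1860 * A) * (1 / real s ^ l)"
      using A s True by (intro mult_left_mono inverse_power_index_mono) auto
    also have "\<dots> \<le> 216 * (1860 * A) * (1 / real s ^ l)"
      using A by (intro mult_right_mono) auto
    finally show ?thesis by simp
  next
    case False
    \<comment> \<open>Within three steps of \<open>N\<close>, or past it, the size of the cutoff
      alone suffices: \<open>(N - s)^3 \<le> 27\<close>, and up to three differences cost a factor
      8, so that 216 is 8 * 27.\<close>
    define B where "B = A * (1860 * real (N - s) ^ 3 / real N ^ 3)"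
    have "norm (?n t) \<le> B" if "t \<ge> s" for t
    proof -
      have "norm (cutoff N t) \<le> 1860 * real (N - t) ^ 3 / real N ^ 3"
        using cutoff_fdiff_le[of 0 N t] N by simp
      also have "\<dots> \<le> 1860 * real (N - s) ^ 3 / real N ^ 3"
        using that by (intro divide_right_mono mult_left_mono power_mono) auto
      finally show ?thesis
        unfolding B_def norm_mult using A marcinkiewicz_seqD(1)[OF a] by (intro mult_mono) auto
    qed
    then have "norm ((fdiff ^^ l) ?n s) \<le> 2 ^ l * B" by (rule fdiff_pow_bound) auto
    also have "\<dots> \<le> 2 ^ 3 * B"
      using l A by (intro mult_right_mono power_increasing) (auto simp: B_def)
    also have "\<dots> \<le> 216 * (1860 * A) / real s ^ l"
    proof (cases "s < N")
      case True
      have "real (N - s) ^ 3 \<le> 3 ^ 3" using False by (intro power_mono) auto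
      then have "2 ^ 3 * B \<le> 2 ^ 3 * (A * (1860 * 3 ^ 3 / real N ^ 3))"
        unfolding B_def using A by (intro mult_left_mono divide_right_mono) auto
      also have "\<dots> = 216 * (1860 * A) * (1 / real N ^ 3)" by simp
      also have "\<dots> \<le> 216 * (1860 * A) * (1 / real N ^ l)"
        using A N l by (intro mult_left_mono divide_left_mono power_increasing mult_pos_pos zero_less_power) auto
      also have "\<dots> \<le> 216 * (1860 * A) * (1 / real s ^ l)"
        using A s True by (intro mult_left_mono inverse_power_index_mono) auto
      finally show ?thesis by simp
    next
      case False
      then show ?thesis using A by (simp add: B_def)
    qed
    finally show ?thesis .
  qed
qed

section \<open>Weak-type bounds for truncated sums\<close>

lemma distribution_fun_le_1: "distribution_fun f a \<le> 1"
  unfolding distribution_fun_def using torus.bounded_measure[of "{x \<in> space torus. a < norm (f x)}"] by simp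

lemma distribution_fun_nonneg: "0 \<le> distribution_fun f a"
  by (simp add: distribution_fun_def)

lemma distribution_fun_add_le:
  assumes [measurable]: "f \<in> borel_measurable torus" "g \<in> borel_measurable torus"
    and "\<And>x. x \<in> {0..<1} \<Longrightarrow> norm (h x) \<le> norm (f x) + norm (g x)"
  shows "distribution_fun h (a + b) \<le> distribution_fun f a + distribution_fun g b"
proof -
  let ?F = "{x \<in> space torus. a < norm (f x)}" and ?G = "{x \<in> space torus. b < norm (g x)}"
  have F: "?F \<in> sets torus" and G: "?G \<in> sets torus" by measurable
  have "distribution_fun h (a + b) \<le> measure torus (?F \<union> ?G)"
    unfolding distribution_fun_def
  proof (rule torus.finite_measure_mono)
    show "{x \<in> space torus. a + b < norm (h x)} \<subseteq> ?F \<union> ?G"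
    proof
      fix x assume "x \<in> {x \<in> space torus. a + b < norm (h x)}"
      then show "x \<in> ?F \<union> ?G" using assms(3)[of x] by auto
    qed
  qed (use F G in auto)
  also have "\<dots> \<le> distribution_fun f a + distribution_fun g b"
    unfolding distribution_fun_def by (rule measure_Un_le[OF F G])
  finally show ?thesis .
qed

lemma distribution_fun_cong:
  assumes "\<And>x. x \<in> {0..<1} \<Longrightarrow> norm (f x) = norm (g x)"
  shows "distribution_fun f a = distribution_fun g a"
  unfolding distribution_fun_def using assms by (intro arg_cong[where f = "measure torus"]) auto

text \<open>The weak norm is only a quasinorm: halving the level for each summand costs the factor
  2.\<close>

lemma weak_type_add:
  assumes "f \<in> borel_measurable torus" "g \<in> borel_measurable torus"
    and "\<And>x. x \<in> {0..<1} \<Longrightarrow> norm (h x) \<le> norm (f x) + norm (g x)"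
    and "\<And>a. 0 < a \<Longrightarrow> a * distribution_fun f a \<le> B" "\<And>a. 0 < a \<Longrightarrow> a * distribution_fun g a \<le> C" "0 < a"
  shows "a * distribution_fun h a \<le> 2 * (B + C)"
proof -
  have "distribution_fun h (a / 2 + a / 2) \<le> distribution_fun f (a / 2) + distribution_fun g (a / 2)"
    by (rule distribution_fun_add_le) (use assms in auto)
  then have "a * distribution_fun h a \<le> a * (distribution_fun f (a / 2) + distribution_fun g (a / 2))"
    using assms(6) by (intro mult_left_mono) auto
  then show ?thesis using assms(4)[of "a / 2"] assms(5)[of "a / 2"] assms(6) by (simp add: algebra_simps)
qed

definition weak_const :: "real \<Rightarrow> real"
  where "weak_const A = 18 * A\<^sup>2 + 13 + 4608 * pi\<^sup>2 * A"

lemma weak_const_nonneg: "0 \<le> A \<Longrightarrow> 0 \<le> weak_const A"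
  by (simp add: weak_const_def)

lemma one_sided_weak_type':
  assumes a: "marcinkiewicz_seq A a" and M: "\<And>t. t > N \<Longrightarrow> a t = 0"
    and f: "integrable torus f" and "0 < s"
  shows "s * distribution_fun (fourier_sum (int ` {..N}) (\<lambda>t. a (nat t)) f) s \<le>
    weak_const A * (LINT x|torus. norm (f x))"
  using one_sided_weak_type[OF a, of "Suc N" f s] assms
  unfolding conv_one_sided_kernel_eq[OF f] lessThan_Suc_atMost weak_const_def by auto

lemma fourier_sum_nat: "fourier_sum (int ` S) c f x = (\<Sum>t\<in>S. c (int t) * fourier_coeff f (int t) * character (int t) x)"
  unfolding fourier_sum_def by (simp add: sum.reindex)

text \<open>The sharp cutoff at \<open>N\<close> is a smooth cutoff plus the modulation by \<open>N\<close> of a reflected smooth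
  cutoff, so both pieces have Calderon-Zygmund kernels with constants independent of \<open>N\<close>.\<close>

lemma truncated_weak_type:
  assumes a: "marcinkiewicz_seq A a" and f: "integrable torus f" and s: "0 < s"
  shows "s * distribution_fun (fourier_sum (int ` {..N}) (\<lambda>t. a (nat t)) f) s \<le>
    2 * (weak_const (14880 * A) + weak_const (401760 * A)) * (LINT x|torus. norm (f x))"
    (is "_ \<le> ?C * ?I")
proof (cases "1 \<le> N")
  case False
  have A: "0 \<le> A" by (rule marcinkiewicz_seq_nonneg[OF a])
  \<comment> \<open>For \<open>N = 0\<close> a single frequency remains. The sequence may be cut to
    it at once, since index 0 is free of difference conditions.\<close>
  define b where "b t = (if t = 0 then a 0 else 0)" for t :: nat
  have b: "marcinkiewicz_seq A b"
    unfolding marcinkiewicz_seq_def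
  proof (intro conjI allI impI)
    show "norm (b t) \<le> A" for t using marcinkiewicz_seqD(1)[OF a, of 0] A by (simp add: b_def)
    fix l t :: nat assume "1 \<le> t"
    then have "norm ((fdiff ^^ l) b t) \<le> 2 ^ l * 0"
      by (intro fdiff_pow_bound[where s = 1]) (auto simp: b_def)
    then show "norm ((fdiff ^^ l) b t) \<le> A / real t ^ l" using A by simp
  qed
  have "fourier_sum (int ` {..N}) (\<lambda>t. a (nat t)) f = fourier_sum (int ` {..N}) (\<lambda>t. b (nat t)) f"
    using False by (auto simp: fun_eq_iff fourier_sum_def b_def not_le less_one)
  then have "s * distribution_fun (fourier_sum (int ` {..N}) (\<lambda>t. a (nat t)) f) s \<le> weak_const A * ?I"
    using one_sided_weak_type'[OF b _ f s, of N] False by (simp add: b_def)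
  also have "\<dots> \<le> ?C * ?I"
  proof (rule mult_right_mono)
    have "A\<^sup>2 \<le> (14880 * A)\<^sup>2" using A by (intro power_mono) auto
    then have "weak_const A \<le> weak_const (14880 * A)"
      unfolding weak_const_def using A by (intro add_mono mult_left_mono) auto
    moreover have "0 \<le> weak_const (401760 * A)" "0 \<le> weak_const (14880 * A)" using A by (intro weak_const_nonneg; simp)+
    moreover have "p \<le> 2 * (q + r)" if "p \<le> q" "0 \<le> r" "0 \<le> q" for p q r :: real using that by simp
    ultimately show "weak_const A \<le> ?C" by blast
  qed simp
  finally show ?thesis .
next
  case True
  \<comment> \<open>The constants below are 14880 = 8 * 1860 and 401760 = 216 * 1860. Reflecting
    frequencies \<open>t\<close> to \<open>N - t\<close> is conjugation followed by a modulation, so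
    the reflected sum for \<open>f\<close> is, up to conjugation and a unimodular factor, an
    ordinary one-sided sum for \<open>F\<close> with conjugated coefficients.\<close>
  define b where "b t = a t * cutoff N t" for t
  define c where "c t = cnj (a (N - t) * cutoff N t)" for t
  define F where "F y = cnj (character (- int N) y * f y)" for y
  have b: "marcinkiewicz_seq (14880 * A) b"
    using marcinkiewicz_seq_mult[OF a marcinkiewicz_seq_cutoff[OF True]] by (simp add: b_def[abs_def] mult_ac)
  have c: "marcinkiewicz_seq (401760 * A) c"
    using marcinkiewicz_seq_cnj[OF marcinkiewicz_seq_reversed_cutoff[OF a True]]
    by (simp add: c_def[abs_def])
  have intF: "integrable torus F"
    unfolding F_def[abs_def] using integrable_mult_character[OF f, of "- int N"]
    by (subst mult.commute) (rule integrable_cnj)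
  have F1: "(LINT x|torus. norm (F x)) = ?I" by (simp add: F_def norm_mult)
  have coeffF: "fourier_coeff F (int t) = cnj (fourier_coeff f (int N - int t))" for t
    unfolding F_def by (simp only: fourier_coeff_cnj fourier_coeff_character_mult) (simp add: algebra_simps)
  let ?h = "fourier_sum (int ` {..N}) (\<lambda>t. a (nat t)) f"
  let ?h1 = "fourier_sum (int ` {..N}) (\<lambda>t. b (nat t)) f"
  let ?h2 = "fourier_sum (int ` {..N}) (\<lambda>t. c (nat t)) F"
  have rev: "(\<Sum>t\<le>N. a t * cutoff N (N - t) * fourier_coeff f (int t) * character (int t) x)
      = character (int N) x * cnj (?h2 x)" for x
  proof -
    have "(\<Sum>t\<le>N. a t * cutoff N (N - t) * fourier_coeff f (int t) * character (int t) x)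
        = (\<Sum>t\<le>N. a (N - t) * cutoff N (N - (N - t)) * fourier_coeff f (int (N - t)) * character (int (N - t)) x)"
      by (rule sum.nat_diff_reindex[symmetric, of _ "Suc N", simplified lessThan_Suc_atMost, simplified])
    also have "\<dots> = (\<Sum>t\<le>N. character (int N) x * cnj (c t * fourier_coeff F (int t) * character (int t) x))"
    proof (rule sum.cong[OF refl])
      fix t assume "t \<in> {..N}"
      then have t: "t \<le> N" by simp
      then have e: "int (N - t) = int N + (- int t)" by simp
      show "a (N - t) * cutoff N (N - (N - t)) * fourier_coeff f (int (N - t)) * character (int (N - t)) x =
        character (int N) x * cnj (c t * fourier_coeff F (int t) * character (int t) x)"
        unfolding e character_add coeffF using t by (simp add: c_def cnj_character mult_ac)
    qed
    also have "\<dots> = character (int N) x * cnj (?h2 x)"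
      by (simp add: fourier_sum_nat sum_distrib_left)
    finally show ?thesis .
  qed
  have "norm (?h x) \<le> norm (?h1 x) + norm (?h2 x)" for x
  proof -
    have "?h x = (\<Sum>t\<le>N. a t * (cutoff N t + cutoff N (N - t)) * fourier_coeff f (int t) * character (int t) x)"
      unfolding fourier_sum_nat by (intro sum.cong refl) (simp add: cutoff_partition[OF _ True])
    also have "\<dots> = ?h1 x + (\<Sum>t\<le>N. a t * cutoff N (N - t) * fourier_coeff f (int t) * character (int t) x)"
      unfolding fourier_sum_nat by (simp add: b_def sum.distrib[symmetric] algebra_simps)
    also note rev
    finally show ?thesis
      using norm_triangle_ineq[of "?h1 x" "character (int N) x * cnj (?h2 x)"] by (simp add: norm_mult)
  qed
  then have "s * distribution_fun ?h s \<le> 2 * (weak_const (14880 * A) * ?I + weak_const (401760 * A) * ?I)"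
  proof (intro weak_type_add[OF measurable_fourier_sum measurable_fourier_sum _ _ _ s])
    fix r :: real assume r: "0 < r"
    show "r * distribution_fun ?h1 r \<le> weak_const (14880 * A) * ?I"
      by (rule one_sided_weak_type'[OF b _ f r]) (simp add: b_def cutoff_eq_0)
    show "r * distribution_fun ?h2 r \<le> weak_const (401760 * A) * ?I"
      unfolding F1[symmetric]
      by (rule one_sided_weak_type'[OF c _ intF r]) (simp add: c_def cutoff_eq_0)
  qed auto
  then show ?thesis by (simp add: algebra_simps)
qed

text \<open>Frequency 0 belongs to the nonnegative half, hence the value 0 at index 0 in the
  sequence for the other half.\<close>

lemma partial_sum_weak_type:
  fixes c :: "int \<Rightarrow> complex"
  assumes pos: "marcinkiewicz_seq A (\<lambda>t. c (int t))"
    and neg: "marcinkiewicz_seq A (\<lambda>t. if t = 0 then 0 else cnj (c (- int t)))"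
  obtains C where "0 \<le> C" "\<And>N (f :: real \<Rightarrow> complex) s. integrable torus f \<Longrightarrow> 0 < s \<Longrightarrow>
    s * distribution_fun (fourier_sum {- int N..int N} c f) s \<le> C * (LINT x|torus. norm (f x))"
proof
  let ?C = "2 * (weak_const (14880 * A) + weak_const (401760 * A))"
  have A: "0 \<le> A" by (rule marcinkiewicz_seq_nonneg[OF pos])
  have C: "0 \<le> ?C" using A by (simp add: weak_const_nonneg)
  show "0 \<le> 4 * ?C" using C by simp
  fix N and f :: "real \<Rightarrow> complex" and s :: real assume f: "integrable torus f" and s: "0 < s"
  let ?I = "LINT x|torus. norm (f x)"
  define a where "a t = (if t = 0 then 0 else cnj (c (- int t)))" for t
  let ?h = "fourier_sum {- int N..int N} c f"
  let ?h1 = "fourier_sum (int ` {..N}) (\<lambda>t. c (int (nat t))) f"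
  let ?h2 = "fourier_sum (int ` {..N}) (\<lambda>t. a (nat t)) (\<lambda>x. cnj (f x))"
  have "?h x = ?h1 x + cnj (?h2 x)" for x
  proof -
    let ?g = "\<lambda>t. c t * fourier_coeff f t * character t x"
    have split: "{- int N..int N} = int ` {..N} \<union> (\<lambda>t. - int t) ` {1..N}"
    proof (intro equalityI subsetI)
      fix t assume t: "t \<in> {- int N..int N}"
      show "t \<in> int ` {..N} \<union> (\<lambda>t. - int t) ` {1..N}"
      proof (cases "0 \<le> t")
        case True
        then have "t = int (nat t)" "nat t \<in> {..N}" using t by auto
        then show ?thesis by blast
      next
        case False
        then have "t = - int (nat (- t))" "nat (- t) \<in> {1..N}" using t by auto
        then show ?thesis by blast
      qed
    qed auto
    have "?h x = sum ?g (int ` {..N}) + sum ?g ((\<lambda>t. - int t) ` {1..N})"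
      unfolding fourier_sum_def split by (rule sum.union_disjoint) auto
    also have "sum ?g ((\<lambda>t. - int t) ` {1..N}) = (\<Sum>t\<in>{1..N}. cnj (a t * fourier_coeff (\<lambda>x. cnj (f x)) (int t) * character (int t) x))"
      by (subst sum.reindex) (auto simp: inj_on_def a_def fourier_coeff_cnj cnj_character)
    also have "\<dots> = (\<Sum>t\<in>{..N}. cnj (a t * fourier_coeff (\<lambda>x. cnj (f x)) (int t) * character (int t) x))"
      by (rule sum.mono_neutral_left) (auto simp: a_def)
    finally show ?thesis by (simp add: fourier_sum_nat fourier_sum_def sum.reindex)
  qed
  then have "norm (?h x) \<le> norm (?h1 x) + norm (?h2 x)" for x
    by (metis complex_mod_cnj norm_triangle_ineq)
  then have "s * distribution_fun ?h s \<le> 2 * (?C * ?I + ?C * ?I)"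
  proof (intro weak_type_add[OF measurable_fourier_sum measurable_fourier_sum _ _ _ s])
    fix r :: real assume r: "0 < r"
    show "r * distribution_fun ?h1 r \<le> ?C * ?I"
      by (rule truncated_weak_type[OF pos f r])
    have "integrable torus (\<lambda>x. cnj (f x))" using f by simp
    from truncated_weak_type[OF neg this r, of N]
    show "r * distribution_fun ?h2 r \<le> ?C * ?I" by (simp add: a_def)
  qed auto
  then show "s * distribution_fun ?h s \<le> 4 * ?C * ?I" by (simp add: algebra_simps)
qed

section \<open>Bounds on Lebesgue spaces\<close>

definition rdiff :: "(real \<Rightarrow> complex) \<Rightarrow> real \<Rightarrow> complex"
  where "rdiff g x = g (x + 1) - g x"

lemma fdiff_pow_eq_rdiff_pow: "(fdiff ^^ l) (\<lambda>t. g (real t)) t = (rdiff ^^ l) g (real t)"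
  by (induction l arbitrary: t) (simp_all add: fdiff_def rdiff_def add.commute)

text \<open>Iterated mean value inequality. The family \<open>rdiff (D i)\<close> is again a chain
  of derivatives, and its top member is bounded by the next derivative of the original chain. An
  abstract chain \<open>D\<close> is used so that the reflection of a multiplier fits as
  well.\<close>

lemma norm_rdiff_pow_le:
  assumes "\<And>i x. i < l \<Longrightarrow> 0 < x \<Longrightarrow> (D i has_vector_derivative D (Suc i) x) (at x)"
    and "\<And>x. x0 \<le> x \<Longrightarrow> norm (D l x) \<le> B" and "0 < x0" "x0 \<le> x"
  shows "norm ((rdiff ^^ l) (D 0) x) \<le> B"
  using assms
proof (induction l arbitrary: D x)
  case 0
  then show ?case by simp
next
  case (Suc l)
  have "norm ((rdiff ^^ l) ((\<lambda>i. rdiff (D i)) 0) x) \<le> B"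
  proof (rule Suc.IH[where D = "\<lambda>i. rdiff (D i)"])
    fix i and y :: real assume "i < l" "0 < y"
    have 1: "(D i has_vector_derivative D (Suc i) y) (at y)"
      and 2: "(D i has_vector_derivative D (Suc i) (y + 1)) (at (y + 1))"
      using \<open>i < l\<close> \<open>0 < y\<close> by (auto intro!: Suc.prems(1))
    have "((\<lambda>x. x + 1) has_vector_derivative 1) (at y)"
      by (auto intro!: derivative_eq_intros simp: has_real_derivative_iff_has_vector_derivative[symmetric])
    from vector_diff_chain_at[OF this 2]
    have "((\<lambda>x. D i (x + 1)) has_vector_derivative D (Suc i) (y + 1)) (at y)" by (simp add: o_def)
    from has_vector_derivative_diff[OF this 1]
    show "(rdiff (D i) has_vector_derivative rdiff (D (Suc i)) y) (at y)"
      by (simp add: rdiff_def[abs_def])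
  next
    fix y assume y: "x0 \<le> y"
    have "norm (D l (y + 1) - D l y) \<le> B * norm ((y + 1) - y)"
    proof (rule differentiable_bound[where S = "{y..y + 1}" and f' = "\<lambda>v h. h *\<^sub>R D (Suc l) v"])
      fix v assume v: "v \<in> {y..y + 1}"
      then have "0 < v" using y Suc.prems(3) unfolding atLeastAtMost_iff by linarith
      then have "(D l has_vector_derivative D (Suc l) v) (at v within {y..y + 1})"
        using Suc.prems(1)[of l v] has_vector_derivative_at_within by blast
      then show "(D l has_derivative (\<lambda>h. h *\<^sub>R D (Suc l) v)) (at v within {y..y + 1})"
        by (simp add: has_vector_derivative_def)
      have "x0 \<le> v" using v y unfolding atLeastAtMost_iff by linarith
      then have "norm (D (Suc l) v) \<le> B" by (rule Suc.prems(2))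
      then show "onorm (\<lambda>h. h *\<^sub>R D (Suc l) v) \<le> B"
        by (intro onorm_le) (simp add: mult_right_mono mult.commute[of _ "norm (D (Suc l) v)"])
    qed auto
    then show "norm (rdiff (D l) y) \<le> B" by (simp add: rdiff_def)
  qed (rule Suc.prems)+
  then show ?case by (simp add: funpow_swap1)
qed

lemma nth_derivative_has_vector_derivative:
  assumes "smooth_away_from_0 m" "t \<noteq> 0"
  shows "(nth_derivative l m has_vector_derivative nth_derivative (Suc l) m t) (at t)"
  using assms by (simp add: smooth_away_from_0_def nth_derivative_def vector_derivative_works[symmetric])

lemma marcinkiewicz_multiplier_seq:
  assumes "marcinkiewicz_multiplier m"
  obtains A where "marcinkiewicz_seq A (\<lambda>t. m (of_int (int t)))"
    "marcinkiewicz_seq A (\<lambda>t. if t = 0 then 0 else cnj (m (of_int (- int t))))"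
    "\<And>t. norm (m t) \<le> A"
proof -
  from assms obtain C where smooth: "smooth_away_from_0 m" and bdd: "bounded (range m)"
    and C: "\<And>l t. l \<le> 4 \<Longrightarrow> t \<noteq> 0 \<Longrightarrow> norm (nth_derivative l m t) \<le> C / \<bar>t\<bar> ^ l"
    unfolding marcinkiewicz_multiplier_def by blast
  from bdd obtain B where B: "\<And>t. norm (m t) \<le> B" by (auto simp: bounded_iff)
  \<comment> \<open>The derivative bounds say nothing at 0, where only boundedness of the multiplier
    is available; one constant serves both.\<close>
  define A where "A = max B C"
  have A: "norm (m t) \<le> A" for t using B[of t] by (simp add: A_def)
  have A0: "0 \<le> A" using A[of 0] norm_ge_zero order_trans by blast
  have D: "norm (nth_derivative l m x) \<le> A / real t ^ l" if "l \<le> 3" "1 \<le> t" "real t \<le> \<bar>x\<bar>" for l t x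
  proof -
    have "norm (nth_derivative l m x) \<le> C / \<bar>x\<bar> ^ l" using that by (intro C) auto
    also have "\<dots> \<le> A / \<bar>x\<bar> ^ l" by (intro divide_right_mono) (auto simp: A_def)
    also have "\<dots> \<le> A / real t ^ l"
      using that A0 by (intro divide_left_mono power_mono mult_pos_pos zero_less_power) auto
    finally show ?thesis .
  qed
  have pos: "norm ((fdiff ^^ l) (\<lambda>t. m (real t)) t) \<le> A / real t ^ l" if "l \<le> 3" "1 \<le> t" for l t
  proof -
    have "norm ((rdiff ^^ l) (nth_derivative 0 m) (real t)) \<le> A / real t ^ l"
      by (rule norm_rdiff_pow_le[where x0 = "real t"])
         (use that D in \<open>auto intro!: nth_derivative_has_vector_derivative[OF smooth]\<close>)
    then show ?thesis unfolding fdiff_pow_eq_rdiff_pow by (simp add: nth_derivative_def)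
  qed
  have neg: "norm ((fdiff ^^ l) (\<lambda>t. m (- real t)) t) \<le> A / real t ^ l" if "l \<le> 3" "1 \<le> t" for l t
  proof -
    \<comment> \<open>The successive derivatives of \<open>m (- x)\<close>, with the signs from the
      chain rule.\<close>
    define E where "E i x = (-1) ^ i * nth_derivative i m (- x)" for i x
    have "norm ((rdiff ^^ l) (E 0) (real t)) \<le> A / real t ^ l"
    proof (rule norm_rdiff_pow_le[where x0 = "real t"])
      fix i and x :: real assume "0 < x"
      have 1: "(nth_derivative i m has_vector_derivative nth_derivative (Suc i) m (- x)) (at (- x))"
        using \<open>0 < x\<close> by (intro nth_derivative_has_vector_derivative[OF smooth]) auto
      have "((\<lambda>x. - x) has_vector_derivative -1) (at x)"
        by (auto intro!: derivative_eq_intros)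
      from vector_diff_chain_at[OF this 1]
      have "((\<lambda>x. nth_derivative i m (- x)) has_vector_derivative - nth_derivative (Suc i) m (- x)) (at x)"
        by (simp add: o_def)
      from has_vector_derivative_mult_right[OF this, of "(-1) ^ i"]
      show "(E i has_vector_derivative E (Suc i) x) (at x)"
        by (simp add: E_def[abs_def])
    next
      show "norm (E l x) \<le> A / real t ^ l" if "real t \<le> x" for x
        unfolding E_def using D[of l t "- x"] that \<open>l \<le> 3\<close> \<open>1 \<le> t\<close> by (simp add: norm_mult norm_power)
    qed (use that in auto)
    moreover have "E 0 = (\<lambda>x. m (- x))" by (simp add: E_def nth_derivative_def fun_eq_iff)
    ultimately show ?thesis
      using fdiff_pow_eq_rdiff_pow[of l "\<lambda>x. m (- x)" t] by simp
  qed
  show thesis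
  proof
    show "marcinkiewicz_seq A (\<lambda>t. m (of_int (int t)))"
      unfolding marcinkiewicz_seq_def using A pos by simp
    show "marcinkiewicz_seq A (\<lambda>t. if t = 0 then 0 else cnj (m (of_int (- int t))))"
      unfolding marcinkiewicz_seq_def
    proof (intro conjI allI impI)
      show "norm (if t = 0 then 0 else cnj (m (of_int (- int t)))) \<le> A" for t :: nat
        using A A0 by simp
      fix l t :: nat assume lt: "l \<le> 3" "1 \<le> t"
      have "(fdiff ^^ l) (\<lambda>t. if t = 0 then 0 else cnj (m (of_int (- int t)))) t
          = (fdiff ^^ l) (\<lambda>t. cnj (m (- real t))) t"
        by (rule fdiff_pow_cong[where s = 1]) (use lt in auto)
      then show "norm ((fdiff ^^ l) (\<lambda>t. if t = 0 then 0 else cnj (m (of_int (- int t)))) t) \<le> A / real t ^ l"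
        using neg[OF lt] by (simp add: fdiff_pow_cnj)
    qed
  qed (rule A)
qed

section \<open>Interpolation between the weak bound and the square-integrable bound\<close>

lemma distribution_fun_chebyshev:
  assumes "integrable torus (\<lambda>x. (norm (h x))\<^sup>2)" "0 < a" and [measurable]: "h \<in> borel_measurable torus"
  shows "distribution_fun h a \<le> (LINT x|torus. (norm (h x))\<^sup>2) / a\<^sup>2"
proof -
  have "distribution_fun h a \<le> measure torus {x \<in> space torus. a\<^sup>2 \<le> (norm (h x))\<^sup>2}"
    unfolding distribution_fun_def
  proof (rule torus.finite_measure_mono)
    show "{x \<in> space torus. a < norm (h x)} \<subseteq> {x \<in> space torus. a\<^sup>2 \<le> (norm (h x))\<^sup>2}"
      using assms(2) by (auto intro!: power_mono)
    show "{x \<in> space torus. a\<^sup>2 \<le> (norm (h x))\<^sup>2} \<in> sets torus" by measurable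
  qed
  also have "\<dots> \<le> (LINT x|torus. (norm (h x))\<^sup>2) / a\<^sup>2"
    by (rule integral_Markov_inequality_measure[where A = "{}"]) (use assms in auto)
  finally show ?thesis .
qed

text \<open>The function is split at the height \<open>s\<close> of the level set itself: the weak
  bound serves the large part, Chebyshev and the \<open>L^2\<close> bound the small part, each at
  level \<open>s / 2\<close>. The result is the integral of an explicit integrand so that
  integration over \<open>s\<close> can be exchanged with it.\<close>

lemma level_set_bound:
  assumes S: "finite S" and c: "\<And>t. t \<in> S \<Longrightarrow> norm (c t) \<le> A"
    and weak: "\<And>g s. integrable torus g \<Longrightarrow> 0 < s \<Longrightarrow>
      s * distribution_fun (fourier_sum S c g) s \<le> C * (LINT x|torus. norm (g x))"
    and f: "integrable torus f" and s: "0 < s" and C: "0 \<le> C"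
  defines "\<Psi> \<equiv> \<lambda>x. 2 * C / s * (if s < norm (f x) then norm (f x) else 0) +
     4 * A\<^sup>2 / s\<^sup>2 * (if s < norm (f x) then 0 else (norm (f x))\<^sup>2)"
  shows "integrable torus \<Psi>" and "distribution_fun (fourier_sum S c f) s \<le> (LINT x|torus. \<Psi> x)"
proof -
  have [measurable]: "f \<in> borel_measurable torus" using f by simp
  define g where "g x = (if s < norm (f x) then f x else 0)" for x
  define h where "h x = (if s < norm (f x) then 0 else f x)" for x
  have [measurable]: "g \<in> borel_measurable torus" "h \<in> borel_measurable torus"
    unfolding g_def[abs_def] h_def[abs_def] by measurable
  have ng: "norm (g x) = (if s < norm (f x) then norm (f x) else 0)" for x by (simp add: g_def)
  have nh: "(norm (h x))\<^sup>2 = (if s < norm (f x) then 0 else (norm (f x))\<^sup>2)" for x by (simp add: h_def)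
  have g: "integrable torus g"
    by (rule Bochner_Integration.integrable_bound[OF f]) (auto simp: g_def)
  have h: "integrable torus h"
    by (rule Bochner_Integration.integrable_bound[OF f]) (auto simp: h_def)
  have h2: "integrable torus (\<lambda>x. (norm (h x))\<^sup>2)"
  proof (rule integrable_torus_bounded[where B = "s\<^sup>2"])
    show "norm ((norm (h x))\<^sup>2) \<le> s\<^sup>2" for x
      using s by (auto simp: h_def intro!: power_mono)
  qed measurable
  have \<Psi>: "\<Psi> = (\<lambda>x. 2 * C / s * norm (g x) + 4 * A\<^sup>2 / s\<^sup>2 * (norm (h x))\<^sup>2)"
    by (simp add: \<Psi>_def ng nh fun_eq_iff)
  show "integrable torus \<Psi>" unfolding \<Psi> using g h2 by simp
  have "fourier_sum S c f x = fourier_sum S c (\<lambda>x. g x + h x) x" for x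
    by (intro arg_cong2[where f = "fourier_sum S c"] refl) (auto simp: g_def h_def)
  then have split: "fourier_sum S c f x = fourier_sum S c g x + fourier_sum S c h x" for x
    by (simp only: fourier_sum_add[OF g h])
  have "distribution_fun (fourier_sum S c f) (s / 2 + s / 2) \<le>
      distribution_fun (fourier_sum S c g) (s / 2) + distribution_fun (fourier_sum S c h) (s / 2)"
    by (rule distribution_fun_add_le) (auto simp: split norm_triangle_ineq)
  moreover have "distribution_fun (fourier_sum S c g) (s / 2) \<le> 2 * C / s * (LINT x|torus. norm (g x))"
    using weak[OF g, of "s / 2"] s by (simp add: field_simps)
  moreover have "distribution_fun (fourier_sum S c h) (s / 2) \<le> 4 * A\<^sup>2 / s\<^sup>2 * (LINT x|torus. (norm (h x))\<^sup>2)"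
  proof -
    have "distribution_fun (fourier_sum S c h) (s / 2) \<le> (LINT x|torus. (norm (fourier_sum S c h x))\<^sup>2) / (s / 2)\<^sup>2"
      using s by (intro distribution_fun_chebyshev integrable_torus_continuous continuous_intros) auto
    also have "\<dots> \<le> A\<^sup>2 * (LINT x|torus. (norm (h x))\<^sup>2) / (s / 2)\<^sup>2"
      by (intro divide_right_mono fourier_sum_L2_bound S h2 c) auto
    finally show ?thesis by (simp add: power_divide mult_ac)
  qed
  moreover have "(LINT x|torus. \<Psi> x) = 2 * C / s * (LINT x|torus. norm (g x)) + 4 * A\<^sup>2 / s\<^sup>2 * (LINT x|torus. (norm (h x))\<^sup>2)"
    unfolding \<Psi> using g h2 by simp
  ultimately show "distribution_fun (fourier_sum S c f) s \<le> (LINT x|torus. \<Psi> x)" by simp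
qed

lemma nn_integral_powr_from_0:
  assumes "-1 < a" "0 \<le> u"
  shows "(\<integral>\<^sup>+s. ennreal (s powr a) * indicator {0<..<u} s \<partial>lborel) = ennreal (u powr (a + 1) / (a + 1))"
proof -
  have "(\<integral>\<^sup>+s. ennreal (s powr a) * indicator {0<..<u} s \<partial>lborel)
      = (\<integral>\<^sup>+s. ennreal (s powr a) * indicator {0..u} s \<partial>lborel)"
    by (intro nn_integral_cong_AE eventually_mono[OF eventually_conj[OF AE_lborel_singleton[of 0] AE_lborel_singleton[of u]]])
       (auto split: split_indicator)
  also have "\<dots> = ennreal (u powr (a + 1) / (a + 1))"
    by (intro nn_integral_has_integral_lebesgue' has_integral_powr_from_0 assms) auto
  finally show ?thesis .
qed

lemma nn_integral_powr_to_inf: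
  assumes "a < -1" "0 < u"
  shows "(\<integral>\<^sup>+s. ennreal (s powr a) * indicator {u..} s \<partial>lborel) = ennreal (u powr (a + 1) / (- a - 1))"
proof -
  have "(\<integral>\<^sup>+s. ennreal (s powr a) * indicator {u..} s \<partial>lborel) = ennreal (- (u powr (a + 1)) / (a + 1))"
    by (intro nn_integral_has_integral_lebesgue' has_integral_powr_to_inf assms) auto
  also have "- (u powr (a + 1)) / (a + 1) = u powr (a + 1) / (- a - 1)"
    using assms by (simp add: field_simps)
  finally show ?thesis .
qed

text \<open>For a fixed height \<open>u\<close> the large part contributes the integral of
  \<open>s powr (p - 2)\<close> below \<open>u\<close>, which converges because
  \<open>p > 1\<close>, and the small part that of \<open>s powr (p - 3)\<close> above
  \<open>u\<close>, which converges because \<open>p < 2\<close>. Both are multiples of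
  \<open>u powr p\<close> after the factors \<open>u\<close> and \<open>u^2\<close>.\<close>

lemma interpolation_integral:
  fixes u :: real
  assumes p: "1 < p" "p < 2" and u: "0 \<le> u" and C: "0 \<le> C"
  shows "(\<integral>\<^sup>+s. ennreal (p * s powr (p - 1) * (2 * C / s * (if s < u then u else 0) +
     4 * A\<^sup>2 / s\<^sup>2 * (if s < u then 0 else u\<^sup>2))) * indicator {0<..} s \<partial>lborel)
    = ennreal ((2 * C * p / (p - 1) + 4 * A\<^sup>2 * p / (2 - p)) * u powr p)"
proof (cases "u = 0")
  case True
  have "(\<integral>\<^sup>+s. ennreal (p * s powr (p - 1) * (2 * C / s * (if s < u then u else 0) +
     4 * A\<^sup>2 / s\<^sup>2 * (if s < u then 0 else u\<^sup>2))) * indicator {0<..} s \<partial>lborel) = (\<integral>\<^sup>+(s::real). 0 \<partial>lborel)"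
    using True by (intro nn_integral_cong) auto
  then show ?thesis using True by simp
next
  case False
  then have u: "0 < u" using u by simp
  have "(\<integral>\<^sup>+s. ennreal (p * s powr (p - 1) * (2 * C / s * (if s < u then u else 0) +
     4 * A\<^sup>2 / s\<^sup>2 * (if s < u then 0 else u\<^sup>2))) * indicator {0<..} s \<partial>lborel)
     = (\<integral>\<^sup>+s. ennreal (2 * C * p * u) * (ennreal (s powr (p - 2)) * indicator {0<..<u} s) +
          ennreal (4 * A\<^sup>2 * p * u\<^sup>2) * (ennreal (s powr (p - 3)) * indicator {u..} s) \<partial>lborel)"
  proof (rule nn_integral_cong)
    fix s :: real
    have e1: "s powr (p - 1) * (2 * C / s) = 2 * C * s powr (p - 2)"
      and e2: "s powr (p - 1) * (4 * A\<^sup>2 / s\<^sup>2) = 4 * A\<^sup>2 * s powr (p - 3)" if "0 < s"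
    proof -
      have "s powr (p - 2) = s powr (p - 1) / s" "s powr (p - 3) = s powr (p - 1) / s\<^sup>2"
        using that powr_diff[of s "p - 1" 1] powr_diff[of s "p - 1" 2] by (simp_all add: powr_numeral)
      then show "s powr (p - 1) * (2 * C / s) = 2 * C * s powr (p - 2)"
        "s powr (p - 1) * (4 * A\<^sup>2 / s\<^sup>2) = 4 * A\<^sup>2 * s powr (p - 3)"
        by simp_all
    qed
    consider "s \<le> 0" | "0 < s" "s < u" | "0 < s" "u \<le> s" by linarith
    then show "ennreal (p * s powr (p - 1) * (2 * C / s * (if s < u then u else 0) +
     4 * A\<^sup>2 / s\<^sup>2 * (if s < u then 0 else u\<^sup>2))) * indicator {0<..} s
     = ennreal (2 * C * p * u) * (ennreal (s powr (p - 2)) * indicator {0<..<u} s) +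
          ennreal (4 * A\<^sup>2 * p * u\<^sup>2) * (ennreal (s powr (p - 3)) * indicator {u..} s)"
    proof cases
      case 1
      then show ?thesis using u by (simp split: split_indicator)
    next
      case 2
      have "p * s powr (p - 1) * (2 * C / s * u) = p * u * (s powr (p - 1) * (2 * C / s))" by simp
      also have "\<dots> = 2 * C * p * u * s powr (p - 2)" unfolding e1[OF 2(1)] by simp
      finally show ?thesis using 2 C p u by (simp add: ennreal_mult[symmetric])
    next
      case 3
      have "p * s powr (p - 1) * (4 * A\<^sup>2 / s\<^sup>2 * u\<^sup>2) = p * u\<^sup>2 * (s powr (p - 1) * (4 * A\<^sup>2 / s\<^sup>2))" by simp
      also have "\<dots> = 4 * A\<^sup>2 * p * u\<^sup>2 * s powr (p - 3)" unfolding e2[OF 3(1)] by simp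
      finally show ?thesis using 3 p u by (simp add: ennreal_mult[symmetric])
    qed
  qed
  also have "\<dots> = ennreal (2 * C * p * u) * (\<integral>\<^sup>+s. ennreal (s powr (p - 2)) * indicator {0<..<u} s \<partial>lborel) +
      ennreal (4 * A\<^sup>2 * p * u\<^sup>2) * (\<integral>\<^sup>+s. ennreal (s powr (p - 3)) * indicator {u..} s \<partial>lborel)"
    by (subst nn_integral_add) (auto simp: nn_integral_cmult)
  also have "\<dots> = ennreal (2 * C * p * u) * ennreal (u powr (p - 1) / (p - 1)) +
      ennreal (4 * A\<^sup>2 * p * u\<^sup>2) * ennreal (u powr (p - 2) / (2 - p))"
    using nn_integral_powr_from_0[of "p - 2" u] nn_integral_powr_to_inf[of "p - 3" u] p u by simp
  also have "\<dots> = ennreal (2 * C * p * u * (u powr (p - 1) / (p - 1)) + 4 * A\<^sup>2 * p * u\<^sup>2 * (u powr (p - 2) / (2 - p)))"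
    using p u C by (simp add: ennreal_mult[symmetric] ennreal_plus[symmetric] del: ennreal_plus)
  also have "2 * C * p * u * (u powr (p - 1) / (p - 1)) + 4 * A\<^sup>2 * p * u\<^sup>2 * (u powr (p - 2) / (2 - p))
      = (2 * C * p / (p - 1) + 4 * A\<^sup>2 * p / (2 - p)) * u powr p"
  proof -
    have "u * u powr (p - 1) = u powr p" "u\<^sup>2 * u powr (p - 2) = u powr p"
      using u powr_add[of u 1 "p - 1"] powr_add[of u 2 "p - 2"] by (simp_all add: powr_numeral)
    moreover have "2 * C * p * u * (u powr (p - 1) / (p - 1)) + 4 * A\<^sup>2 * p * u\<^sup>2 * (u powr (p - 2) / (2 - p))
      = 2 * C * p / (p - 1) * (u * u powr (p - 1)) + 4 * A\<^sup>2 * p / (2 - p) * (u\<^sup>2 * u powr (p - 2))"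
      by simp
    ultimately show ?thesis by (simp only: distrib_right)
  qed
  finally show ?thesis .
qed

text \<open>The layer cake formula on the left, the level set bound at each height, then Tonelli, so
  that the integral over heights is computed pointwise in \<open>x\<close>.\<close>

lemma marcinkiewicz_interpolation:
  assumes S: "finite S" and c: "\<And>t. t \<in> S \<Longrightarrow> norm (c t) \<le> A"
    and weak: "\<And>g s. integrable torus g \<Longrightarrow> 0 < s \<Longrightarrow>
      s * distribution_fun (fourier_sum S c g) s \<le> C * (LINT x|torus. norm (g x))"
    and C: "0 \<le> C" and p: "1 < p" "p < 2" and f: "integrable torus f"
  shows "(\<integral>\<^sup>+x. ennreal (norm (fourier_sum S c f x) powr p) \<partial>torus) \<le>
    (\<integral>\<^sup>+x. ennreal ((2 * C * p / (p - 1) + 4 * A\<^sup>2 * p / (2 - p)) * norm (f x) powr p) \<partial>torus)"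
proof -
  interpret pair: pair_sigma_finite torus lborel
    by (intro pair_sigma_finite.intro torus.sigma_finite_measure_axioms sigma_finite_lborel)
  have [measurable]: "f \<in> borel_measurable torus" using f by simp
  define h where "h x = norm (fourier_sum S c f x)" for x
  have [measurable]: "h \<in> borel_measurable torus" unfolding h_def by measurable
  define \<Psi> where "\<Psi> s x = 2 * C / s * (if s < norm (f x) then norm (f x) else 0) +
     4 * A\<^sup>2 / s\<^sup>2 * (if s < norm (f x) then 0 else (norm (f x))\<^sup>2)" for s x
  have \<Psi>0: "0 \<le> \<Psi> s x" if "0 < s" for s x using that C by (simp add: \<Psi>_def)
  have "(\<integral>\<^sup>+x. ennreal (h x powr p) \<partial>torus)
      = (\<integral>\<^sup>+x. (\<integral>\<^sup>+s. ennreal (p * s powr (p - 1)) * indicator {0<..<h x} s \<partial>lborel) \<partial>torus)"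
  proof (rule nn_integral_cong)
    fix x
    have "(\<integral>\<^sup>+s. ennreal (p * s powr (p - 1)) * indicator {0<..<h x} s \<partial>lborel)
        = (\<integral>\<^sup>+s. ennreal p * (ennreal (s powr (p - 1)) * indicator {0<..<h x} s) \<partial>lborel)"
      using p by (intro nn_integral_cong) (simp add: ennreal_mult mult.assoc)
    also have "\<dots> = ennreal p * ennreal (h x powr p / p)"
      using nn_integral_powr_from_0[of "p - 1" "h x"] p by (subst nn_integral_cmult) (auto simp: h_def)
    also have "\<dots> = ennreal (h x powr p)" using p by (simp add: ennreal_mult[symmetric])
    finally show "ennreal (h x powr p) = (\<integral>\<^sup>+s. ennreal (p * s powr (p - 1)) * indicator {0<..<h x} s \<partial>lborel)" ..
  qed
  \<comment> \<open>The interval \<open>{0<..<h x}\<close> depends on \<open>x\<close>; the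
    conditional form exposes the joint measurability in \<open>x\<close> and \<open>s\<close> that
    the exchange requires.\<close>
  also have "\<dots> = (\<integral>\<^sup>+x. (\<integral>\<^sup>+s. (if 0 < s \<and> s < h x then ennreal (p * s powr (p - 1)) else 0) \<partial>lborel) \<partial>torus)"
    by (intro nn_integral_cong) (auto split: split_indicator)
  also have "\<dots> = (\<integral>\<^sup>+s. (\<integral>\<^sup>+x. (if 0 < s \<and> s < h x then ennreal (p * s powr (p - 1)) else 0) \<partial>torus) \<partial>lborel)"
    by (rule pair.Fubini'[symmetric]) measurable
  also have "\<dots> \<le> (\<integral>\<^sup>+s. (\<integral>\<^sup>+x. (if 0 < s then ennreal (p * s powr (p - 1) * \<Psi> s x) else 0) \<partial>torus) \<partial>lborel)"
  proof (rule nn_integral_mono)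
    fix s :: real
    show "(\<integral>\<^sup>+x. (if 0 < s \<and> s < h x then ennreal (p * s powr (p - 1)) else 0) \<partial>torus)
      \<le> (\<integral>\<^sup>+x. (if 0 < s then ennreal (p * s powr (p - 1) * \<Psi> s x) else 0) \<partial>torus)"
    proof (cases "0 < s")
      case True
      let ?E = "{x \<in> space torus. s < h x}"
      have E: "?E \<in> sets torus" by measurable
      have w: "0 \<le> p * s powr (p - 1)" using p by simp
      note lev = level_set_bound[OF S c weak f True C, folded \<Psi>_def]
      have "(\<integral>\<^sup>+x. (if 0 < s \<and> s < h x then ennreal (p * s powr (p - 1)) else 0) \<partial>torus)
          = (\<integral>\<^sup>+x. ennreal (p * s powr (p - 1)) * indicator ?E x \<partial>torus)"
        using True by (intro nn_integral_cong) (auto split: split_indicator)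
      also have "\<dots> = ennreal (p * s powr (p - 1)) * emeasure torus ?E"
        by (rule nn_integral_cmult_indicator[OF E])
      also have "\<dots> = ennreal (p * s powr (p - 1)) * ennreal (distribution_fun (fourier_sum S c f) s)"
        by (simp add: torus.emeasure_eq_measure distribution_fun_def h_def)
      also have "\<dots> \<le> ennreal (p * s powr (p - 1)) * ennreal (LINT x|torus. \<Psi> s x)"
        using lev(2) by (intro mult_left_mono ennreal_leI) auto
      also have "ennreal (LINT x|torus. \<Psi> s x) = (\<integral>\<^sup>+x. ennreal (\<Psi> s x) \<partial>torus)"
        using lev(1) \<Psi>0[OF True] by (intro nn_integral_eq_integral[symmetric]) auto
      also have "ennreal (p * s powr (p - 1)) * \<dots> = (\<integral>\<^sup>+x. ennreal (p * s powr (p - 1)) * ennreal (\<Psi> s x) \<partial>torus)"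
        using lev(1) by (intro nn_integral_cmult[symmetric]) auto
      also have "\<dots> = (\<integral>\<^sup>+x. (if 0 < s then ennreal (p * s powr (p - 1) * \<Psi> s x) else 0) \<partial>torus)"
        using True w \<Psi>0[OF True] by (intro nn_integral_cong) (simp add: ennreal_mult)
      finally show ?thesis .
    qed simp
  qed
  also have "\<dots> = (\<integral>\<^sup>+x. (\<integral>\<^sup>+s. (if 0 < s then ennreal (p * s powr (p - 1) * \<Psi> s x) else 0) \<partial>lborel) \<partial>torus)"
    unfolding \<Psi>_def by (rule pair.Fubini') measurable
  also have "\<dots> = (\<integral>\<^sup>+x. (\<integral>\<^sup>+s. ennreal (p * s powr (p - 1) * \<Psi> s x) * indicator {0<..} s \<partial>lborel) \<partial>torus)"
    by (intro nn_integral_cong) (auto split: split_indicator)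
  also have "\<dots> = (\<integral>\<^sup>+x. ennreal ((2 * C * p / (p - 1) + 4 * A\<^sup>2 * p / (2 - p)) * norm (f x) powr p) \<partial>torus)"
    unfolding \<Psi>_def by (intro nn_integral_cong interpolation_integral p C norm_ge_zero)
  finally show ?thesis by (simp add: h_def)
qed

section \<open>Bounds for finite sums by interpolation and duality\<close>

lemma integrable_norm_powr_continuous:
  fixes g :: "real \<Rightarrow> complex"
  assumes "continuous_on UNIV g" "0 \<le> p"
  shows "integrable torus (\<lambda>x. norm (g x) powr p)"
proof -
  have "compact (g ` {0..1})"
    by (intro compact_continuous_image continuous_on_subset[OF assms(1)]) auto
  then obtain B where B: "\<forall>y\<in>g ` {0..1}. norm y \<le> B"
    using compact_imp_bounded bounded_iff by metis
  have [measurable]: "g \<in> borel_measurable torus" by (rule continuous_measurable_torus[OF assms(1)])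
  show ?thesis
  proof (rule integrable_torus_bounded[where B = "B powr p"])
    show "norm (norm (g x) powr p) \<le> B powr p" if "x \<in> {0..<1}" for x
    proof -
      have "norm (g x) \<le> B" using B that by auto
      then show ?thesis using assms(2) by (simp add: powr_mono2)
    qed
  qed measurable
qed

lemma integral_norm_powr_2: "(LINT x|torus. norm (g x) powr 2) = (LINT x|torus. (norm (g x))\<^sup>2)"
  for g :: "real \<Rightarrow> complex"
  by (intro Bochner_Integration.integral_cong refl) (simp add: powr_numeral)

lemma Lp_imp_integrable:
  assumes "f \<in> Lp p" "1 \<le> p"
  shows "integrable torus f"
proof (rule Bochner_Integration.integrable_bound)
  show "integrable torus (\<lambda>x. 1 + norm (f x) powr p)" using assms by (simp add: Lp_def)
  show "f \<in> borel_measurable torus" using assms by (simp add: Lp_def)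
  have "u \<le> 1 + u powr p" if "0 \<le> u" for u :: real
  proof (cases "u \<le> 1")
    case False
    then have "u powr 1 \<le> u powr p" using assms by (intro powr_mono) auto
    then show ?thesis using False by simp
  qed (simp add: add_increasing2)
  then show "AE x in torus. norm (f x) \<le> norm (1 + norm (f x) powr p)"
    by (intro AE_I2) (simp add: abs_of_nonneg add_nonneg_nonneg)
qed

lemma Lp_bound_low:
  assumes S: "finite S" and c: "\<And>t. t \<in> S \<Longrightarrow> norm (c t) \<le> A"
    and weak: "\<And>g s. integrable torus g \<Longrightarrow> 0 < s \<Longrightarrow>
      s * distribution_fun (fourier_sum S c g) s \<le> C * (LINT x|torus. norm (g x))"
    and C: "0 \<le> C" and p: "1 < p" "p < 2" and f: "f \<in> Lp p"
  shows "(LINT x|torus. norm (fourier_sum S c f x) powr p) \<le>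
    (2 * C * p / (p - 1) + 4 * A\<^sup>2 * p / (2 - p)) * (LINT x|torus. norm (f x) powr p)" (is "_ \<le> ?K * _")
proof -
  have int: "integrable torus (\<lambda>x. norm (f x) powr p)" using f by (simp add: Lp_def)
  have K: "0 \<le> ?K" using p C by (intro add_nonneg_nonneg divide_nonneg_nonneg mult_nonneg_nonneg) auto
  have "ennreal (LINT x|torus. norm (fourier_sum S c f x) powr p)
      = (\<integral>\<^sup>+x. ennreal (norm (fourier_sum S c f x) powr p) \<partial>torus)"
    using p by (intro nn_integral_eq_integral[symmetric] integrable_norm_powr_continuous continuous_intros) auto
  also have "\<dots> \<le> (\<integral>\<^sup>+x. ennreal (?K * norm (f x) powr p) \<partial>torus)"
    using p by (intro marcinkiewicz_interpolation S c weak C Lp_imp_integrable[OF f]) auto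
  also have "\<dots> = ennreal (LINT x|torus. ?K * norm (f x) powr p)"
    using int K by (intro nn_integral_eq_integral) auto
  also have "\<dots> = ennreal (?K * (LINT x|torus. norm (f x) powr p))" by simp
  finally show ?thesis
    using K by (subst (asm) ennreal_le_iff) (auto intro!: mult_nonneg_nonneg)
qed

text \<open>Duality, with Young's inequality in place of Hoelder's: the left hand side can be absorbed
  because it is known to be finite.\<close>

lemma Lp_bound_high:
  assumes S: "finite S" and p: "2 < p" and q: "q = p / (p - 1)" and K: "1 \<le> K"
    and dual: "\<And>k. k \<in> Lp q \<Longrightarrow> (LINT x|torus. norm (fourier_sum S (\<lambda>t. cnj (c t)) k x) powr q) \<le>
      K * (LINT x|torus. norm (k x) powr q)"
    and f: "f \<in> Lp p"
  shows "(LINT x|torus. norm (fourier_sum S c f x) powr p) \<le> K powr (p / q) * (LINT x|torus. norm (f x) powr p)"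
proof -
  have pq: "1 < q" "1 / p + 1 / q = 1" "(p - 1) * q = p" "0 < p" unfolding q using p by (auto simp: field_simps)
  have intf: "integrable torus f" using p by (intro Lp_imp_integrable[OF f]) simp
  have intfp: "integrable torus (\<lambda>x. norm (f x) powr p)" using f by (simp add: Lp_def)
  define g where "g = fourier_sum S c f"
  have gc: "continuous_on UNIV g" unfolding g_def by (intro continuous_intros)
  have [measurable]: "g \<in> borel_measurable torus" by (rule continuous_measurable_torus[OF gc])
  \<comment> \<open>The extremal test function for \<open>g\<close>: its \<open>q\<close>-th power
    has the size of the \<open>p\<close>-th power of \<open>g\<close>, and its pairing with
    \<open>g\<close> is exactly the integral to be bounded.\<close>
  define k where "k x = g x * of_real (norm (g x) powr (p - 2))" for x
  have nk: "norm (k x) = norm (g x) powr (p - 1)" for x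
  proof (cases "g x = 0")
    case False
    have "norm (g x) * norm (g x) powr (p - 2) = norm (g x) powr (p - 1)"
      using False powr_add[of "norm (g x)" 1 "p - 2"] by simp
    then show ?thesis by (simp add: k_def norm_mult)
  qed (simp add: k_def)
  have nkq: "norm (k x) powr q = norm (g x) powr p" for x
    by (simp add: nk powr_powr pq)
  have [measurable]: "k \<in> borel_measurable torus" unfolding k_def[abs_def] by measurable
  have k: "k \<in> Lp q"
    using integrable_norm_powr_continuous[OF gc, of p] pq by (simp add: Lp_def nkq)
  have intk: "integrable torus k" using pq by (intro Lp_imp_integrable[OF k]) simp
  have gk: "g x * cnj (k x) = of_real (norm (g x) powr p)" for x
  proof (cases "g x = 0")
    case False
    have "g x * cnj (k x) = (g x * cnj (g x)) * of_real (norm (g x) powr (p - 2))"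
      by (simp add: k_def)
    also have "\<dots> = of_real ((norm (g x))\<^sup>2 * norm (g x) powr (p - 2))"
      unfolding complex_norm_square[symmetric] of_real_mult ..
    also have "(norm (g x))\<^sup>2 * norm (g x) powr (p - 2) = norm (g x) powr p"
      using False powr_add[of "norm (g x)" 2 "p - 2"] by (simp add: powr_numeral)
    finally show ?thesis by simp
  qed (simp add: k_def)
  define v where "v = fourier_sum S (\<lambda>t. cnj (c t)) k"
  have vc: "continuous_on UNIV v" unfolding v_def by (intro continuous_intros)
  have [measurable]: "v \<in> borel_measurable torus" by (rule continuous_measurable_torus[OF vc])
  define X where "X = (LINT x|torus. norm (g x) powr p)"
  define Y where "Y = (LINT x|torus. norm (f x) powr p)"
  have X0: "0 \<le> X" and Y0: "0 \<le> Y" by (simp_all add: X_def Y_def)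
  have intvf: "integrable torus (\<lambda>x. cnj (v x) * f x)"
  proof (rule integrable_bounded_mult[OF intf])
    show "norm (cnj (v x)) \<le> (\<Sum>t\<in>S. norm (cnj (c t) * fourier_coeff k t))" for x
      unfolding v_def fourier_sum_def complex_mod_cnj by (rule order_trans[OF norm_sum]) (simp add: norm_mult)
    show "(\<lambda>x. cnj (v x)) \<in> borel_measurable torus"
      by (intro continuous_measurable_torus continuous_intros vc)
  qed
  \<comment> \<open>The multiplier moves from \<open>f\<close> to \<open>k\<close> in conjugated
    form, which is the operator the hypothesis \<open>dual\<close> controls. Frequencies are negated
    on the way because the pairing reads off coefficients at \<open>- t\<close>.\<close>
  have adj: "complex_of_real X = (LINT x|torus. cnj (v x) * f x)"
  proof -
    have "complex_of_real X = (LINT x|torus. complex_of_real (norm (g x) powr p))"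
      unfolding X_def by simp
    also have "\<dots> = (LINT x|torus. g x * cnj (k x))" by (simp only: gk)
    also have "\<dots> = (\<Sum>t\<in>S. c t * fourier_coeff f t * cnj (fourier_coeff k t))"
      unfolding g_def fourier_sum_def
      using intk by (subst integral_trig_poly_mult[OF S]) (simp_all add: fourier_coeff_cnj)
    also have "\<dots> = (LINT x|torus. (\<Sum>t\<in>uminus ` S. (c (- t) * cnj (fourier_coeff k (- t))) * character t x) * f x)"
      using S by (subst integral_trig_poly_mult[OF _ intf]) (auto simp: sum.reindex mult_ac)
    also have "\<dots> = (LINT x|torus. cnj (v x) * f x)"
      unfolding v_def fourier_sum_def by (simp add: sum.reindex cnj_character)
    finally show ?thesis .
  qed
  \<comment> \<open>The weight in Young's inequality is chosen so that
    \<open>e powr q * K = 1\<close>: the dual term becomes \<open>X / q\<close>, and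
    \<open>X / p\<close> remains on the left after absorption.\<close>
  define e where "e = K powr (- (1 / q))"
  have e: "0 < e" "e powr q = 1 / K" "e powr (- p) = K powr (p / q)"
  proof -
    show "0 < e" using K by (simp add: e_def)
    have "- (1 / q) * q = - 1" "- (1 / q) * (- p) = p / q" using pq by simp_all
    then show "e powr q = 1 / K" "e powr (- p) = K powr (p / q)"
      unfolding e_def powr_powr using K by (simp_all only: powr_minus_divide powr_one)
  qed
  have young: "norm (f x) * norm (v x) \<le> e powr (- p) / p * norm (f x) powr p + e powr q / q * norm (v x) powr q" for x
  proof -
    have "norm (f x) * norm (v x) = (norm (f x) / e) * (e * norm (v x))" using e by simp
    also have "\<dots> \<le> (norm (f x) / e) powr p / p + (e * norm (v x)) powr q / q"
      using p pq e by (intro Youngs_inequality) auto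
    also have "\<dots> = e powr (- p) / p * norm (f x) powr p + e powr q / q * norm (v x) powr q"
      using e(1) by (simp add: powr_divide powr_mult powr_minus_divide)
    finally show ?thesis .
  qed
  have intv: "integrable torus (\<lambda>x. norm (v x) powr q)"
    using pq by (intro integrable_norm_powr_continuous[OF vc]) auto
  have "X = norm (LINT x|torus. cnj (v x) * f x)" unfolding adj[symmetric] using X0 by simp
  also have "\<dots> \<le> (LINT x|torus. norm (cnj (v x) * f x))" by (rule integral_norm_bound)
  also have "\<dots> \<le> (LINT x|torus. e powr (- p) / p * norm (f x) powr p + e powr q / q * norm (v x) powr q)"
  proof (rule integral_mono)
    show "norm (cnj (v x) * f x) \<le> e powr (- p) / p * norm (f x) powr p + e powr q / q * norm (v x) powr q" for x
      using young[of x] by (simp add: norm_mult mult.commute)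
  qed (use intvf intfp intv in auto)
  also have "\<dots> = e powr (- p) / p * Y + e powr q / q * (LINT x|torus. norm (v x) powr q)"
    using intfp intv by (simp add: Y_def)
  also have "\<dots> \<le> e powr (- p) / p * Y + e powr q / q * (K * X)"
  proof -
    have "(LINT x|torus. norm (v x) powr q) \<le> K * X"
      using dual[OF k] by (simp add: v_def nkq X_def)
    then show ?thesis using pq by (intro add_left_mono mult_left_mono) auto
  qed
  also have "\<dots> = K powr (p / q) / p * Y + X / q" using e K by simp
  finally have "X * (1 - 1 / q) \<le> K powr (p / q) / p * Y" by (simp add: algebra_simps)
  also have "1 - 1 / q = 1 / p" using pq by simp
  finally show ?thesis using pq by (simp add: X_def Y_def g_def field_simps)
qed

section \<open>Convergence in measure\<close>

lemma partial_sum_Lp_bound_low: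
  fixes c :: "int \<Rightarrow> complex"
  assumes pos: "marcinkiewicz_seq A (\<lambda>t. c (int t))"
    and neg: "marcinkiewicz_seq A (\<lambda>t. if t = 0 then 0 else cnj (c (- int t)))"
    and c: "\<And>t. norm (c t) \<le> A" and p: "1 < p" "p < 2"
  obtains K where "0 \<le> K" "\<And>N f. f \<in> Lp p \<Longrightarrow>
    (LINT x|torus. norm (fourier_sum {- int N..int N} c f x) powr p) \<le> K * (LINT x|torus. norm (f x) powr p)"
proof -
  obtain C where C: "0 \<le> C" "\<And>N (f :: real \<Rightarrow> complex) s. integrable torus f \<Longrightarrow> 0 < s \<Longrightarrow>
    s * distribution_fun (fourier_sum {- int N..int N} c f) s \<le> C * (LINT x|torus. norm (f x))"
    using partial_sum_weak_type[OF pos neg] by metis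
  show thesis
  proof
    show "0 \<le> 2 * C * p / (p - 1) + 4 * A\<^sup>2 * p / (2 - p)"
      using p C by (intro add_nonneg_nonneg divide_nonneg_nonneg mult_nonneg_nonneg) auto
    fix N f assume "f \<in> Lp p"
    then show "(LINT x|torus. norm (fourier_sum {- int N..int N} c f x) powr p) \<le>
      (2 * C * p / (p - 1) + 4 * A\<^sup>2 * p / (2 - p)) * (LINT x|torus. norm (f x) powr p)"
      by (intro Lp_bound_low[OF _ c C(2) C(1) p]) auto
  qed
qed

text \<open>At \<open>p = 2\<close> the interpolation constant blows up, and Bessel's inequality
  serves directly. For \<open>p > 2\<close> the conjugated coefficients satisfy both sequence
  conditions again, so the low range provides the dual bound at the conjugate exponent;
  \<open>max 1 K\<close> meets the condition on the constant in the duality lemma.\<close>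

lemma partial_sum_Lp_bound:
  fixes c :: "int \<Rightarrow> complex"
  assumes pos: "marcinkiewicz_seq A (\<lambda>t. c (int t))"
    and neg: "marcinkiewicz_seq A (\<lambda>t. if t = 0 then 0 else cnj (c (- int t)))"
    and c: "\<And>t. norm (c t) \<le> A" and p: "1 < p"
  obtains K where "0 \<le> K" "\<And>N f. f \<in> Lp p \<Longrightarrow>
    (LINT x|torus. norm (fourier_sum {- int N..int N} c f x) powr p) \<le> K * (LINT x|torus. norm (f x) powr p)"
proof -
  consider "p < 2" | "p = 2" | "2 < p" by linarith
  then show thesis
  proof cases
    case 1
    from partial_sum_Lp_bound_low[OF pos neg c p 1] show thesis using that by blast
  next
    case 2
    show thesis
    proof
      show "0 \<le> A\<^sup>2" by simp
      fix N f assume f: "f \<in> Lp p"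
      have "(\<lambda>x. norm (f x) powr 2) = (\<lambda>x. (norm (f x))\<^sup>2)" by (simp add: fun_eq_iff powr_numeral)
      then have "f \<in> borel_measurable torus" "integrable torus (\<lambda>x. (norm (f x))\<^sup>2)"
        using f 2 by (auto simp: Lp_def)
      then show "(LINT x|torus. norm (fourier_sum {- int N..int N} c f x) powr p) \<le> A\<^sup>2 * (LINT x|torus. norm (f x) powr p)"
        unfolding 2 integral_norm_powr_2 by (intro fourier_sum_L2_bound c) auto
    qed
  next
    case 3
    define q where "q = p / (p - 1)"
    have q: "1 < q" "q < 2" using 3 by (auto simp: q_def field_simps)
    have "marcinkiewicz_seq A (\<lambda>t. cnj (c (int t)))" by (rule marcinkiewicz_seq_cnj[OF pos])
    moreover have "marcinkiewicz_seq A (\<lambda>t. if t = 0 then 0 else cnj (cnj (c (- int t))))"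
    proof -
      have "(\<lambda>t. cnj (if t = 0 then 0 else cnj (c (- int t)))) = (\<lambda>t. if t = 0 then 0 else cnj (cnj (c (- int t))))"
        by (simp add: fun_eq_iff)
      then show ?thesis using marcinkiewicz_seq_cnj[OF neg] by simp
    qed
    moreover have "norm (cnj (c t)) \<le> A" for t using c by simp
    ultimately obtain K where K: "0 \<le> K" "\<And>N f. f \<in> Lp q \<Longrightarrow>
      (LINT x|torus. norm (fourier_sum {- int N..int N} (\<lambda>t. cnj (c t)) f x) powr q) \<le> K * (LINT x|torus. norm (f x) powr q)"
      using partial_sum_Lp_bound_low[of A "\<lambda>t. cnj (c t)" q] q by metis
    show thesis
    proof
      show "0 \<le> (max 1 K) powr (p / q)" by simp
      fix N f assume f: "f \<in> Lp p"
      show "(LINT x|torus. norm (fourier_sum {- int N..int N} c f x) powr p) \<le> (max 1 K) powr (p / q) * (LINT x|torus. norm (f x) powr p)"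
      proof (rule Lp_bound_high[OF _ 3 q_def _ _ f])
        fix k assume "k \<in> Lp q"
        then have "(LINT x|torus. norm (fourier_sum {- int N..int N} (\<lambda>t. cnj (c t)) k x) powr q) \<le> K * (LINT x|torus. norm (k x) powr q)"
          by (rule K(2))
        also have "\<dots> \<le> max 1 K * (LINT x|torus. norm (k x) powr q)"
          by (intro mult_right_mono) auto
        finally show "(LINT x|torus. norm (fourier_sum {- int N..int N} (\<lambda>t. cnj (c t)) k x) powr q) \<le> max 1 K * (LINT x|torus. norm (k x) powr q)" .
      qed auto
    qed
  qed
qed

section \<open>Borel-Cantelli, subsequences and completeness for convergence in measure\<close>

lemma AE_eventually_small:
  fixes G :: "nat \<Rightarrow> real \<Rightarrow> complex"
  assumes [measurable]: "\<And>k. G k \<in> borel_measurable torus" and "\<And>k. distribution_fun (G k) ((1/2) ^ k) \<le> (1/2) ^ k"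
  shows "AE x in torus. eventually (\<lambda>k. norm (G k x) \<le> (1/2) ^ k) sequentially"
proof -
  define E where "E k = {x \<in> space torus. (1/2) ^ k < norm (G k x)}" for k
  have sets: "E k \<in> sets torus" for k unfolding E_def by measurable
  have "summable (\<lambda>k. measure torus (E k))"
  proof (rule summable_comparison_test[OF _ summable_geometric[of "1/2 :: real"]])
    show "\<exists>N. \<forall>n\<ge>N. norm (measure torus (E n)) \<le> (1/2) ^ n"
      using assms(2) by (simp add: distribution_fun_def E_def)
  qed simp
  with sets have "AE x in torus. eventually (\<lambda>k. x \<in> space torus - E k) sequentially"
    by (intro borel_cantelli_AE1) (auto simp: less_top[symmetric])
  then show ?thesis
  proof (rule AE_mp, intro AE_I2 impI)
    fix x assume "\<forall>\<^sub>F k in sequentially. x \<in> space torus - E k"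
    then show "\<forall>\<^sub>F k in sequentially. norm (G k x) \<le> (1/2) ^ k"
      by (rule eventually_mono) (auto simp: E_def)
  qed
qed

text \<open>Riesz's argument: the terms are picked with summable exceptional sets. The indices
  \<open>r k\<close> are not claimed to increase, as only the existence of an approximating sequence
  is used later.\<close>

lemma converges_in_measure_AE_subseq:
  assumes F: "\<And>N. F N \<in> borel_measurable torus" and "converges_in_measure F g"
  obtains r where "AE x in torus. (\<lambda>k. F (r k) x) \<longlonglongrightarrow> g x"
proof -
  have g: "g \<in> borel_measurable torus"
    and lim: "\<And>\<epsilon>. 0 < \<epsilon> \<Longrightarrow> (\<lambda>N. distribution_fun (\<lambda>x. F N x - g x) \<epsilon>) \<longlonglongrightarrow> 0"
    using assms(2) by (auto simp: converges_in_measure_def)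
  have "\<exists>N. distribution_fun (\<lambda>x. F N x - g x) ((1/2) ^ k) \<le> (1/2) ^ k" for k
  proof -
    have "eventually (\<lambda>N. distribution_fun (\<lambda>x. F N x - g x) ((1/2) ^ k) < (1/2) ^ k) sequentially"
      using lim[of "(1/2) ^ k"] by (rule order_tendstoD) simp_all
    then show ?thesis unfolding eventually_sequentially by (meson less_imp_le order_refl)
  qed
  then obtain r where r: "\<And>k. distribution_fun (\<lambda>x. F (r k) x - g x) ((1/2) ^ k) \<le> (1/2) ^ k" by metis
  have "AE x in torus. eventually (\<lambda>k. norm (F (r k) x - g x) \<le> (1/2) ^ k) sequentially"
    by (rule AE_eventually_small[OF _ r]) (intro borel_measurable_diff F g)
  then have "AE x in torus. (\<lambda>k. F (r k) x) \<longlonglongrightarrow> g x"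
  proof (rule AE_mp, intro AE_I2 impI)
    fix x assume "\<forall>\<^sub>F k in sequentially. norm (F (r k) x - g x) \<le> (1/2) ^ k"
    then have "(\<lambda>k. F (r k) x - g x) \<longlonglongrightarrow> 0"
      by (rule Lim_null_comparison) (simp add: LIMSEQ_power_zero)
    then show "(\<lambda>k. F (r k) x) \<longlonglongrightarrow> g x" by (rule LIM_zero_cancel)
  qed
  then show thesis by (rule that)
qed

lemma AE_tendsto_imp_in_measure:
  fixes F :: "nat \<Rightarrow> real \<Rightarrow> complex"
  assumes [measurable]: "\<And>N. F N \<in> borel_measurable torus" "g \<in> borel_measurable torus"
    and lim: "AE x in torus. (\<lambda>k. F k x) \<longlonglongrightarrow> g x" and "0 < \<epsilon>"
  shows "(\<lambda>k. distribution_fun (\<lambda>x. F k x - g x) \<epsilon>) \<longlonglongrightarrow> 0"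
proof -
  define E where "E k = {x \<in> space torus. \<epsilon> < norm (F k x - g x)}" for k
  have sets [measurable]: "E k \<in> sets torus" for k unfolding E_def by measurable
  have "(\<lambda>k. LINT x|torus. indicator (E k) x) \<longlonglongrightarrow> (LINT x|torus. (0::real))"
  proof (rule integral_dominated_convergence[where w = "\<lambda>_. 1"])
    show "AE x in torus. (\<lambda>k. indicator (E k) x) \<longlonglongrightarrow> (0::real)"
      using lim
    proof (rule AE_mp, intro AE_I2 impI)
      fix x assume "(\<lambda>k. F k x) \<longlonglongrightarrow> g x"
      then have "(\<lambda>k. norm (F k x - g x)) \<longlonglongrightarrow> 0"
        using LIM_zero tendsto_norm_zero by blast
      then have "eventually (\<lambda>k. norm (F k x - g x) < \<epsilon>) sequentially"
        using \<open>0 < \<epsilon>\<close> by (rule order_tendstoD)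
      then have "eventually (\<lambda>k. indicator (E k) x = (0::real)) sequentially"
        by (rule eventually_mono) (auto simp: E_def)
      then show "(\<lambda>k. indicator (E k) x) \<longlonglongrightarrow> (0::real)" by (rule tendsto_eventually)
    qed
  qed (auto split: split_indicator)
  moreover have "(LINT x|torus. indicator (E k) x) = distribution_fun (\<lambda>x. F k x - g x) \<epsilon>" for k
  proof -
    have "E k \<inter> {0..<1} = E k" by (auto simp: E_def)
    then show ?thesis using sets[of k] by (simp add: distribution_fun_def E_def)
  qed
  ultimately show ?thesis by simp
qed

text \<open>Completeness: a rapidly Cauchy subsequence converges almost everywhere by Borel-Cantelli
  and a geometric series, and the Cauchy property carries convergence over to the full
  sequence.\<close>

lemma cauchy_in_measure_imp_converges:
  fixes F :: "nat \<Rightarrow> real \<Rightarrow> complex"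
  assumes F [measurable]: "\<And>N. F N \<in> borel_measurable torus"
    and cauchy: "\<And>\<epsilon> \<delta>. 0 < \<epsilon> \<Longrightarrow> 0 < \<delta> \<Longrightarrow>
      \<exists>N0. \<forall>m\<ge>N0. \<forall>n\<ge>N0. distribution_fun (\<lambda>x. F m x - F n x) \<epsilon> \<le> \<delta>"
  shows "\<exists>g. converges_in_measure F g"
proof -
  have "\<exists>N0. \<forall>m\<ge>N0. \<forall>n\<ge>N0. distribution_fun (\<lambda>x. F m x - F n x) ((1/2) ^ k) \<le> (1/2) ^ k" for k
    by (rule cauchy) auto
  then obtain N0 where N0: "\<And>k m n. N0 k \<le> m \<Longrightarrow> N0 k \<le> n \<Longrightarrow>
      distribution_fun (\<lambda>x. F m x - F n x) ((1/2) ^ k) \<le> (1/2) ^ k" by metis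
  \<comment> \<open>Summing the thresholds makes the indices monotone and at least
    \<open>N0 k\<close>; the summand \<open>k\<close> makes them unbounded.\<close>
  define r where "r k = k + (\<Sum>i\<le>k. N0 i)" for k
  have r: "N0 k \<le> r k" "r k \<le> r (Suc k)" "k \<le> r k" for k
    unfolding r_def by (auto intro: trans_le_add2 member_le_sum)
  have "AE x in torus. eventually (\<lambda>k. norm (F (r (Suc k)) x - F (r k) x) \<le> (1/2) ^ k) sequentially"
  proof (rule AE_eventually_small)
    show "distribution_fun (\<lambda>x. F (r (Suc k)) x - F (r k) x) ((1/2) ^ k) \<le> (1/2) ^ k" for k
      using r[of k] by (intro N0) auto
  qed measurable
  then have conv: "AE x in torus. (\<lambda>k. F (r k) x) \<longlonglongrightarrow> lim (\<lambda>k. F (r k) x)"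
  proof (rule AE_mp, intro AE_I2 impI)
    fix x assume ev: "\<forall>\<^sub>F k in sequentially. norm (F (r (Suc k)) x - F (r k) x) \<le> (1/2) ^ k"
    have "summable (\<lambda>k. F (r (Suc k)) x - F (r k) x)"
      by (rule summable_comparison_test_ev[OF ev]) (simp add: summable_geometric)
    then have "convergent (\<lambda>n. \<Sum>k<n. F (r (Suc k)) x - F (r k) x)"
      by (simp add: summable_iff_convergent)
    then have "convergent (\<lambda>n. F (r n) x - F (r 0) x)"
      unfolding sum_lessThan_telescope[of "\<lambda>n. F (r n) x"] .
    then have "convergent (\<lambda>n. F (r n) x)"
      using convergent_add[OF _ convergent_const[of "F (r 0) x"]] by fastforce
    then show "(\<lambda>k. F (r k) x) \<longlonglongrightarrow> lim (\<lambda>k. F (r k) x)" by (rule convergent_LIMSEQ_iff[THEN iffD1])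
  qed
  define g where "g x = lim (\<lambda>k. F (r k) x)" for x
  have g [measurable]: "g \<in> borel_measurable torus" unfolding g_def[abs_def] by measurable
  have sub: "(\<lambda>k. distribution_fun (\<lambda>x. F (r k) x - g x) \<epsilon>) \<longlonglongrightarrow> 0" if "0 < \<epsilon>" for \<epsilon>
    by (rule AE_tendsto_imp_in_measure) (use conv that in \<open>auto simp: g_def\<close>)
  have "(\<lambda>N. distribution_fun (\<lambda>x. F N x - g x) \<epsilon>) \<longlonglongrightarrow> 0" if e: "0 < \<epsilon>" for \<epsilon>
  proof (rule LIMSEQ_I)
    fix d :: real assume d: "0 < d"
    obtain M where M: "\<And>m n. M \<le> m \<Longrightarrow> M \<le> n \<Longrightarrow> distribution_fun (\<lambda>x. F m x - F n x) (\<epsilon> / 2) \<le> d / 3"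
      using cauchy[of "\<epsilon> / 2" "d / 3"] e d by auto
    have "eventually (\<lambda>k. distribution_fun (\<lambda>x. F (r k) x - g x) (\<epsilon> / 2) < d / 3) sequentially"
      using sub[of "\<epsilon> / 2"] by (rule order_tendstoD) (use e d in auto)
    then obtain k where k: "M \<le> k" "distribution_fun (\<lambda>x. F (r k) x - g x) (\<epsilon> / 2) < d / 3"
      unfolding eventually_sequentially by (meson nle_le)
    have "norm (distribution_fun (\<lambda>x. F n x - g x) \<epsilon> - 0) < d" if "M \<le> n" for n
    proof -
      have "distribution_fun (\<lambda>x. F n x - g x) (\<epsilon> / 2 + \<epsilon> / 2) \<le>
        distribution_fun (\<lambda>x. F n x - F (r k) x) (\<epsilon> / 2) + distribution_fun (\<lambda>x. F (r k) x - g x) (\<epsilon> / 2)"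
      proof (rule distribution_fun_add_le)
        show "norm (F n x - g x) \<le> norm (F n x - F (r k) x) + norm (F (r k) x - g x)" for x
          using norm_triangle_ineq[of "F n x - F (r k) x" "F (r k) x - g x"] by simp
      qed measurable
      moreover have "distribution_fun (\<lambda>x. F n x - F (r k) x) (\<epsilon> / 2) \<le> d / 3"
        using that k(1) r(3)[of k] by (intro M) auto
      ultimately show ?thesis using k(2) d distribution_fun_nonneg[of "\<lambda>x. F n x - g x" \<epsilon>] by simp
    qed
    then show "\<exists>no. \<forall>n\<ge>no. norm (distribution_fun (\<lambda>x. F n x - g x) \<epsilon> - 0) < d" by blast
  qed
  then show ?thesis using g unfolding converges_in_measure_def by blast
qed

text \<open>At a large height \<open>n\<close> the function splits into a part \<open>g\<close> of
  small integral, on which the weak bound is uniform in the length of the sum, and a bounded part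
  \<open>h\<close>, for which the \<open>L^2\<close> distance of two partial sums is controlled by a
  tail of the Bessel series.\<close>

lemma partial_sums_converge_in_measure:
  fixes c :: "int \<Rightarrow> complex"
  assumes c: "\<And>t. norm (c t) \<le> A" and C: "0 \<le> C"
    and weak: "\<And>N (f :: real \<Rightarrow> complex) s. integrable torus f \<Longrightarrow> 0 < s \<Longrightarrow>
      s * distribution_fun (fourier_sum {- int N..int N} c f) s \<le> C * (LINT x|torus. norm (f x))"
    and f: "integrable torus f"
  shows "\<exists>g. converges_in_measure (\<lambda>N. fourier_sum {- int N..int N} c f) g"
proof (rule cauchy_in_measure_imp_converges)
  fix \<epsilon> \<delta> :: real assume e: "0 < \<epsilon>" and d: "0 < \<delta>"
  let ?S = "\<lambda>N. fourier_sum {- int N..int N} c"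
  have [measurable]: "f \<in> borel_measurable torus" using f by simp
  \<comment> \<open>One third of the level for the difference on \<open>h\<close>, and one for each
    of the two partial sums of \<open>g\<close>.\<close>
  define e3 where "e3 = \<epsilon> / 3"
  have e3: "0 < e3" "\<epsilon> = e3 + (e3 + e3)" using e by (auto simp: e3_def)
  have "(\<lambda>n. LINT x|torus. (if real n < norm (f x) then norm (f x) else 0)) \<longlonglongrightarrow> (LINT x|torus. 0)"
  proof (rule integral_dominated_convergence[where w = "\<lambda>x. norm (f x)"])
    show "AE x in torus. (\<lambda>n. if real n < norm (f x) then norm (f x) else 0) \<longlonglongrightarrow> 0"
    proof (rule AE_I2)
      fix x
      obtain n where "norm (f x) \<le> real n" using real_arch_simple by blast
      then have "eventually (\<lambda>n. (if real n < norm (f x) then norm (f x) else 0) = 0) sequentially"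
        unfolding eventually_sequentially by (intro exI[of _ n]) auto
      then show "(\<lambda>n. if real n < norm (f x) then norm (f x) else 0) \<longlonglongrightarrow> 0" by (rule tendsto_eventually)
    qed
  qed (use f in auto)
  \<comment> \<open>\<open>C + 1\<close> guards against division by zero; \<open>A^2 + 1\<close> has
    the same purpose in the estimate for \<open>h\<close>.\<close>
  moreover have "0 < \<delta> * e3 / (3 * (C + 1))" using d e3 C by simp
  ultimately have "eventually (\<lambda>n. (LINT x|torus. (if real n < norm (f x) then norm (f x) else 0)) < \<delta> * e3 / (3 * (C + 1))) sequentially"
    by (intro order_tendstoD(2)) auto
  then obtain n where n: "(LINT x|torus. (if real n < norm (f x) then norm (f x) else 0)) < \<delta> * e3 / (3 * (C + 1))"
    unfolding eventually_sequentially by blast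
  define g where "g x = (if real n < norm (f x) then f x else 0)" for x
  define h where "h x = (if real n < norm (f x) then 0 else f x)" for x
  have [measurable]: "g \<in> borel_measurable torus" "h \<in> borel_measurable torus"
    unfolding g_def[abs_def] h_def[abs_def] by measurable
  have g: "integrable torus g" by (rule Bochner_Integration.integrable_bound[OF f]) (auto simp: g_def)
  have h: "integrable torus h" by (rule Bochner_Integration.integrable_bound[OF f]) (auto simp: h_def)
  have h2: "integrable torus (\<lambda>x. (norm (h x))\<^sup>2)"
  proof (rule integrable_torus_bounded[where B = "(real n)\<^sup>2"])
    show "norm ((norm (h x))\<^sup>2) \<le> (real n)\<^sup>2" for x
      by (auto simp: h_def intro!: power_mono)
  qed measurable
  have "(LINT x|torus. norm (g x)) = (LINT x|torus. (if real n < norm (f x) then norm (f x) else 0))"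
    by (intro Bochner_Integration.integral_cong) (auto simp: g_def)
  then have gI: "(C + 1) * (LINT x|torus. norm (g x)) \<le> \<delta> * e3 / 3"
    using n C by (simp add: field_simps)
  have gN: "distribution_fun (?S N g) e3 \<le> \<delta> / 3" for N
  proof -
    have "e3 * distribution_fun (?S N g) e3 \<le> C * (LINT x|torus. norm (g x))" by (rule weak[OF g e3(1)])
    also have "\<dots> \<le> (C + 1) * (LINT x|torus. norm (g x))" by (intro mult_right_mono) auto
    also note gI
    finally show ?thesis using e3(1) by (simp add: field_simps)
  qed
  have split: "?S N f x = ?S N g x + ?S N h x" for N x
  proof -
    have "f = (\<lambda>x. g x + h x)" by (auto simp: g_def h_def)
    then show ?thesis using fourier_sum_add[OF g h] by simp
  qed
  define b where "b N = (\<Sum>t\<in>{- int N..int N}. (norm (fourier_coeff h t))\<^sup>2)" for N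
  have "convergent b"
  proof (rule Bseq_mono_convergent)
    show "\<forall>m n. m \<le> n \<longrightarrow> b m \<le> b n" unfolding b_def by (intro allI impI sum_mono2) auto
    show "Bseq b"
    proof (rule BseqI')
      show "norm (b N) \<le> (LINT x|torus. (norm (h x))\<^sup>2)" for N
        using Bessel_inequality[of "{- int N..int N}" h] h2 by (simp add: b_def sum_nonneg)
    qed
  qed
  then have "Cauchy b" by (rule convergent_Cauchy)
  moreover have "0 < \<delta> * e3\<^sup>2 / (3 * (A\<^sup>2 + 1))" using d e3 by (intro divide_pos_pos mult_pos_pos) (auto simp: add_nonneg_pos)
  ultimately obtain N0 where N0: "\<And>m n. N0 \<le> m \<Longrightarrow> N0 \<le> n \<Longrightarrow> norm (b m - b n) < \<delta> * e3\<^sup>2 / (3 * (A\<^sup>2 + 1))"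
    using CauchyD by blast
  have hN: "distribution_fun (\<lambda>x. ?S m h x - ?S n h x) e3 \<le> \<delta> / 3" if mn: "N0 \<le> n" "n \<le> m" for m n
  proof -
    define D where "D = {- int m..int m} - {- int n..int n}"
    have sub: "{- int n..int n} \<subseteq> {- int m..int m}" using mn by auto
    have eq: "(\<lambda>x. ?S m h x - ?S n h x) = (\<lambda>x. \<Sum>t\<in>D. c t * fourier_coeff h t * character t x)"
      unfolding fourier_sum_def D_def using sub by (auto simp: sum_diff)
    have "distribution_fun (\<lambda>x. ?S m h x - ?S n h x) e3 \<le> (LINT x|torus. (norm (?S m h x - ?S n h x))\<^sup>2) / e3\<^sup>2"
      by (intro distribution_fun_chebyshev e3 integrable_torus_continuous continuous_measurable_torus continuous_intros)
    also have "(LINT x|torus. (norm (?S m h x - ?S n h x))\<^sup>2) = (\<Sum>t\<in>D. (norm (c t * fourier_coeff h t))\<^sup>2)"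
      unfolding eq[unfolded fun_eq_iff, rule_format] by (rule integral_norm_square_trig_poly) (simp add: D_def)
    also have "\<dots> \<le> (\<Sum>t\<in>D. (A\<^sup>2 + 1) * (norm (fourier_coeff h t))\<^sup>2)"
    proof (rule sum_mono)
      fix t
      have "(norm (c t))\<^sup>2 \<le> A\<^sup>2" using c by (intro power_mono) auto
      then have "(norm (c t))\<^sup>2 * (norm (fourier_coeff h t))\<^sup>2 \<le> (A\<^sup>2 + 1) * (norm (fourier_coeff h t))\<^sup>2"
        by (intro mult_right_mono) auto
      then show "(norm (c t * fourier_coeff h t))\<^sup>2 \<le> (A\<^sup>2 + 1) * (norm (fourier_coeff h t))\<^sup>2"
        by (simp add: norm_mult power_mult_distrib)
    qed
    also have "\<dots> = (A\<^sup>2 + 1) * (b m - b n)"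
      unfolding b_def D_def using sub by (simp add: sum_diff sum_distrib_left[symmetric])
    also have "\<dots> \<le> (A\<^sup>2 + 1) * (\<delta> * e3\<^sup>2 / (3 * (A\<^sup>2 + 1)))"
      using N0[of m n] mn by (intro mult_left_mono) (auto simp: add_nonneg_nonneg)
    also have "\<dots> = \<delta> * e3\<^sup>2 / 3"
    proof -
      have "A\<^sup>2 + 1 \<noteq> 0" using zero_le_power2[of A] by linarith
      moreover have "w * (z / (3 * w)) = z / 3" if "w \<noteq> 0" for w z :: real using that by simp
      ultimately show ?thesis by blast
    qed
    finally show ?thesis using e3(1) by (simp add: divide_right_mono field_simps)
  qed
  have sym: "distribution_fun (\<lambda>x. u x - v x) s = distribution_fun (\<lambda>x. v x - u x) s" for u v s
    by (rule distribution_fun_cong) (rule norm_minus_commute)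
  have "distribution_fun (\<lambda>x. ?S m f x - ?S n f x) \<epsilon> \<le> \<delta>" if mn: "N0 \<le> m" "N0 \<le> n" for m n
  proof -
    have H: "distribution_fun (\<lambda>x. ?S m h x - ?S n h x) e3 \<le> \<delta> / 3"
      using hN[of n m] hN[of m n] mn sym[of "?S m h" "?S n h"] by (cases "n \<le> m") auto
    have "distribution_fun (\<lambda>x. ?S m f x - ?S n f x) (e3 + (e3 + e3)) \<le>
      distribution_fun (\<lambda>x. ?S m h x - ?S n h x) e3 + distribution_fun (\<lambda>x. ?S m g x - ?S n g x) (e3 + e3)"
    proof (rule distribution_fun_add_le)
      show "norm (?S m f x - ?S n f x) \<le> norm (?S m h x - ?S n h x) + norm (?S m g x - ?S n g x)" for x
        unfolding split using norm_triangle_ineq[of "?S m h x - ?S n h x" "?S m g x - ?S n g x"]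
        by (simp add: algebra_simps)
    qed measurable
    also have "distribution_fun (\<lambda>x. ?S m g x - ?S n g x) (e3 + e3) \<le>
      distribution_fun (?S m g) e3 + distribution_fun (?S n g) e3"
      by (rule distribution_fun_add_le) (auto simp: norm_triangle_ineq4)
    finally show ?thesis using H gN[of m] gN[of n] by (simp add: e3(2))
  qed
  then show "\<exists>N0. \<forall>m\<ge>N0. \<forall>n\<ge>N0. distribution_fun (\<lambda>x. ?S m f x - ?S n f x) \<epsilon> \<le> \<delta>" by blast
qed measurable

text \<open>The level \<open>a\<close> is divided into \<open>a - d\<close> for the approximant and
  \<open>d\<close> for the error, which vanishes as \<open>N\<close> grows. The lost amount
  \<open>d * distribution_fun g a\<close> is at most \<open>d\<close>, so the bound survives with
  the same constant.\<close>

lemma weak_bound_limit: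
  fixes F :: "nat \<Rightarrow> real \<Rightarrow> complex"
  assumes F: "\<And>N. F N \<in> borel_measurable torus" and lim: "converges_in_measure F g"
    and bound: "\<And>N s. 0 < s \<Longrightarrow> s * distribution_fun (F N) s \<le> B" and a: "0 < a"
  shows "a * distribution_fun g a \<le> B"
proof (rule field_le_epsilon)
  fix e :: real assume e: "0 < e"
  define d where "d = min e (a / 2)"
  have d: "0 < d" "d < a" "d \<le> e" using e a by (auto simp: d_def)
  have g: "g \<in> borel_measurable torus" using lim by (simp add: converges_in_measure_def)
  have "distribution_fun g a \<le> B / (a - d) + distribution_fun (\<lambda>x. F N x - g x) d" for N
  proof -
    have "distribution_fun g ((a - d) + d) \<le> distribution_fun (F N) (a - d) + distribution_fun (\<lambda>x. F N x - g x) d"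
    proof (rule distribution_fun_add_le)
      show "norm (g x) \<le> norm (F N x) + norm (F N x - g x)" for x
        using norm_triangle_ineq4[of "F N x" "F N x - g x"] by simp
    qed (use F g in auto)
    moreover have "distribution_fun (F N) (a - d) \<le> B / (a - d)"
      using bound[of "a - d" N] d by (simp add: field_simps)
    ultimately show ?thesis by simp
  qed
  moreover have "(\<lambda>N. B / (a - d) + distribution_fun (\<lambda>x. F N x - g x) d) \<longlonglongrightarrow> B / (a - d) + 0"
    using lim d by (intro tendsto_intros) (auto simp: converges_in_measure_def)
  ultimately have "distribution_fun g a \<le> B / (a - d) + 0"
    by (intro LIMSEQ_le_const) auto
  then have "(a - d) * distribution_fun g a \<le> B" using d by (simp add: field_simps)
  moreover have "d * distribution_fun g a \<le> e * 1"
    using d distribution_fun_le_1 distribution_fun_nonneg by (intro mult_mono) auto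
  ultimately show "a * distribution_fun g a \<le> B + e" by (simp add: algebra_simps)
qed

text \<open>Fatou's lemma along an almost everywhere convergent choice of terms. It works with
  nonnegative integrals, so membership of the limit in \<open>Lp p\<close> comes out of the same
  bound.\<close>

lemma Lp_bound_limit:
  fixes F :: "nat \<Rightarrow> real \<Rightarrow> complex"
  assumes F: "\<And>N. continuous_on UNIV (F N)" and lim: "converges_in_measure F g"
    and p: "0 < p" and bound: "\<And>N. (LINT x|torus. norm (F N x) powr p) \<le> B"
  shows "g \<in> Lp p" "(LINT x|torus. norm (g x) powr p) \<le> B"
proof -
  have Fm [measurable]: "F N \<in> borel_measurable torus" for N by (rule continuous_measurable_torus[OF F])
  have [measurable]: "g \<in> borel_measurable torus" using lim by (simp add: converges_in_measure_def)
  obtain r where r: "AE x in torus. (\<lambda>k. F (r k) x) \<longlonglongrightarrow> g x"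
    using converges_in_measure_AE_subseq[OF Fm lim] by blast
  have B: "0 \<le> B" using bound[of 0] by (rule order_trans[rotated]) simp
  have "(\<integral>\<^sup>+x. ennreal (norm (g x) powr p) \<partial>torus) = (\<integral>\<^sup>+x. liminf (\<lambda>k. ennreal (norm (F (r k) x) powr p)) \<partial>torus)"
  proof (rule nn_integral_cong_AE, rule AE_mp[OF r], intro AE_I2 impI)
    fix x assume "(\<lambda>k. F (r k) x) \<longlonglongrightarrow> g x"
    then have "(\<lambda>k. ennreal (norm (F (r k) x) powr p)) \<longlonglongrightarrow> ennreal (norm (g x) powr p)"
      using p by (intro tendsto_ennrealI tendsto_powr2 tendsto_norm tendsto_const) auto
    then show "ennreal (norm (g x) powr p) = liminf (\<lambda>k. ennreal (norm (F (r k) x) powr p))"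
      by (intro lim_imp_Liminf[symmetric]) auto
  qed
  also have "\<dots> \<le> liminf (\<lambda>k. \<integral>\<^sup>+x. ennreal (norm (F (r k) x) powr p) \<partial>torus)"
    by (rule nn_integral_liminf) measurable
  also have "\<dots> \<le> ennreal B"
  proof (rule Liminf_le)
    have "(\<integral>\<^sup>+x. ennreal (norm (F (r k) x) powr p) \<partial>torus) \<le> ennreal B" for k
    proof -
      have "(\<integral>\<^sup>+x. ennreal (norm (F (r k) x) powr p) \<partial>torus) = ennreal (LINT x|torus. norm (F (r k) x) powr p)"
        using p by (intro nn_integral_eq_integral integrable_norm_powr_continuous F) auto
      then show ?thesis using bound by (simp add: ennreal_leI)
    qed
    then show "\<forall>\<^sub>F k in sequentially. (\<integral>\<^sup>+x. ennreal (norm (F (r k) x) powr p) \<partial>torus) \<le> ennreal B" by simp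
  qed simp
  finally have le: "(\<integral>\<^sup>+x. ennreal (norm (g x) powr p) \<partial>torus) \<le> ennreal B" .
  then have int: "integrable torus (\<lambda>x. norm (g x) powr p)"
    by (intro integrableI_bounded) (auto simp: le_less_trans)
  then show "g \<in> Lp p" by (simp add: Lp_def)
  have "(\<integral>\<^sup>+x. ennreal (norm (g x) powr p) \<partial>torus) = ennreal (LINT x|torus. norm (g x) powr p)"
    by (rule nn_integral_eq_integral[OF int]) auto
  then show "(LINT x|torus. norm (g x) powr p) \<le> B" using le B by simp
qed

text \<open>The convergence clause guarantees that the chosen function really is the sum of the
  series in measure; it gives the two boundedness clauses their meaning.\<close>

theorem theorem5p3:
  fixes m :: "real \<Rightarrow> complex"
  assumes "marcinkiewicz_multiplier m"
  shows "(\<forall>f\<in>Lp 1. converges_in_measure (multiplier_partial_sum m f) (multiplier_op m f)) \<and>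
    maps_boundedly (multiplier_op m) (Lp 1) (Lp_norm 1) weak_L1 weak_L1_norm \<and>
    (\<forall>p>1. maps_boundedly (multiplier_op m) (Lp p) (Lp_norm p) (Lp p) (Lp_norm p))"
proof -
  define c where "c t = m (of_int t)" for t :: int
  obtain A where pos: "marcinkiewicz_seq A (\<lambda>t. c (int t))"
    and neg: "marcinkiewicz_seq A (\<lambda>t. if t = 0 then 0 else cnj (c (- int t)))"
    and m: "\<And>t. norm (m t) \<le> A"
    using marcinkiewicz_multiplier_seq[OF assms] unfolding c_def by metis
  have c: "norm (c t) \<le> A" for t by (simp add: c_def m)
  have psum: "multiplier_partial_sum m f = (\<lambda>N. fourier_sum {- int N..int N} c f)" for f
    by (simp add: multiplier_partial_sum_def fourier_sum_def c_def fun_eq_iff)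
  obtain C where C: "0 \<le> C" and weak: "\<And>N (f :: real \<Rightarrow> complex) s. integrable torus f \<Longrightarrow> 0 < s \<Longrightarrow>
    s * distribution_fun (fourier_sum {- int N..int N} c f) s \<le> C * (LINT x|torus. norm (f x))"
    using partial_sum_weak_type[OF pos neg] by metis
  \<comment> \<open>Existence of a limit justifies the choice. Everything below uses only
    convergence in measure of the chosen function, so it holds for whichever representative is
    picked.\<close>
  have conv: "converges_in_measure (multiplier_partial_sum m f) (multiplier_op m f)" if "integrable torus f" for f
    unfolding multiplier_op_def psum
    by (rule someI_ex[OF partial_sums_converge_in_measure[OF c C weak that]])
  have meas: "multiplier_partial_sum m f N \<in> borel_measurable torus" for f N
    unfolding psum by measurable
  have "maps_boundedly (multiplier_op m) (Lp 1) (Lp_norm 1) weak_L1 weak_L1_norm"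
    unfolding maps_boundedly_def
  proof (intro exI[of _ C] ballI conjI)
    fix f assume f: "f \<in> Lp 1"
    then have int: "integrable torus f" by (rule Lp_imp_integrable) simp
    have norm1: "Lp_norm 1 f = (LINT x|torus. norm (f x))" by (simp add: Lp_norm_def)
    have bound: "a * distribution_fun (multiplier_op m f) a \<le> C * Lp_norm 1 f" if "0 < a" for a
      unfolding norm1
      by (rule weak_bound_limit[OF meas conv[OF int] _ that]) (auto simp: psum intro: weak[OF int])
    have "multiplier_op m f \<in> borel_measurable torus"
      using conv[OF int] by (simp add: converges_in_measure_def)
    moreover have "bdd_above ((\<lambda>a. a * distribution_fun (multiplier_op m f) a) ` {0<..})"
      by (rule bdd_aboveI2[where M = "C * Lp_norm 1 f"]) (simp add: bound)
    ultimately show "multiplier_op m f \<in> weak_L1" by (simp add: weak_L1_def)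
    show "weak_L1_norm (multiplier_op m f) \<le> C * Lp_norm 1 f"
      unfolding weak_L1_norm_def by (rule cSUP_least) (auto simp: bound)
  qed
  moreover have "maps_boundedly (multiplier_op m) (Lp p) (Lp_norm p) (Lp p) (Lp_norm p)" if p: "1 < p" for p
  proof -
    obtain K where K: "0 \<le> K" "\<And>N f. f \<in> Lp p \<Longrightarrow>
      (LINT x|torus. norm (fourier_sum {- int N..int N} c f x) powr p) \<le> K * (LINT x|torus. norm (f x) powr p)"
      using partial_sum_Lp_bound[OF pos neg c p] by metis
    show ?thesis
      unfolding maps_boundedly_def
    \<comment> \<open>The earlier bounds compare \<open>p\<close>-th powers; taking roots turns
      \<open>K\<close> into this constant.\<close>
    proof (intro exI[of _ "K powr (1 / p)"] ballI conjI)
      fix f assume f: "f \<in> Lp p"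
      then have int: "integrable torus f" using p by (intro Lp_imp_integrable) auto
      have cont: "continuous_on UNIV (multiplier_partial_sum m f N)" for N
        unfolding psum by (intro continuous_intros)
      have bound: "(LINT x|torus. norm (multiplier_partial_sum m f N x) powr p) \<le> K * (LINT x|torus. norm (f x) powr p)" for N
        unfolding psum by (rule K(2)[OF f])
      have p0: "0 < p" using p by simp
      note lim = Lp_bound_limit[OF cont conv[OF int] p0 bound]
      show "multiplier_op m f \<in> Lp p" by (rule lim(1))
      have "Lp_norm p (multiplier_op m f) \<le> (K * (LINT x|torus. norm (f x) powr p)) powr (1 / p)"
        unfolding Lp_norm_def using lim(2) p by (intro powr_mono2) auto
      also have "\<dots> = K powr (1 / p) * Lp_norm p f"
        unfolding Lp_norm_def by (rule powr_mult)
      finally show "Lp_norm p (multiplier_op m f) \<le> K powr (1 / p) * Lp_norm p f" .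
    qed
  qed
  ultimately show ?thesis using conv Lp_imp_integrable[of _ 1] by auto
qed

end
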